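(* Let $G$ be the group of homeomorphisms of $2^{\mathbb{N}}$ generated by $S=X\cup Y$, and let $G_0$ be the group generated by $S_0=X\cup Y_0$. Let $R$ be the set of all relations (1)--(5) listed in the context, and let $R_0$ be the set of those relations in $R$ which only refer to generators in $S_0$. Then the relations $R$ (on the generating set $S$) give a presentation for $G$, and the relations $R_0$ (on the generating set $S_0$) give a presentation for $G_0$. Moreover, $G$ and $G_0$ admit finite presentations.
   Context: $2^{\mathbb{N}}$ is the set of infinite binary sequences and $2^{<\mathbb{N}}$ the set of finite binary sequences (including the empty one); juxtaposition denotes concatenation. Maps act on the right: $\xi.f$ is the result of applying $f$ to $\xi$, and $\xi.(fg)=(\xi.f).g$. Finite sequences $s,t$ are incompatible if neither is an initial segment of the other. Define bijections $x,y$ of $2^{\mathbb{N}}$ by \[ \xi.x=\begin{cases}0\eta&\text{if }\xi=00\eta\\ 10\eta&\text{if }\xi=01\eta\\ 11\eta&\text{if }\xi=1\eta\end{cases} \qquad \xi.y=\begin{cases}0(\eta.y)&\text{if }\xi=00\eta\\ 10(\eta.y^{-1})&\text{if }\xi=01\eta\\ 11(\eta.y)&\text{if }\xi=1\eta\end{cases} \] (so that, recursively, $0\eta.y^{-1}=00(\eta.y^{-1})$, $10\eta.y^{-1}=01(\eta.y)$, $11\eta.y^{-1}=1(\eta.y^{-1})$). For $s\in 2^{<\mathbb{N}}$ let $x_s$ be the map sending $s\eta$ to $s(\eta.x)$ and fixing every $\xi$ that does not extend $s$; let $y_s$ be the map sending $s\eta$ to $s(\eta.y)$ and fixing every $\xi$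 that does not extend $s$. For the empty sequence $s$, $x_s=x$ and $y_s=y$. For $t\in 2^{<\mathbb{N}}$, $t.x_s$ is defined exactly when $t$ is incompatible with $s$ (then $t.x_s=t$), or $t=s00u$ (then $t.x_s=s0u$), or $t=s01u$ (then $t.x_s=s10u$), or $t=s1u$ (then $t.x_s=s11u$), where $u \in 2^{<\mathbb{N}}$. $X=\{x_s: s\in 2^{<\mathbb{N}}\}$, $Y=\{y_s: s\in 2^{<\mathbb{N}}\}$, and $Y_0$ is the set of all $y_s$ such that $s$ is not a constant binary sequence (the empty sequence counts as constant; so $s$ contains both a $0$ and a $1$). The relations $R$ are, for all $s,t\in 2^{<\mathbb{N}}$: (1) $x_s^2=x_{s0}\,x_s\,x_{s1}$; (2) if $t.x_s$ is defined, then $x_t x_s=x_s x_{t.x_s}$; (3) if $t.x_s$ is defined, then $y_t x_s=x_s y_{t.x_s}$; (4) if $s$ and $t$ are incompatible, then $y_s y_t=y_t y_s$; (5) $y_s=x_s\,y_{s0}\,y_{s10}^{-1}\,y_{s11}$. $G_0$ is also generated by $x$, $x_{1}$ and $y_{10}$; these are identified (via a continued-fraction coding of the real projective line by binary sequences) with the homeomorphisms $a,b,c$ of $\mathbb{R}$ given by $a(t)=t+1$; $b(t)=t$ for $t\le0$, $\frac{t}{1-t}$ for $0\le t\le\frac12$, $3-\frac1t$ for $\frac12\le t\le1$, $t+1$ for $t\ge1$; $c(t)=\frac{2t}{1+t}$ for $0\le t\le1$ and $c(t)=t$ otherwise. *)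

theory Defs
  imports
    "HOL-Analysis.Analysis"
    "HOL-Algebra.Generated_Groups"
    "HOL-Library.Sublist"
    "HOL-Library.Omega_Words_Fun"
begin

section \<open>Free groups and presentations\<close>

text \<open>A letter is a generator \<open>a\<close>, written \<open>(a, True)\<close>, or its formal inverse, written
  \<open>(a, False)\<close>. The free group consists of the freely reduced words.\<close>

type_synonym 'a letter = "'a \<times> bool"

definition inv_letter :: "'a letter \<Rightarrow> 'a letter" where
  "inv_letter l = (fst l, \<not> snd l)"

definition inv_word :: "'a letter list \<Rightarrow> 'a letter list" where
  "inv_word w = rev (map inv_letter w)"

definition reduced_word :: "'a letter list \<Rightarrow> bool" where
  "reduced_word = successively (\<lambda>k l. l \<noteq> inv_letter k)"

fun push :: "'a letter \<Rightarrow> 'a letter list \<Rightarrow> 'a letter list" where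
  "push k [] = [k]"
| "push k (l # w) = (if l = inv_letter k then w else k # l # w)"

definition reduce_word :: "'a letter list \<Rightarrow> 'a letter list" where
  "reduce_word w = foldr push w []"

definition words_over :: "'a set \<Rightarrow> 'a letter list set" where
  "words_over S = {w. fst ` set w \<subseteq> S}"

definition free_group :: "'a set \<Rightarrow> 'a letter list monoid" where
  "free_group S = \<lparr>carrier = {w \<in> words_over S. reduced_word w},
                   mult = (\<lambda>u v. reduce_word (u @ v)), one = []\<rparr>"

definition normal_closure :: "('g, 'b) monoid_scheme \<Rightarrow> 'g set \<Rightarrow> 'g set" where
  "normal_closure G A = \<Inter>{N. N \<lhd> G \<and> A \<subseteq> N}"

definition letter_val :: "('g, 'b) monoid_scheme \<Rightarrow> ('a \<Rightarrow> 'g) \<Rightarrow> 'a letter \<Rightarrow> 'g" where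
  "letter_val G \<phi> l = (if snd l then \<phi> (fst l) else inv\<^bsub>G\<^esub> \<phi> (fst l))"

definition word_val :: "('g, 'b) monoid_scheme \<Rightarrow> ('a \<Rightarrow> 'g) \<Rightarrow> 'a letter list \<Rightarrow> 'g" where
  "word_val G \<phi> w = foldr (\<lambda>l g. letter_val G \<phi> l \<otimes>\<^bsub>G\<^esub> g) w \<one>\<^bsub>G\<^esub>"

text \<open>A relation \<open>u = v\<close> between words is the pair \<open>(u, v)\<close>; its relator is \<open>u v\<^sup>-\<^sup>1\<close>.\<close>

type_synonym 'a relation = "'a letter list \<times> 'a letter list"

definition relator :: "'a relation \<Rightarrow> 'a letter list" where
  "relator r = reduce_word (fst r @ inv_word (snd r))"

text \<open>\<open>\<langle>S | R\<rangle>\<close> presents \<open>G\<close>, with \<open>a \<in> S\<close> standing for the element \<open>\<phi> a\<close>: the homomorphism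
  from the free group on \<open>S\<close> to \<open>G\<close> which extends \<open>\<phi>\<close> is onto, and its kernel is the normal
  closure of the relators.\<close>

definition presentation ::
    "('g, 'b) monoid_scheme \<Rightarrow> ('a \<Rightarrow> 'g) \<Rightarrow> 'a set \<Rightarrow> 'a relation set \<Rightarrow> bool" where
  "presentation G \<phi> S R \<longleftrightarrow>
     group G \<and> \<phi> \<in> S \<rightarrow> carrier G \<and> R \<subseteq> words_over S \<times> words_over S \<and>
     word_val G \<phi> ` carrier (free_group S) = carrier G \<and>
     kernel (free_group S) G (word_val G \<phi>) = normal_closure (free_group S) (relator ` R)"

text \<open>A finite set of abstract generators may be taken to consist of natural numbers.\<close>

definition finitely_presented :: "('g, 'b) monoid_scheme \<Rightarrow> bool" where
  "finitely_presented G \<longleftrightarrow>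
     (\<exists>(S :: nat set) \<phi> R. finite S \<and> finite R \<and> presentation G \<phi> S R)"

lemma inv_letter_inv_letter [simp]: "inv_letter (inv_letter l) = l"
  by (simp add: inv_letter_def)

lemma inv_letter_neq [simp]: "inv_letter l \<noteq> l" "l \<noteq> inv_letter l"
  by (cases l; simp add: inv_letter_def)+

lemma fst_inv_letter [simp]: "fst (inv_letter l) = fst l"
  by (simp add: inv_letter_def)

lemma reduced_Nil [simp]: "reduced_word []"
  by (simp add: reduced_word_def)

lemma reduced_Cons: "reduced_word (k # w) \<longleftrightarrow> (w = [] \<or> hd w \<noteq> inv_letter k) \<and> reduced_word w"
  by (auto simp: reduced_word_def successively_Cons)

lemma reduced_push: "reduced_word w \<Longrightarrow> reduced_word (push k w)"
  by (cases w) (auto simp: reduced_Cons)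

lemma push_cancel:
  assumes "reduced_word w" shows "push (inv_letter k) (push k w) = w"
proof (cases w)
  case (Cons l v)
  then show ?thesis using assms by (cases v) (auto simp: reduced_Cons)
qed auto

lemma push_cancel': "reduced_word w \<Longrightarrow> push k (push (inv_letter k) w) = w"
  using push_cancel[of w "inv_letter k"] by simp

lemma push_reduced: "reduced_word (k # w) \<Longrightarrow> push k w = k # w"
  by (cases w) (auto simp: reduced_Cons)

lemma reduced_foldr_push: "reduced_word w \<Longrightarrow> reduced_word (foldr push u w)"
  by (induction u) (auto simp: reduced_push)

lemma reduced_reduce [simp]: "reduced_word (reduce_word w)"
  by (simp add: reduce_word_def reduced_foldr_push)

lemma reduce_reduced: "reduced_word w \<Longrightarrow> reduce_word w = w"
proof (induction w)
  case (Cons k w)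
  then have "reduce_word w = w" by (simp add: reduced_Cons)
  then show ?case using push_reduced[OF Cons.prems] by (simp add: reduce_word_def)
qed (simp add: reduce_word_def)

lemma foldr_push_push:
  assumes "reduced_word w" shows "foldr push (push k u) w = push k (foldr push u w)"
  using assms by (cases u) (auto simp: push_cancel' reduced_foldr_push)

lemma foldr_push_reduce: "reduced_word w \<Longrightarrow> foldr push (reduce_word u) w = foldr push u w"
  by (induction u) (auto simp: reduce_word_def foldr_push_push)

lemma reduce_append: "reduce_word (u @ v) = foldr push u (reduce_word v)"
  by (simp add: reduce_word_def)

lemma reduce_append_left [simp]: "reduce_word (reduce_word u @ v) = reduce_word (u @ v)"
  by (simp add: reduce_append foldr_push_reduce)

lemma reduce_append_right [simp]: "reduce_word (u @ reduce_word v) = reduce_word (u @ v)"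
  by (simp add: reduce_append reduce_reduced)

lemma reduce_inv_word: "reduce_word (inv_word u @ u) = []"
proof -
  have "foldr push (inv_word u) (foldr push u w) = w" if "reduced_word w" for w
    using that
    by (induction u arbitrary: w)
       (auto simp: inv_word_def push_cancel reduced_foldr_push)
  from this[of "[]"] show ?thesis by (simp add: reduce_word_def)
qed

lemma words_over_push: "k # w \<in> words_over S \<Longrightarrow> push k w \<in> words_over S"
  by (cases w) (auto simp: words_over_def)

lemma words_over_reduce: "w \<in> words_over S \<Longrightarrow> reduce_word w \<in> words_over S"
proof (induction w)
  case (Cons k w)
  then have "reduce_word w \<in> words_over S" by (simp add: words_over_def)
  with Cons.prems have "k # reduce_word w \<in> words_over S" by (simp add: words_over_def)
  then show ?case using words_over_push by (simp add: reduce_word_def)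
qed (simp add: reduce_word_def)

lemma words_over_append: "u @ v \<in> words_over S \<longleftrightarrow> u \<in> words_over S \<and> v \<in> words_over S"
  by (auto simp: words_over_def)

lemma words_over_inv_word: "u \<in> words_over S \<Longrightarrow> inv_word u \<in> words_over S"
  by (auto simp: words_over_def inv_word_def)

lemma group_free_group: "group (free_group S)"
proof (rule groupI)
  fix u assume u: "u \<in> carrier (free_group S)"
  then have "reduce_word (inv_word u) \<in> carrier (free_group S)"
    by (simp add: free_group_def words_over_reduce words_over_inv_word)
  moreover have "reduce_word (inv_word u) \<otimes>\<^bsub>free_group S\<^esub> u = \<one>\<^bsub>free_group S\<^esub>"
    by (simp add: free_group_def reduce_inv_word)
  ultimately show "\<exists>v\<in>carrier (free_group S). v \<otimes>\<^bsub>free_group S\<^esub> u = \<one>\<^bsub>free_group S\<^esub>"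
    by blast
qed (auto simp: free_group_def words_over_reduce words_over_append reduce_reduced,
     auto simp: words_over_def)


section \<open>The homeomorphism group of the Cantor space\<close>

text \<open>The Cantor space is \<^typ>\<open>bool word\<close>, that is, functions from \<^typ>\<open>nat\<close> to \<^typ>\<open>bool\<close> with the
  product topology; \<^term>\<open>False\<close> is the digit 0 and \<^term>\<open>True\<close> the digit 1. Since maps act on the
  right, the product \<open>f g\<close> applies \<open>f\<close> first.\<close>

definition homeo_group :: "('c::topological_space \<Rightarrow> 'c) monoid" where
  "homeo_group = \<lparr>carrier = {f. \<exists>g. homeomorphism UNIV UNIV f g},
                  mult = (\<lambda>f g. g \<circ> f), one = id\<rparr>"

lemma group_homeo_group: "group homeo_group"
proof (rule groupI)
  fix f g :: "'c::topological_space \<Rightarrow> 'c"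
  assume "f \<in> carrier homeo_group" "g \<in> carrier homeo_group"
  then obtain f' g' where "homeomorphism UNIV UNIV f f'" "homeomorphism UNIV UNIV g g'"
    by (auto simp: homeo_group_def)
  then have "homeomorphism UNIV UNIV (g \<circ> f) (f' \<circ> g')"
    by (rule homeomorphism_compose)
  then show "f \<otimes>\<^bsub>homeo_group\<^esub> g \<in> carrier homeo_group"
    by (auto simp: homeo_group_def)
next
  fix f :: "'c::topological_space \<Rightarrow> 'c" assume "f \<in> carrier homeo_group"
  then obtain f' where f: "homeomorphism UNIV UNIV f f'" by (auto simp: homeo_group_def)
  then have "f' \<in> carrier homeo_group"
    by (auto simp: homeo_group_def dest: homeomorphism_symD)
  moreover have "f \<circ> f' = id" using f by (auto simp: homeomorphism_def)
  ultimately show "\<exists>h\<in>carrier homeo_group. h \<otimes>\<^bsub>homeo_group\<^esub> f = \<one>\<^bsub>homeo_group\<^esub>"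
    by (intro bexI[of _ f']) (auto simp: homeo_group_def)
next
  show "\<one>\<^bsub>homeo_group\<^esub> \<in> carrier homeo_group"
    using homeomorphism_ident by (auto simp: homeo_group_def id_def)
qed (auto simp: homeo_group_def)


section \<open>The maps \<open>x\<^sub>s\<close> and \<open>y\<^sub>s\<close>\<close>

definition cantor_x :: "bool word \<Rightarrow> bool word" where
  "cantor_x \<xi> =
     (if \<not> \<xi> 0 \<and> \<not> \<xi> 1 then [False] \<frown> Omega_Words_Fun.suffix 2 \<xi>
      else if \<not> \<xi> 0 then [True, False] \<frown> Omega_Words_Fun.suffix 2 \<xi>
      else [True, True] \<frown> Omega_Words_Fun.suffix 1 \<xi>)"

declare build_cons [simp del] build_append [simp del]

lemma conc_cong [fundef_cong]:
  assumes "u = v" "m = n" "\<And>k. n = length v + k \<Longrightarrow> \<eta> k = \<zeta> k"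
  shows "(u \<frown> \<eta>) m = (v \<frown> \<zeta>) n"
  using assms by (simp add: conc_def)

text \<open>\<open>y_digit True n \<xi>\<close> and \<open>y_digit False n \<xi>\<close> are the \<open>n\<close>-th digits of the images of \<open>\<xi>\<close> under
  \<open>y\<close> and \<open>y\<^sup>-\<^sup>1\<close>. The recursion is on \<open>n\<close>, because every step of the corecursive definition of
  \<open>y\<close> emits at least one digit; the defining equations of \<open>y\<close> are proved below.\<close>

fun y_digit :: "bool \<Rightarrow> nat \<Rightarrow> bool word \<Rightarrow> bool" where
  "y_digit True n \<xi> =
     (if \<not> \<xi> 0 \<and> \<not> \<xi> 1
      then ([False] \<frown> (\<lambda>k. y_digit True k (Omega_Words_Fun.suffix 2 \<xi>))) n
      else if \<not> \<xi> 0
      then ([True, False] \<frown> (\<lambda>k. y_digit False k (Omega_Words_Fun.suffix 2 \<xi>))) n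
      else ([True, True] \<frown> (\<lambda>k. y_digit True k (Omega_Words_Fun.suffix 1 \<xi>))) n)"
| "y_digit False n \<xi> =
     (if \<not> \<xi> 0
      then ([False, False] \<frown> (\<lambda>k. y_digit False k (Omega_Words_Fun.suffix 1 \<xi>))) n
      else if \<not> \<xi> 1
      then ([False, True] \<frown> (\<lambda>k. y_digit True k (Omega_Words_Fun.suffix 2 \<xi>))) n
      else ([True] \<frown> (\<lambda>k. y_digit False k (Omega_Words_Fun.suffix 2 \<xi>))) n)"

declare y_digit.simps [simp del]

definition cantor_y :: "bool word \<Rightarrow> bool word" where
  "cantor_y \<xi> = (\<lambda>n. y_digit True n \<xi>)"

definition cantor_y_inv :: "bool word \<Rightarrow> bool word" where
  "cantor_y_inv \<xi> = (\<lambda>n. y_digit False n \<xi>)"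

definition act_below :: "bool list \<Rightarrow> (bool word \<Rightarrow> bool word) \<Rightarrow> bool word \<Rightarrow> bool word" where
  "act_below s f \<xi> =
     (if Omega_Words_Fun.prefix (length s) \<xi> = s
      then s \<frown> f (Omega_Words_Fun.suffix (length s) \<xi>) else \<xi>)"

definition x_at :: "bool list \<Rightarrow> bool word \<Rightarrow> bool word" where
  "x_at s = act_below s cantor_x"

definition y_at :: "bool list \<Rightarrow> bool word \<Rightarrow> bool word" where
  "y_at s = act_below s cantor_y"

definition X_gens :: "(bool word \<Rightarrow> bool word) set" where
  "X_gens = range x_at"

definition Y_gens :: "(bool word \<Rightarrow> bool word) set" where
  "Y_gens = range y_at"

definition Y0_gens :: "(bool word \<Rightarrow> bool word) set" where
  "Y0_gens = {y_at s |s. False \<in> set s \<and> True \<in> set s}"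

definition S_gens :: "(bool word \<Rightarrow> bool word) set" where
  "S_gens = X_gens \<union> Y_gens"

definition S0_gens :: "(bool word \<Rightarrow> bool word) set" where
  "S0_gens = X_gens \<union> Y0_gens"

definition LM_group :: "(bool word \<Rightarrow> bool word) monoid" where
  "LM_group = subgroup_generated homeo_group S_gens"

definition LM0_group :: "(bool word \<Rightarrow> bool word) monoid" where
  "LM0_group = subgroup_generated homeo_group S0_gens"

lemma suffix_conc [simp]: "Omega_Words_Fun.suffix (length s) (s \<frown> \<eta>) = \<eta>"
  by (simp add: fun_eq_iff)

lemma suffix_conc_1 [simp]: "Omega_Words_Fun.suffix (Suc 0) ([a] \<frown> \<eta>) = \<eta>"
  using suffix_conc[of "[a]" \<eta>] by simp

lemma suffix_conc_2 [simp]: "Omega_Words_Fun.suffix 2 ([a, b] \<frown> \<eta>) = \<eta>"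
  using suffix_conc[of "[a, b]" \<eta>] by (simp add: numeral_2_eq_2)

lemma word_cases_1:
  fixes \<xi> :: "bool word"
  obtains \<eta> where "\<xi> = [False] \<frown> \<eta>" | \<eta> where "\<xi> = [True] \<frown> \<eta>"
proof -
  have "\<xi> = [\<xi> 0] \<frown> Omega_Words_Fun.suffix 1 \<xi>"
    by (auto simp: fun_eq_iff conc_def)
  then show thesis using that by (cases "\<xi> 0") metis+
qed

lemma word_cases_x:
  fixes \<xi> :: "bool word"
  obtains \<eta> where "\<xi> = [False, False] \<frown> \<eta>" | \<eta> where "\<xi> = [False, True] \<frown> \<eta>"
    | \<eta> where "\<xi> = [True] \<frown> \<eta>"
proof (cases \<xi> rule: word_cases_1)
  case (1 \<eta>)
  then show thesis using that by (cases \<eta> rule: word_cases_1) auto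
qed (use that in blast)

lemma word_cases_x_inv:
  fixes \<xi> :: "bool word"
  obtains \<eta> where "\<xi> = [False] \<frown> \<eta>" | \<eta> where "\<xi> = [True, False] \<frown> \<eta>"
    | \<eta> where "\<xi> = [True, True] \<frown> \<eta>"
proof (cases \<xi> rule: word_cases_1)
  case (2 \<eta>)
  then show thesis using that by (cases \<eta> rule: word_cases_1) auto
qed (use that in blast)

lemma cantor_x_simps [simp]:
  "cantor_x ([False, False] \<frown> \<eta>) = [False] \<frown> \<eta>"
  "cantor_x ([False, True] \<frown> \<eta>) = [True, False] \<frown> \<eta>"
  "cantor_x ([True] \<frown> \<eta>) = [True, True] \<frown> \<eta>"
  by (simp_all add: cantor_x_def)

lemma cantor_y_simps [simp]:
  "cantor_y ([False, False] \<frown> \<eta>) = [False] \<frown> cantor_y \<eta>"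
  "cantor_y ([False, True] \<frown> \<eta>) = [True, False] \<frown> cantor_y_inv \<eta>"
  "cantor_y ([True] \<frown> \<eta>) = [True, True] \<frown> cantor_y \<eta>"
  by (rule ext, simp add: cantor_y_def cantor_y_inv_def y_digit.simps(1)[of _ "_ \<frown> _"])+

lemma cantor_y_inv_simps [simp]:
  "cantor_y_inv ([False] \<frown> \<eta>) = [False, False] \<frown> cantor_y_inv \<eta>"
  "cantor_y_inv ([True, False] \<frown> \<eta>) = [False, True] \<frown> cantor_y \<eta>"
  "cantor_y_inv ([True, True] \<frown> \<eta>) = [True] \<frown> cantor_y_inv \<eta>"
  by (rule ext, simp add: cantor_y_def cantor_y_inv_def y_digit.simps(2)[of _ "_ \<frown> _"])+

lemma cantor_y_inverse_digits:
  "cantor_y_inv (cantor_y \<xi>) n = \<xi> n \<and> cantor_y (cantor_y_inv \<xi>) n = \<xi> n"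
proof (induction n arbitrary: \<xi> rule: less_induct)
  case (less n)
  have *: "(s \<frown> \<zeta>) n = (s \<frown> \<eta>) n" if "s \<noteq> []" "\<And>k. k < n \<Longrightarrow> \<zeta> k = \<eta> k" for s \<zeta> \<eta>
    using that by (cases s) (auto simp: conc_def)
  have "cantor_y_inv (cantor_y \<xi>) n = \<xi> n"
    by (cases \<xi> rule: word_cases_x) (auto intro!: * simp: less)
  moreover have "cantor_y (cantor_y_inv \<xi>) n = \<xi> n"
    by (cases \<xi> rule: word_cases_x_inv) (auto intro!: * simp: less)
  ultimately show ?case by blast
qed

lemma cantor_y_inv_cantor_y [simp]: "cantor_y_inv (cantor_y \<xi>) = \<xi>"
  and cantor_y_cantor_y_inv [simp]: "cantor_y (cantor_y_inv \<xi>) = \<xi>"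
  by (simp_all add: fun_eq_iff cantor_y_inverse_digits)

lemma act_below_conc [simp]: "act_below s f (s \<frown> \<eta>) = s \<frown> f \<eta>"
  by (simp add: act_below_def)

lemma act_below_outside:
  assumes "\<And>\<eta>. \<xi> \<noteq> s \<frown> \<eta>" shows "act_below s f \<xi> = \<xi>"
proof -
  have "Omega_Words_Fun.prefix (length s) \<xi> \<noteq> s"
    using assms[of "Omega_Words_Fun.suffix (length s) \<xi>"]
      Omega_Words_Fun.prefix_suffix[of \<xi> "length s"] by metis
  then show ?thesis by (simp add: act_below_def)
qed

lemma act_below_Nil [simp]: "act_below [] f = f"
  by (simp add: act_below_def fun_eq_iff)

lemma continuous_digit: "continuous_on UNIV (\<lambda>\<xi> :: bool word. \<xi> n)"
  by simp

lemma continuous_suffix: "continuous_on UNIV (Omega_Words_Fun.suffix k :: bool word \<Rightarrow> bool word)"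
  by (rule continuous_on_coordinatewise_then_product) simp

lemma continuous_If:
  fixes P :: "bool word \<Rightarrow> bool"
  assumes P: "continuous_on UNIV P" and "continuous_on UNIV f" "continuous_on UNIV g"
  shows "continuous_on UNIV (\<lambda>\<xi>. if P \<xi> then f \<xi> else g \<xi>)"
proof -
  have cl: "closed (P -` A)" for A
    using P by (intro closed_vimage) (auto simp: closed_def open_discrete)
  have "closed {\<xi>. P \<xi>}" "closed {\<xi>. \<not> P \<xi>}"
    using cl[of "{True}"] cl[of "{False}"] by (auto simp: vimage_def)
  then have "continuous_on ({\<xi>. P \<xi>} \<union> {\<xi>. \<not> P \<xi>}) (\<lambda>\<xi>. if P \<xi> then f \<xi> else g \<xi>)"
    using assms by (intro continuous_on_cases) (auto intro: continuous_on_subset)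
  moreover have "{\<xi>. P \<xi>} \<union> {\<xi>. \<not> P \<xi>} = UNIV" by auto
  ultimately show ?thesis by simp
qed

lemma continuous_conj:
  fixes P Q :: "bool word \<Rightarrow> bool"
  assumes "continuous_on UNIV P" "continuous_on UNIV Q"
  shows "continuous_on UNIV (\<lambda>\<xi>. P \<xi> \<and> Q \<xi>)"
  by (rule continuous_on_eq[OF continuous_If[OF assms continuous_on_const[of _ False]]]) auto

lemma continuous_not:
  fixes P :: "bool word \<Rightarrow> bool"
  assumes "continuous_on UNIV P"
  shows "continuous_on UNIV (\<lambda>\<xi>. \<not> P \<xi>)"
  by (rule continuous_on_eq[OF continuous_If[OF assms continuous_on_const[of _ False]
          continuous_on_const[of _ True]]]) auto

lemma continuous_prefix_eq:
  "continuous_on UNIV (\<lambda>\<xi> :: bool word. Omega_Words_Fun.prefix (length s) \<xi> = s)"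
proof -
  have eq: "(\<lambda>\<xi>. \<xi> n = b) = (if b then (\<lambda>\<xi>. \<xi> n) else (\<lambda>\<xi>. \<not> \<xi> n))" for n :: nat and b by auto
  have 1: "continuous_on UNIV (\<lambda>\<xi> :: bool word. \<xi> n = b)" for n b
    unfolding eq by (auto intro: continuous_not continuous_digit)
  have 2: "continuous_on UNIV (\<lambda>\<xi> :: bool word. \<forall>i<m. \<xi> i = s ! i)" for m
  proof (induction m)
    case (Suc m)
    then show ?case
      using continuous_conj[OF 1[of m "s ! m"] Suc] by (simp only: All_less_Suc)
  qed simp
  have "(Omega_Words_Fun.prefix (length s) \<xi> = s) = (\<forall>i<length s. \<xi> i = s ! i)" for \<xi>
    unfolding list_eq_iff_nth_eq by simp
  then show ?thesis using 2[of "length s"] by simp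
qed

lemma continuous_conc:
  fixes f :: "bool word \<Rightarrow> bool word"
  assumes "\<And>k. n = length s + k \<Longrightarrow> continuous_on UNIV (\<lambda>\<xi>. f \<xi> k)"
  shows "continuous_on UNIV (\<lambda>\<xi>. (s \<frown> f \<xi>) n)"
  using assms[of "n - length s"] by (cases "n < length s") auto

lemma continuous_y_digit: "continuous_on UNIV (y_digit b n)"
proof (induction n arbitrary: b rule: less_induct)
  case (less n)
  have *: "continuous_on UNIV (\<lambda>\<xi>. y_digit c k (Omega_Words_Fun.suffix j \<xi>))" if "k < n" for c k j
    by (rule continuous_on_compose2[OF less[OF that] continuous_suffix]) auto
  have "continuous_on UNIV (y_digit True n)"
    by (rule continuous_on_eq[rotated], rule y_digit.simps(1)[symmetric],
        intro continuous_If continuous_conj continuous_not continuous_conc continuous_digit *) auto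
  moreover have "continuous_on UNIV (y_digit False n)"
    by (rule continuous_on_eq[rotated], rule y_digit.simps(2)[symmetric],
        intro continuous_If continuous_conj continuous_not continuous_conc continuous_digit *) auto
  ultimately show ?case by (cases b) auto
qed

lemma homeomorphism_cantor_y: "homeomorphism UNIV UNIV cantor_y cantor_y_inv"
proof -
  have "continuous_on UNIV cantor_y" "continuous_on UNIV cantor_y_inv"
    unfolding cantor_y_def[abs_def] cantor_y_inv_def[abs_def]
    by (rule continuous_on_coordinatewise_then_product, rule continuous_y_digit)+
  moreover have "range cantor_y = UNIV" "range cantor_y_inv = UNIV"
    by (metis cantor_y_cantor_y_inv surjI, metis cantor_y_inv_cantor_y surjI)
  ultimately show ?thesis by (simp add: homeomorphism_def)
qed

definition cantor_x_inv :: "bool word \<Rightarrow> bool word" where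
  "cantor_x_inv \<xi> =
     (if \<not> \<xi> 0 then [False, False] \<frown> Omega_Words_Fun.suffix 1 \<xi>
      else if \<not> \<xi> 1 then [False, True] \<frown> Omega_Words_Fun.suffix 2 \<xi>
      else [True] \<frown> Omega_Words_Fun.suffix 2 \<xi>)"

lemma cantor_x_inv_simps [simp]:
  "cantor_x_inv ([False] \<frown> \<eta>) = [False, False] \<frown> \<eta>"
  "cantor_x_inv ([True, False] \<frown> \<eta>) = [False, True] \<frown> \<eta>"
  "cantor_x_inv ([True, True] \<frown> \<eta>) = [True] \<frown> \<eta>"
  by (simp_all add: cantor_x_inv_def)

lemma cantor_x_inv_cantor_x [simp]: "cantor_x_inv (cantor_x \<xi>) = \<xi>"
  by (cases \<xi> rule: word_cases_x) simp_all

lemma cantor_x_cantor_x_inv [simp]: "cantor_x (cantor_x_inv \<xi>) = \<xi>"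
  by (cases \<xi> rule: word_cases_x_inv) simp_all

lemma continuous_conc_suffix:
  fixes f :: "bool word \<Rightarrow> bool word"
  assumes "continuous_on UNIV f"
  shows "continuous_on UNIV (\<lambda>\<xi> :: bool word. s \<frown> f (Omega_Words_Fun.suffix k \<xi>))"
proof (rule continuous_on_coordinatewise_then_product, rule continuous_conc)
  fix m
  have "continuous_on UNIV (\<lambda>\<xi>. f (Omega_Words_Fun.suffix k \<xi>))"
    by (rule continuous_on_compose2[OF assms continuous_suffix]) auto
  then show "continuous_on UNIV (\<lambda>\<xi>. f (Omega_Words_Fun.suffix k \<xi>) m)"
    by (rule continuous_on_product_then_coordinatewise)
qed

lemma homeomorphism_cantor_x: "homeomorphism UNIV UNIV cantor_x cantor_x_inv"
proof -
  note c = continuous_conc_suffix[OF continuous_on_id]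
  have "continuous_on UNIV cantor_x" "continuous_on UNIV cantor_x_inv"
    unfolding cantor_x_def[abs_def] cantor_x_inv_def[abs_def]
    by (intro continuous_If continuous_conj continuous_not continuous_digit c)+
  moreover have "range cantor_x = UNIV" "range cantor_x_inv = UNIV"
    by (metis cantor_x_cantor_x_inv surjI, metis cantor_x_inv_cantor_x surjI)
  ultimately show ?thesis by (simp add: homeomorphism_def)
qed

lemma homeomorphism_act_below:
  assumes "homeomorphism UNIV UNIV f g"
  shows "homeomorphism UNIV UNIV (act_below s f) (act_below s g)"
proof -
  have cont: "continuous_on UNIV (act_below s h)" if "continuous_on UNIV h" for h
    unfolding act_below_def[abs_def]
    by (intro continuous_If continuous_prefix_eq continuous_conc_suffix that continuous_on_id)
  have inv: "act_below s h (act_below s k \<xi>) = \<xi>" if "\<And>\<xi>. h (k \<xi>) = \<xi>" for h k \<xi>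
  proof (cases "\<exists>\<eta>. \<xi> = s \<frown> \<eta>")
    case True
    then show ?thesis using that by auto
  next
    case False
    then show ?thesis by (simp add: act_below_outside)
  qed
  have "act_below s f (act_below s g \<xi>) = \<xi>" "act_below s g (act_below s f \<xi>) = \<xi>" for \<xi>
    using assms by (auto intro!: inv simp: homeomorphism_def)
  moreover from this have "range (act_below s f) = UNIV" "range (act_below s g) = UNIV"
    by (metis surjI)+
  moreover have "continuous_on UNIV (act_below s f)" "continuous_on UNIV (act_below s g)"
    using assms by (auto intro!: cont simp: homeomorphism_def)
  ultimately show ?thesis by (simp add: homeomorphism_def)
qed

lemma S_gens_homeo: "S_gens \<subseteq> carrier homeo_group"
  using homeomorphism_act_below[OF homeomorphism_cantor_x]
    homeomorphism_act_below[OF homeomorphism_cantor_y]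
  by (auto simp: S_gens_def X_gens_def Y_gens_def x_at_def y_at_def homeo_group_def)

lemma S0_gens_subset: "S0_gens \<subseteq> S_gens"
  by (auto simp: S_gens_def S0_gens_def Y_gens_def Y0_gens_def)


section \<open>The relations\<close>

text \<open>\<open>seq_image s t t'\<close> means that \<open>t.x\<^sub>s\<close> is defined and equal to \<open>t'\<close>.\<close>

inductive seq_image :: "bool list \<Rightarrow> bool list \<Rightarrow> bool list \<Rightarrow> bool" for s where
  "t \<parallel> s \<Longrightarrow> seq_image s t t"
| "seq_image s (s @ [False, False] @ u) (s @ [False] @ u)"
| "seq_image s (s @ [False, True] @ u) (s @ [True, False] @ u)"
| "seq_image s (s @ [True] @ u) (s @ [True, True] @ u)"

definition xl :: "bool list \<Rightarrow> (bool word \<Rightarrow> bool word) letter" where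
  "xl s = (x_at s, True)"

definition yl :: "bool list \<Rightarrow> (bool word \<Rightarrow> bool word) letter" where
  "yl s = (y_at s, True)"

inductive_set R_rels :: "(bool word \<Rightarrow> bool word) relation set" where
  R1: "([xl s, xl s], [xl (s @ [False]), xl s, xl (s @ [True])]) \<in> R_rels"
| R2: "seq_image s t t' \<Longrightarrow> ([xl t, xl s], [xl s, xl t']) \<in> R_rels"
| R3: "seq_image s t t' \<Longrightarrow> ([yl t, xl s], [xl s, yl t']) \<in> R_rels"
| R4: "s \<parallel> t \<Longrightarrow> ([yl s, yl t], [yl t, yl s]) \<in> R_rels"
| R5: "([yl s], [xl s, yl (s @ [False]), inv_letter (yl (s @ [True, False])),
         yl (s @ [True, True])]) \<in> R_rels"

definition R0_rels :: "(bool word \<Rightarrow> bool word) relation set" where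
  "R0_rels = R_rels \<inter> (words_over S0_gens \<times> words_over S0_gens)"

end

theory Submission
  imports Defs
begin

text \<open>Relation (5) allows every element of the abstract group to be written as an element of
  Thompson's group \<open>F\<close> followed by a product of powers of \<open>y\<^sub>s\<close>, longer sequences first, in which no
  letter \<open>y\<^sub>s\<close> can be expanded so as to meet its inverse. Coding the projective line by binary
  sequences, \<open>y\<close> becomes the doubling map and the elements of \<open>F\<close> are piecewise in \<open>PSL\<^sub>2(\<int>)\<close>. Along
  a branch which meets a power of some \<open>y\<^sub>s\<close>, the product is then a matrix with determinant
  \<open>2\<^sup>k\<close>, \<open>k > 0\<close>, which is not divisible by 2; it is a geodesic of length \<open>k\<close> in the Bruhat-Tits tree
  of \<open>PGL\<^sub>2(\<rat>\<^sub>2)\<close>. Hence the product does not lie in \<open>F\<close>, and a relation between the generators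
  reduces to one between the \<open>x\<^sub>s\<close>.

  For \<open>F\<close> itself, every element \<open>h\<close> carries each sufficiently deep binary tree to another one, and \<open>h\<close> is
  the quotient of the two products of rotations which turn these trees into right combs. If \<open>h\<close> acts
  trivially the trees coincide, so \<open>h = 1\<close>.

  Finitely many relations suffice because \<open>x\<close> and \<open>x\<^sub>1\<close> generate \<open>F\<close> with two relations, because the
  partial action of \<open>F\<close> on finite sequences has finitely many orbits on single sequences and on
  incompatible pairs, and because the stabilisers are finitely generated.\<close>

section \<open>Groups in additive notation\<close>

text \<open>Standard forms are not claimed to be unique. It is enough that a form with a nonzero
  label never acts like an element of F, and the states modulo 2 are made for this purpose. The
  obstacle on the way to a standard form is that s0.x_s is undefined, and so is the image of s1
  under the inverse of x_s. A power of y at such a vertex has to be expanded before x_s can pass it,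
  and each expansion creates new powers further down. What does not grow is the largest total
  exponent along one branch, and this makes the rewriting terminate. G and G_0 are treated by one
  argument, with a predicate P telling for which s the map y_s is a generator. P is inherited by
  extensions, so that expansions stay among the generators, and it is invariant under the partial
  action of F.\<close>

text \<open>Abstract groups are handled through the class \<^class>\<open>group_add\<close>, to which they are carried by
  their regular representation. As everywhere, the first summand is applied first.\<close>

typedef 'a permu = "{f :: 'a \<Rightarrow> 'a. bij f}"
  morphisms app Permu
  by (rule exI[of _ id]) simp

setup_lifting type_definition_permu

instantiation permu :: (type) group_add
begin

lift_definition zero_permu :: "'a permu" is id by simp

lift_definition plus_permu :: "'a permu \<Rightarrow> 'a permu \<Rightarrow> 'a permu" is "\<lambda>f g. g \<circ> f"
  by (simp add: bij_comp)

lift_definition uminus_permu :: "'a permu \<Rightarrow> 'a permu" is "inv_into UNIV"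
  by (simp add: bij_imp_bij_inv)

lift_definition minus_permu :: "'a permu \<Rightarrow> 'a permu \<Rightarrow> 'a permu" is "\<lambda>f g. inv_into UNIV g \<circ> f"
  by (simp add: bij_comp bij_imp_bij_inv)

instance
  by standard (transfer; auto simp: fun_eq_iff bij_def inv_f_f surj_f_inv_f)+

end

lemma permu_eqI: "(\<And>z. app p z = app q z) \<Longrightarrow> p = q"
  by transfer auto

lemma app_zero [simp]: "app 0 z = z"
  by transfer simp

lemma app_plus [simp]: "app (p + q) z = app q (app p z)"
  by transfer simp

lemma app_uminus_app [simp]: "app (- p) (app p z) = z" "app p (app (- p) z) = z"
  by (simp_all flip: app_plus)

lemma app_Permu: "bij f \<Longrightarrow> app (Permu f) = f"
  by (simp add: Permu_inverse)

inductive_set gen :: "'g::group_add set \<Rightarrow> 'g set" for B where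
  gen_zero: "0 \<in> gen B"
| gen_incl: "b \<in> B \<Longrightarrow> b \<in> gen B"
| gen_add: "g \<in> gen B \<Longrightarrow> h \<in> gen B \<Longrightarrow> g + h \<in> gen B"
| gen_uminus: "g \<in> gen B \<Longrightarrow> - g \<in> gen B"

lemma gen_diff: "g \<in> gen B \<Longrightarrow> h \<in> gen B \<Longrightarrow> g - h \<in> gen B"
  using gen_add[of g B "- h"] gen_uminus by auto

lemmas gen_intros = gen_zero gen_incl gen_add gen_uminus gen_diff

lemma gen_subsetI: "B \<subseteq> gen C \<Longrightarrow> gen B \<subseteq> gen C"
proof
  fix g assume "g \<in> gen B" "B \<subseteq> gen C"
  then show "g \<in> gen C" by (induction) (auto intro: gen_intros)
qed

lemma gen_mono: "B \<subseteq> C \<Longrightarrow> gen B \<subseteq> gen C"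
  by (rule gen_subsetI) (auto intro: gen_incl)

definition comm :: "'g::group_add \<Rightarrow> 'g \<Rightarrow> bool" where
  "comm g h \<longleftrightarrow> g + h = h + g"

lemma comm_sym: "comm g h \<Longrightarrow> comm h g"
  by (simp add: comm_def)

lemma comm_zero [simp]: "comm 0 g" "comm g 0"
  by (simp_all add: comm_def)

lemma comm_add: "comm a g \<Longrightarrow> comm b g \<Longrightarrow> comm (a + b) g"
  unfolding comm_def by (metis add.assoc)

lemma comm_uminus: "comm a g \<Longrightarrow> comm (- a) g"
  unfolding comm_def by (metis add.assoc add.right_neutral add_minus_cancel left_minus)

lemma comm_add2: "comm g a \<Longrightarrow> comm g b \<Longrightarrow> comm g (a + b)"
  and comm_uminus2: "comm g a \<Longrightarrow> comm g (- a)"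
  using comm_add comm_uminus comm_sym by blast+

lemma comm_gen:
  assumes "h \<in> gen C" "\<And>c. c \<in> C \<Longrightarrow> comm g c" shows "comm g h"
  using assms by (induction) (auto intro: comm_add2 comm_uminus2)

lemma comm_gen_gen:
  assumes "g \<in> gen B" "h \<in> gen C" "\<And>b c. b \<in> B \<Longrightarrow> c \<in> C \<Longrightarrow> comm b c"
  shows "comm g h"
  using assms(1)
proof induction
  case (gen_incl b)
  then show ?case using assms comm_gen by blast
qed (auto intro: comm_add comm_uminus)

definition additive_hom :: "('g::group_add \<Rightarrow> 'h::group_add) \<Rightarrow> bool" where
  "additive_hom \<rho> \<longleftrightarrow> (\<forall>a b. \<rho> (a + b) = \<rho> a + \<rho> b)"

lemma additive_hom_simps:
  assumes "additive_hom \<rho>"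
  shows "\<rho> (a + b) = \<rho> a + \<rho> b" "\<rho> 0 = 0" "\<rho> (- a) = - \<rho> a" "\<rho> (a - b) = \<rho> a - \<rho> b"
proof -
  show *: "\<rho> (a + b) = \<rho> a + \<rho> b" for a b using assms by (simp add: additive_hom_def)
  show z: "\<rho> 0 = 0" using *[of 0 0] add_minus_cancel[of "- \<rho> 0" "\<rho> 0"] by (metis add.right_neutral minus_add_cancel)
  show m: "\<rho> (- a) = - \<rho> a" for a using *[of a "- a"] z by (simp add: eq_neg_iff_add_eq_0 flip: *)
  show "\<rho> (a - b) = \<rho> a - \<rho> b" using *[of a "- b"] m by simp
qed

lemma gen_image: "additive_hom \<rho> \<Longrightarrow> g \<in> gen (\<rho> ` B) \<Longrightarrow> \<exists>h\<in>gen B. \<rho> h = g"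
proof (rotate_tac, induction rule: gen.induct)
  case gen_zero
  then show ?case by (auto intro!: bexI[of _ 0] gen_intros simp: additive_hom_simps)
next
  case (gen_incl b)
  then show ?case by (auto intro: gen_intros)
next
  case (gen_add g h)
  then obtain g' h' where "g' \<in> gen B" "\<rho> g' = g" "h' \<in> gen B" "\<rho> h' = h" by blast
  with gen_add.prems show ?case
    by (intro bexI[of _ "g' + h'"]) (auto intro: gen_intros simp: additive_hom_simps)
next
  case (gen_uminus g)
  then obtain g' where "g' \<in> gen B" "\<rho> g' = g" by blast
  with gen_uminus.prems show ?case
    by (intro bexI[of _ "- g'"]) (auto intro: gen_intros simp: additive_hom_simps)
qed

definition ev :: "('a \<Rightarrow> 'g::group_add) \<Rightarrow> 'a letter list \<Rightarrow> 'g" where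
  "ev \<psi> w = sum_list (map (\<lambda>l. if snd l then \<psi> (fst l) else - \<psi> (fst l)) w)"

lemma ev_simps [simp]:
  "ev \<psi> [] = 0"
  "ev \<psi> (l # w) = (if snd l then \<psi> (fst l) else - \<psi> (fst l)) + ev \<psi> w"
  "ev \<psi> (u @ v) = ev \<psi> u + ev \<psi> v"
  by (simp_all add: ev_def)

lemma ev_push: "ev \<psi> (push l w) = ev \<psi> (l # w)"
  by (induction l w rule: push.induct) (auto simp: inv_letter_def simp flip: add.assoc)

lemma ev_reduce [simp]: "ev \<psi> (reduce_word w) = ev \<psi> w"
  by (induction w) (simp_all add: reduce_word_def ev_push)

lemma ev_inv_word [simp]: "ev \<psi> (inv_word w) = - ev \<psi> w"
  by (induction w) (auto simp: inv_word_def inv_letter_def minus_add)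

lemma ev_relator: "ev \<psi> (relator r) = 0 \<longleftrightarrow> ev \<psi> (fst r) = ev \<psi> (snd r)"
  by (simp add: relator_def)

lemma words_over_Cons [simp]: "l # w \<in> words_over S \<longleftrightarrow> fst l \<in> S \<and> w \<in> words_over S"
  by (auto simp: words_over_def)

lemma words_over_Nil [simp]: "[] \<in> words_over S"
  by (simp add: words_over_def)

lemma ev_in_gen: "w \<in> words_over S \<Longrightarrow> ev \<psi> w \<in> gen (\<psi> ` S)"
  by (induction w) (auto intro: gen_intros)

lemma gen_imp_ev: "g \<in> gen (\<psi> ` S) \<Longrightarrow> \<exists>w\<in>words_over S. ev \<psi> w = g"
proof (induction rule: gen.induct)
  case gen_zero
  then show ?case by (intro bexI[of _ "[]"]) auto
next
  case (gen_incl b)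
  then obtain a where "a \<in> S" "b = \<psi> a" by blast
  then show ?case by (intro bexI[of _ "[(a, True)]"]) auto
next
  case (gen_add g h)
  then obtain u v where "u \<in> words_over S" "ev \<psi> u = g" "v \<in> words_over S" "ev \<psi> v = h" by blast
  then show ?case by (intro bexI[of _ "u @ v"]) (auto simp: words_over_append)
next
  case (gen_uminus g)
  then obtain u where "u \<in> words_over S" "ev \<psi> u = g" by blast
  then show ?case by (intro bexI[of _ "inv_word u"]) (auto simp: words_over_inv_word)
qed

lemma ev_hom: "additive_hom \<rho> \<Longrightarrow> \<rho> (ev \<psi> w) = ev (\<lambda>a. \<rho> (\<psi> a)) w"
  by (induction w) (auto simp: additive_hom_simps)

subsection \<open>A criterion for presentations\<close>

text \<open>Right translations, because in \<open>permu\<close> the first summand acts first; left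
  translations would give an antihomomorphism. Elements outside the carrier are fixed so that the
  result is a bijection of the whole type.\<close>

definition cayley :: "('g, 'b) monoid_scheme \<Rightarrow> 'g \<Rightarrow> 'g permu" where
  "cayley G g = Permu (\<lambda>h. if h \<in> carrier G then h \<otimes>\<^bsub>G\<^esub> g else h)"

context group
begin

lemma app_cayley:
  assumes "g \<in> carrier G"
  shows "app (cayley G g) h = (if h \<in> carrier G then h \<otimes> g else h)"
proof -
  have "bij (\<lambda>h. if h \<in> carrier G then h \<otimes> g else h)"
    by (rule bij_betw_byWitness[where f' = "\<lambda>h. if h \<in> carrier G then h \<otimes> inv g else h"])
       (use assms in \<open>auto simp: m_assoc\<close>)
  then show ?thesis by (simp add: cayley_def app_Permu)
qed

lemma cayley_mult:
  "g \<in> carrier G \<Longrightarrow> h \<in> carrier G \<Longrightarrow> cayley G (g \<otimes> h) = cayley G g + cayley G h"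
  by (rule permu_eqI) (simp add: app_cayley m_assoc)

lemma cayley_eq_iff:
  assumes "g \<in> carrier G" "h \<in> carrier G"
  shows "cayley G g = cayley G h \<longleftrightarrow> g = h"
proof
  assume "cayley G g = cayley G h"
  then have "app (cayley G g) \<one> = app (cayley G h) \<one>" by simp
  then show "g = h" using assms by (simp add: app_cayley)
qed simp

lemma cayley_one: "cayley G \<one> = 0"
  by (rule permu_eqI) (simp add: app_cayley)

lemma cayley_inv: "g \<in> carrier G \<Longrightarrow> cayley G (inv g) = - cayley G g"
  using cayley_mult[of "inv g" g] by (simp add: cayley_one eq_neg_iff_add_eq_0)

lemma word_val_closed:
  assumes "\<phi> \<in> S \<rightarrow> carrier G" "w \<in> words_over S"
  shows "word_val G \<phi> w \<in> carrier G"
  using assms(2) by (induction w) (use assms(1) in \<open>auto simp: word_val_def letter_val_def\<close>)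

lemma cayley_word_val:
  assumes "\<phi> \<in> S \<rightarrow> carrier G" "w \<in> words_over S"
  shows "cayley G (word_val G \<phi> w) = ev (\<lambda>a. cayley G (\<phi> a)) w"
  using assms(2)
proof (induction w)
  case (Cons l w)
  then have "word_val G \<phi> w \<in> carrier G" "\<phi> (fst l) \<in> carrier G"
    using assms(1) by (auto intro: word_val_closed)
  then show ?case using Cons
    by (auto simp: word_val_def letter_val_def cayley_mult cayley_inv)
qed (simp add: word_val_def cayley_one)

lemma word_val_reduce:
  assumes "\<phi> \<in> S \<rightarrow> carrier G" "w \<in> words_over S"
  shows "word_val G \<phi> (reduce_word w) = word_val G \<phi> w"
proof -
  have "cayley G (word_val G \<phi> (reduce_word w)) = cayley G (word_val G \<phi> w)"
    using assms by (simp add: cayley_word_val words_over_reduce)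
  then show ?thesis
    using assms by (simp add: cayley_eq_iff word_val_closed words_over_reduce)
qed

lemma group_hom_word_val:
  assumes "\<phi> \<in> S \<rightarrow> carrier G"
  shows "group_hom (free_group S) G (word_val G \<phi>)"
proof (intro group_hom.intro group_hom_axioms.intro group_free_group is_group homI)
  fix u v assume "u \<in> carrier (free_group S)" "v \<in> carrier (free_group S)"
  then have w: "u \<in> words_over S" "v \<in> words_over S" by (auto simp: free_group_def)
  have "cayley G (word_val G \<phi> (u \<otimes>\<^bsub>free_group S\<^esub> v))
      = cayley G (word_val G \<phi> u \<otimes> word_val G \<phi> v)"
    using w assms
    by (simp add: free_group_def cayley_word_val words_over_reduce words_over_append cayley_mult
        word_val_closed)
  then show "word_val G \<phi> (u \<otimes>\<^bsub>free_group S\<^esub> v) = word_val G \<phi> u \<otimes> word_val G \<phi> v"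
    using w assms by (simp add: free_group_def cayley_eq_iff word_val_closed
        words_over_reduce words_over_append)
qed (use assms in \<open>auto simp: free_group_def intro: word_val_closed\<close>)

end

lemma carrier_free_group [simp]: "w \<in> carrier (free_group S) \<longleftrightarrow> w \<in> words_over S \<and> reduced_word w"
  by (simp add: free_group_def)

text \<open>Turns a homomorphism out of the free group into a valuation of letters in a permutation
  group, the form in which \<open>presentation_criterion\<close> tests the relations.\<close>

lemma ev_cayley_free:
  assumes "group Q" "\<theta> \<in> hom (free_group S) Q" "w \<in> words_over S"
  shows "cayley Q (\<theta> (reduce_word w)) = ev (\<lambda>a. cayley Q (\<theta> [(a, True)])) w"
  using assms(3)
proof (induction w)
  case Nil
  interpret group_hom "free_group S" Q \<theta>
    using assms group_free_group by (auto intro!: group_hom.intro group_hom_axioms.intro)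
  show ?case using hom_one by (simp add: free_group_def reduce_word_def cayley_one)
next
  case (Cons l w)
  interpret group_hom "free_group S" Q \<theta>
    using assms group_free_group by (auto intro!: group_hom.intro group_hom_axioms.intro)
  obtain a b where l: "l = (a, b)" by fastforce
  have red: "reduced_word [(a, c)]" for c by (simp add: reduced_Cons)
  have ab: "[(a, c)] \<in> carrier (free_group S)" for c using Cons.prems l red by simp
  have w: "reduce_word w \<in> carrier (free_group S)"
    using Cons.prems by (simp add: words_over_reduce)
  have "reduce_word (l # w) = [l] \<otimes>\<^bsub>free_group S\<^esub> reduce_word w"
    using reduce_append_right[of "[l]" w] by (simp add: free_group_def)
  then have 1: "cayley Q (\<theta> (reduce_word (l # w))) = cayley Q (\<theta> [l]) + cayley Q (\<theta> (reduce_word w))"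
    using ab w l by (simp add: H.cayley_mult)
  have "[(a, False)] \<otimes>\<^bsub>free_group S\<^esub> [(a, True)] = \<one>\<^bsub>free_group S\<^esub>"
    by (simp add: free_group_def reduce_word_def inv_letter_def)
  then have "\<theta> [(a, False)] = inv\<^bsub>Q\<^esub> \<theta> [(a, True)]"
    using ab by (metis G.inv_equality hom_inv)
  then have "cayley Q (\<theta> [l]) = (if b then cayley Q (\<theta> [(a, True)]) else - cayley Q (\<theta> [(a, True)]))"
    using ab[of True] l by (auto simp: H.cayley_inv)
  then show ?case using 1 Cons l by simp
qed

text \<open>Consequences of the relations are tested in permutation groups; the quotients of the free group
  act on themselves, which are sets of words.\<close>

theorem presentation_criterion:
  fixes \<phi> :: "'a \<Rightarrow> 'g" and S :: "'a set"
  assumes G: "group G" and \<phi>: "\<phi> \<in> S \<rightarrow> carrier G" and R: "R \<subseteq> words_over S \<times> words_over S"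
    and surj: "carrier G \<subseteq> word_val G \<phi> ` words_over S"
    and rel: "\<And>u v. (u, v) \<in> R \<Longrightarrow> word_val G \<phi> u = word_val G \<phi> v"
    and faithful: "\<And>(\<psi> :: 'a \<Rightarrow> 'a letter list set permu) w.
      (\<forall>(u, v)\<in>R. ev \<psi> u = ev \<psi> v) \<Longrightarrow> w \<in> words_over S \<Longrightarrow> word_val G \<phi> w = \<one>\<^bsub>G\<^esub> \<Longrightarrow> ev \<psi> w = 0"
  shows "presentation G \<phi> S R"
proof -
  interpret G: group G by (rule G)
  interpret h: group_hom "free_group S" G "word_val G \<phi>" by (rule G.group_hom_word_val[OF \<phi>])
  have "carrier G \<subseteq> word_val G \<phi> ` carrier (free_group S)"
  proof
    fix g assume "g \<in> carrier G"
    then obtain w where w: "w \<in> words_over S" "g = word_val G \<phi> w" using surj by blast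
    then have "g = word_val G \<phi> (reduce_word w)" using G.word_val_reduce[OF \<phi>] by simp
    then show "g \<in> word_val G \<phi> ` carrier (free_group S)" using w by (simp add: words_over_reduce)
  qed
  moreover have relators: "relator ` R \<subseteq> kernel (free_group S) G (word_val G \<phi>)"
  proof safe
    fix u v assume uv: "(u, v) \<in> R"
    then have w: "u \<in> words_over S" "v \<in> words_over S" using R by auto
    then have ws: "relator (u, v) \<in> words_over S"
      by (simp add: relator_def words_over_reduce words_over_append words_over_inv_word)
    have "ev (\<lambda>a. cayley G (\<phi> a)) u = ev (\<lambda>a. cayley G (\<phi> a)) v"
      using rel[OF uv] w by (simp flip: G.cayley_word_val[OF \<phi>])
    then have "cayley G (word_val G \<phi> (relator (u, v))) = cayley G \<one>\<^bsub>G\<^esub>"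
      using ws by (simp add: G.cayley_word_val[OF \<phi>] G.cayley_one ev_relator)
    then show "relator (u, v) \<in> kernel (free_group S) G (word_val G \<phi>)"
      using ws G.word_val_closed[OF \<phi> ws] by (simp add: kernel_def G.cayley_eq_iff relator_def)
  qed
  moreover have "kernel (free_group S) G (word_val G \<phi>) \<subseteq> normal_closure (free_group S) (relator ` R)"
    unfolding normal_closure_def
  proof safe
    fix w N
    assume w: "w \<in> kernel (free_group S) G (word_val G \<phi>)"
      and N: "N \<lhd> free_group S" "relator ` R \<subseteq> N"
    interpret N: normal N "free_group S" by (rule N)
    \<comment> \<open>\<open>N\<close> is an arbitrary normal subgroup containing the relators. In
      the quotient by \<open>N\<close> the relations hold, so \<open>faithful\<close> forces
      \<open>w\<close> to become trivial there, which means that it lies in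
      \<open>N\<close>.\<close>
    define Q where "Q = free_group S Mod N"
    define \<theta> where "\<theta> = (\<lambda>u. N #>\<^bsub>free_group S\<^esub> u)"
    define \<psi> where "\<psi> = (\<lambda>a. cayley Q (\<theta> [(a, True)]))"
    have Q: "group Q" unfolding Q_def by (rule N.factorgroup_is_group)
    interpret Q: group Q by (rule Q)
    have \<theta>: "\<theta> \<in> hom (free_group S) Q" unfolding \<theta>_def Q_def by (rule N.r_coset_hom_Mod)
    have one: "\<one>\<^bsub>Q\<^esub> = N" by (simp add: Q_def)
    have \<theta>N: "\<theta> u = N \<longleftrightarrow> u \<in> N" if "u \<in> carrier (free_group S)" for u
      unfolding \<theta>_def
      by (metis group.coset_join1 group.coset_join2 group_free_group N.is_subgroup N.subset that)
    have ev: "ev \<psi> u = cayley Q (\<theta> (reduce_word u))" if "u \<in> words_over S" for u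
      unfolding \<psi>_def using ev_cayley_free[OF Q \<theta> that] by simp
    have "ev \<psi> u = ev \<psi> v" if uv: "(u, v) \<in> R" for u v
    proof -
      have r: "relator (u, v) \<in> N" using N uv by auto
      then have c: "relator (u, v) \<in> carrier (free_group S)" using N.subset by auto
      then have "ev \<psi> (relator (u, v)) = 0"
        using \<theta>N[OF c] r ev[of "relator (u, v)"] by (simp add: reduce_reduced Q.cayley_one flip: one)
      then show ?thesis by (simp add: ev_relator)
    qed
    moreover have ws: "w \<in> carrier (free_group S)" "word_val G \<phi> w = \<one>\<^bsub>G\<^esub>"
      using w by (simp_all add: kernel_def)
    ultimately have "ev \<psi> w = 0" by (intro faithful) auto
    then have "cayley Q (\<theta> w) = cayley Q \<one>\<^bsub>Q\<^esub>"
      using ws ev[of w] by (simp add: reduce_reduced Q.cayley_one)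
    moreover have "\<theta> w \<in> carrier Q" using \<theta> ws by (auto simp: hom_def)
    ultimately have "\<theta> w = N" by (metis Q.cayley_eq_iff Q.one_closed one)
    then show "w \<in> N" using \<theta>N ws by simp
  qed
  moreover have "normal_closure (free_group S) (relator ` R) \<subseteq> kernel (free_group S) G (word_val G \<phi>)"
    using relators h.normal_kernel by (auto simp: normal_closure_def)
  ultimately show ?thesis
    using G \<phi> R h.hom_closed unfolding presentation_def by blast
qed

section \<open>The relations in the homeomorphism group\<close>

lemma homeo_imp_bij: "homeomorphism UNIV UNIV f g \<Longrightarrow> bij f"
  by (rule bij_betw_byWitness[where f' = g]) (auto simp: homeomorphism_def)

lemma bij_act_below:
  assumes "bij f" shows "bij (act_below s f)"
proof (rule bij_betw_byWitness[where f' = "act_below s (inv_into UNIV f)"])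
  have *: "act_below s h (act_below s k \<xi>) = \<xi>" if "\<And>\<xi>. h (k \<xi>) = \<xi>" for h k \<xi>
    by (cases "\<exists>\<eta>. \<xi> = s \<frown> \<eta>") (auto simp: that act_below_outside)
  show "\<forall>\<xi>\<in>UNIV. act_below s (inv_into UNIV f) (act_below s f \<xi>) = \<xi>"
    "\<forall>\<xi>\<in>UNIV. act_below s f (act_below s (inv_into UNIV f) \<xi>) = \<xi>"
    using assms by (auto intro!: * simp: bij_def surj_f_inv_f)
qed auto

section \<open>Permutations acting in the cone below a finite sequence\<close>

definition under :: "bool list \<Rightarrow> bool word permu \<Rightarrow> bool word permu" where
  "under s p = Permu (act_below s (app p))"

lemma bij_app: "bij (app p)"
  using app[of p] by simp

lemma app_under [simp]: "app (under s p) = act_below s (app p)"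
  by (simp add: under_def app_Permu bij_act_below bij_app)

lemma act_below_append: "act_below s f ((s @ u) \<frown> \<eta>) = s \<frown> f (u \<frown> \<eta>)"
  using act_below_conc[of s f "u \<frown> \<eta>"] by simp

lemma conc_neq_parallel: "s \<parallel> t \<Longrightarrow> s \<frown> \<eta> \<noteq> t \<frown> \<zeta>"
proof
  assume "s \<parallel> t" and eq: "s \<frown> \<eta> = t \<frown> \<zeta>"
  then obtain as b bs c cs where *: "b \<noteq> c" "s = as @ b # bs" "t = as @ c # cs"
    using parallel_decomp by blast
  have "(s \<frown> \<eta>) (length as) = b" "(t \<frown> \<zeta>) (length as) = c"
    by (simp_all add: *)
  with eq * show False by simp
qed

lemma act_below_parallel: "s \<parallel> t \<Longrightarrow> act_below s f (t \<frown> \<eta>) = t \<frown> \<eta>"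
  by (rule act_below_outside) (metis conc_neq_parallel)

lemma under_cases:
  obtains \<eta> where "\<xi> = s \<frown> \<eta>" | "\<And>\<eta>. \<xi> \<noteq> s \<frown> \<eta>"
  by blast

lemma under_add: "under s (p + q) = under s p + under s q"
proof (rule permu_eqI)
  show "app (under s (p + q)) \<xi> = app (under s p + under s q) \<xi>" for \<xi>
    by (cases \<xi> rule: under_cases[of _ s]) (auto simp: act_below_outside)
qed

lemma additive_hom_under: "additive_hom (under s)"
  by (simp add: additive_hom_def under_add)

lemmas under_simps = additive_hom_simps[OF additive_hom_under]

lemma under_under: "under s (under t p) = under (s @ t) p"
proof (rule permu_eqI)
  fix \<xi>
  show "app (under s (under t p)) \<xi> = app (under (s @ t) p) \<xi>"
  proof (cases \<xi> rule: under_cases[of _ s])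
    case (1 \<eta>)
    then show ?thesis
    proof (cases \<eta> rule: under_cases[of _ t])
      case (1 \<zeta>)
      then show ?thesis
        using \<open>\<xi> = s \<frown> \<eta>\<close> act_below_conc[of "s @ t" "app p" \<zeta>]
        by (simp add: act_below_append)
    next
      case 2
      have "\<And>\<zeta>. s \<frown> \<eta> \<noteq> (s @ t) \<frown> \<zeta>" using 2 by (simp flip: conc_conc)
      then show ?thesis using \<open>\<xi> = s \<frown> \<eta>\<close> 2 by (simp add: act_below_outside)
    qed
  next
    case 2
    have "\<And>\<zeta>. \<xi> \<noteq> (s @ t) \<frown> \<zeta>" using 2 by (simp flip: conc_conc)
    then show ?thesis using 2 by (simp add: act_below_outside)
  qed
qed

text \<open>Extends the partial action t.x_s from the generators to arbitrary permutations: the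
  prefix \<open>t\<close> is exchanged for \<open>t'\<close> and the tail is left alone.\<close>

definition carries :: "bool word permu \<Rightarrow> bool list \<Rightarrow> bool list \<Rightarrow> bool" where
  "carries p t t' \<longleftrightarrow> (\<forall>\<eta>. app p (t \<frown> \<eta>) = t' \<frown> \<eta>)"

text \<open>If \<open>t\<close> were shorter than \<open>t'\<close>, the digit at position
  \<open>length t\<close> would be free on one side and prescribed on the other; two constant tails
  with different digits detect this. The lemma later shows that an element acting trivially keeps
  the leaves of a tree.\<close>

lemma carries_zero [simp]: "carries 0 t t' \<longleftrightarrow> t = t'"
proof
  assume c: "carries 0 t t'"
  have *: False if "t \<frown> (\<lambda>_. b) = t' \<frown> (\<lambda>_. b)" "t \<frown> (\<lambda>_. \<not> b) = t' \<frown> (\<lambda>_. \<not> b)"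
    "length t < length t'" for t t' :: "bool list" and b
  proof -
    have "(t \<frown> (\<lambda>_. b)) (length t) = b" "(t \<frown> (\<lambda>_. \<not> b)) (length t) = (\<not> b)" by simp_all
    moreover have "(t' \<frown> (\<lambda>_. b)) (length t) = t' ! length t"
      "(t' \<frown> (\<lambda>_. \<not> b)) (length t) = t' ! length t" using that(3) by (simp_all add: conc_fst)
    ultimately show False using that by metis
  qed
  have e: "t \<frown> \<eta> = t' \<frown> \<eta>" for \<eta> using c by (simp add: carries_def)
  have "length t = length t'"
    using *[OF e e] *[OF e[symmetric] e[symmetric]] by (meson linorder_neqE_nat)
  with e[of undefined] show "t = t'" by (simp add: concat_eq)
qed (simp add: carries_def)

lemma carries_add: "carries p t t' \<Longrightarrow> carries q t' t'' \<Longrightarrow> carries (p + q) t t''"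
  by (simp add: carries_def)

lemma carries_uminus: "carries (- p) t' t \<longleftrightarrow> carries p t t'"
  unfolding carries_def by (metis app_uminus_app)

text \<open>A permutation confined to the cone below \<open>t\<close> is conjugated by
  \<open>p\<close> into the same permutation below \<open>t'\<close>. The relations
  \<open>R2\<close>, \<open>R3\<close> and \<open>R4\<close> come from this, the last one with
  \<open>t = t'\<close>.\<close>

lemma under_carries:
  assumes "carries p t t'" shows "under t q + p = p + under t' q"
proof (rule permu_eqI)
  fix \<xi>
  show "app (under t q + p) \<xi> = app (p + under t' q) \<xi>"
  proof (cases \<xi> rule: under_cases[of _ t])
    case (1 \<eta>)
    then show ?thesis using assms by (simp add: carries_def)
  next
    case 2
    have "app p \<xi> \<noteq> t' \<frown> \<eta>" for \<eta>
      using 2 assms unfolding carries_def by (metis app_uminus_app(1))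
    then show ?thesis using 2 by (simp add: act_below_outside)
  qed
qed

lemma carries_under_parallel: "s \<parallel> t \<Longrightarrow> carries (under s p) t t"
  by (simp add: carries_def act_below_parallel)

lemma comm_under: "s \<parallel> t \<Longrightarrow> comm (under s p) (under t q)"
  unfolding comm_def using under_carries[OF carries_under_parallel] by metis

section \<open>The generators as permutations and their relations\<close>

definition px :: "bool list \<Rightarrow> bool word permu" where
  "px s = Permu (x_at s)"

definition py :: "bool list \<Rightarrow> bool word permu" where
  "py s = Permu (y_at s)"

lemma bij_cantor_x: "bij cantor_x" and bij_cantor_y: "bij cantor_y"
  by (rule homeo_imp_bij homeomorphism_cantor_x homeomorphism_cantor_y)+

lemma px_under: "px s = under s (px [])" and py_under: "py s = under s (py [])"
  by (simp_all add: px_def py_def under_def x_at_def y_at_def app_Permu bij_cantor_x bij_cantor_y)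

lemma under_px: "under s (px t) = px (s @ t)" and under_py: "under s (py t) = py (s @ t)"
  by (metis px_under under_under, metis py_under under_under)

lemma app_px: "app (px s) = x_at s" and app_py: "app (py s) = y_at s"
  by (simp_all add: px_def py_def app_Permu x_at_def y_at_def bij_act_below bij_cantor_x bij_cantor_y)

lemma app_px_Nil [simp]: "app (px []) = cantor_x" and app_py_Nil [simp]: "app (py []) = cantor_y"
  by (simp_all add: app_px app_py x_at_def y_at_def)

lemma app_uminus_py_Nil [simp]: "app (- py []) = cantor_y_inv"
proof
  show "app (- py []) \<xi> = cantor_y_inv \<xi>" for \<xi>
    using app_uminus_app(1)[of "py []" "cantor_y_inv \<xi>"] by simp
qed

lemma act_below_Cons_conc [simp]:
  "act_below (b # s) f ((c # u) \<frown> \<eta>) =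
     (if b = c then [b] \<frown> act_below s f (u \<frown> \<eta>) else (c # u) \<frown> \<eta>)"
proof (cases "b = c")
  case True
  have "act_below (b # s) f ([b] \<frown> \<zeta>) = [b] \<frown> act_below s f \<zeta>" for \<zeta>
  proof (cases \<zeta> rule: under_cases[of _ s])
    case (1 \<eta>)
    then show ?thesis using act_below_conc[of "b # s" f \<eta>] by simp
  next
    case 2
    have "[b] \<frown> \<zeta> \<noteq> (b # s) \<frown> \<xi>" for \<xi>
      using 2[of \<xi>] same_concat_eq[of "[b]" \<zeta> "s \<frown> \<xi>"] by simp
    with 2 show ?thesis by (simp add: act_below_outside)
  qed
  from this[of "u \<frown> \<eta>"] True show ?thesis by simp
next
  case False
  then show ?thesis by (auto intro!: act_below_parallel Cons_parallelI1)
qed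

lemma cantor_x_Cons_conc [simp]:
  "cantor_x ((False # False # u) \<frown> \<eta>) = (False # u) \<frown> \<eta>"
  "cantor_x ((False # True # u) \<frown> \<eta>) = (True # False # u) \<frown> \<eta>"
  "cantor_x ((True # u) \<frown> \<eta>) = (True # True # u) \<frown> \<eta>"
  using cantor_x_simps[of "u \<frown> \<eta>"] by simp_all

lemma seq_image_carries: "seq_image s t t' \<Longrightarrow> carries (px s) t t'"
proof (induction rule: seq_image.induct)
  case (1 t)
  then show ?case
    using carries_under_parallel[of s t "px []"] by (simp add: under_px parallel_commute)
qed (simp_all add: carries_def app_px x_at_def act_below_append)

lemma px_square: "px s + px s = px (s @ [False]) + px s + px (s @ [True])"
proof -
  have "px [] + px [] = px [False] + px [] + px [True]"
  proof (rule permu_eqI)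
    fix \<xi>
    show "app (px [] + px []) \<xi> = app (px [False] + px [] + px [True]) \<xi>"
    proof (cases \<xi> rule: word_cases_x)
      case (1 \<eta>)
      then show ?thesis
        by (cases \<eta> rule: word_cases_1) (auto simp: app_px x_at_def)
    qed (auto simp: app_px x_at_def)
  qed
  \<comment> \<open>Since \<open>under s\<close> is a homomorphism, the identity at the root carries
    over to the vertex \<open>s\<close>.\<close>
  from arg_cong[OF this, of "under s"] show ?thesis by (simp add: under_add under_px)
qed

lemma px_conj: "seq_image s t t' \<Longrightarrow> px t + px s = px s + px t'"
  and py_conj: "seq_image s t t' \<Longrightarrow> py t + px s = px s + py t'"
  using under_carries[OF seq_image_carries, of s t t' "px []"]
    under_carries[OF seq_image_carries, of s t t' "py []"]
  by (simp_all add: under_px under_py)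

lemma py_comm: "s \<parallel> t \<Longrightarrow> py s + py t = py t + py s"
  using comm_under[of s t "py []" "py []"] by (simp add: under_py comm_def)

text \<open>The recursive definition of y read as a product: x exchanges the prefixes 00, 01, 1 for
  0, 10, 11, and then y, its inverse and y act on the tails.\<close>

lemma py_expand:
  "py s = px s + py (s @ [False]) - py (s @ [True, False]) + py (s @ [True, True])"
proof -
  have "py [] = px [] + under [False] (py []) + under [True, False] (- py []) + under [True, True] (py [])"
  proof (rule permu_eqI)
    fix \<xi>
    show "app (py []) \<xi> = app (px [] + under [False] (py []) + under [True, False] (- py [])
      + under [True, True] (py [])) \<xi>"
      by (cases \<xi> rule: word_cases_x) auto
  qed
  from arg_cong[OF this, of "under s"] show ?thesis
    by (simp add: under_simps under_under under_px under_py)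
qed

section \<open>Moves on binary sequences\<close>

lemma seq_image_append: "seq_image r s s' \<Longrightarrow> seq_image r (s @ u) (s' @ u)"
proof (induction rule: seq_image.induct)
  case (1 t)
  then show ?case by (metis append_Nil2 parallel_append seq_image.intros(1))
next
  case (2 v)
  show ?case using seq_image.intros(2)[of r "v @ u"] by simp
next
  case (3 v)
  show ?case using seq_image.intros(3)[of r "v @ u"] by simp
next
  case (4 v)
  show ?case using seq_image.intros(4)[of r "v @ u"] by simp
qed

lemma parallel_append_left [simp]: "r @ s \<parallel> r @ t \<longleftrightarrow> s \<parallel> t"
  by (simp add: parallel_def)

lemma seq_image_prepend: "seq_image r s s' \<Longrightarrow> seq_image (u @ r) (u @ s) (u @ s')"
proof (induction rule: seq_image.induct)
  case (1 t)
  then show ?case by (intro seq_image.intros(1)) simp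
next
  case (2 v)
  show ?case using seq_image.intros(2)[of "u @ r" v] by simp
next
  case (3 v)
  show ?case using seq_image.intros(3)[of "u @ r" v] by simp
next
  case (4 v)
  show ?case using seq_image.intros(4)[of "u @ r" v] by simp
qed

lemma seq_image_Nil:
  "seq_image [] (False # False # u) (False # u)"
  "seq_image [] (False # True # u) (True # False # u)"
  "seq_image [] (True # u) (True # True # u)"
  using seq_image.intros(2-4)[of "[]" u] by simp_all

lemma seq_image_True:
  "seq_image [True] (True # False # False # u) (True # False # u)"
  "seq_image [True] (True # False # True # u) (True # True # False # u)"
  "seq_image [True] (True # True # u) (True # True # True # u)"
  "seq_image [True] (False # u) (False # u)"
  using seq_image.intros(2-4)[of "[True]" u] seq_image.intros(1)[of "False # u" "[True]"]
  by (simp_all add: Cons_parallelI1)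

text \<open>With x_n standing for x at the vertex 1^n, this is the source of the relations x_m x_n =
  x_n x_(m+1), n < m, of the infinite presentation of F.\<close>

lemma seq_image_spine:
  assumes "n < m" shows "seq_image (replicate n True) (replicate m True) (replicate (Suc m) True)"
proof -
  define k where "k = m - n - 1"
  with assms have m: "m = n + Suc k" by simp
  have "replicate n True @ [True] @ replicate k True = replicate m True"
    by (simp add: m replicate_add replicate_append_same)
  moreover have "replicate n True @ [True, True] @ replicate k True = replicate (Suc m) True"
    unfolding m add_Suc_right[symmetric] by (simp only: replicate_add) (simp add: replicate_append_same)
  ultimately show ?thesis
    using seq_image.intros(4)[of "replicate n True" "replicate k True"] by simp
qed

text \<open>Steps of x and x_1, taken in both directions, lead from any sequence to one of four
  representatives: the empty sequence, 0 for the powers of 0, 1 for the powers of 1, and 10 for all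
  sequences with both digits. For the last kind, x_1 sends 100u to 10u, and it sends 101u to 110u,
  which is also the image of 10u under x.\<close>

lemma orbit_induct:
  assumes Nil: "\<And>t t'. seq_image [] t t' \<Longrightarrow> Q t \<longleftrightarrow> Q t'"
    and True: "\<And>t t'. seq_image [True] t t' \<Longrightarrow> Q t \<longleftrightarrow> Q t'"
    and base: "Q []" "Q [False]" "Q [True]" "Q [True, False]"
  shows "Q s"
proof -
  have *: "Q (True # False # u)" for u
  proof (induction u)
    case (Cons b u)
    then show ?case
      using Nil[OF seq_image_Nil(3)[of "False # u"]] True[OF seq_image_True(1)[of u]]
        True[OF seq_image_True(2)[of u]]
      by (cases b) simp_all
  qed (simp add: base)
  have **: "Q (True # u)" for u
  proof (induction u)
    case (Cons b u)
    then show ?case using Nil[OF seq_image_Nil(3)[of u]] * by (cases b) simp_all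
  qed (simp add: base)
  have "Q (False # u)" for u
  proof (induction u)
    case (Cons b u)
    then show ?case
      using Nil[OF seq_image_Nil(1)[of u]] Nil[OF seq_image_Nil(2)[of u]] * by (cases b) simp_all
  qed (simp add: base)
  with ** base show ?thesis by (cases s) (metis (full_types))+
qed

section \<open>Thompson's group\<close>

datatype btree = Lf | Nd btree btree

fun leaves :: "btree \<Rightarrow> bool list list" where
  "leaves Lf = [[]]"
| "leaves (Nd l r) = map (Cons False) (leaves l) @ map (Cons True) (leaves r)"

fun min_depth :: "btree \<Rightarrow> nat" where
  "min_depth Lf = 0"
| "min_depth (Nd l r) = Suc (min (min_depth l) (min_depth r))"

fun full_tree :: "nat \<Rightarrow> btree" where
  "full_tree 0 = Lf"
| "full_tree (Suc n) = Nd (full_tree n) (full_tree n)"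

text \<open>The effect of x at the vertex 1^n on a tree: the subtrees at 00, 01 and 1 below that
  vertex become those at 0, 10 and 11.\<close>

inductive rotation :: "nat \<Rightarrow> btree \<Rightarrow> btree \<Rightarrow> bool" where
  rot_0: "rotation 0 (Nd (Nd a b) r) (Nd a (Nd b r))"
| rot_Suc: "rotation n r r' \<Longrightarrow> rotation (Suc n) (Nd l r) (Nd l r')"

text \<open>A tree is turned into a right comb by rotations along its right spine; \<open>comb_word A k t\<close> is
  the product of the corresponding elements, the root of \<open>t\<close> being the vertex \<open>1\<^sup>k\<close>.\<close>

function comb_word :: "(nat \<Rightarrow> 'g::group_add) \<Rightarrow> nat \<Rightarrow> btree \<Rightarrow> 'g" where
  "comb_word A k Lf = 0"
| "comb_word A k (Nd Lf r) = comb_word A (Suc k) r"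
| "comb_word A k (Nd (Nd a b) r) = A k + comb_word A k (Nd a (Nd b r))"
  by pat_completeness auto
termination
  \<comment> \<open>A rotation keeps the size of the tree and shrinks its left subtree.\<close>
  by (relation "measures [\<lambda>(A, k, t). size t, \<lambda>(A, k, t). (case t of Lf \<Rightarrow> 0 | Nd l r \<Rightarrow> size l)]") auto

lemma comb_word_induct [case_names Lf Lf_Nd Nd_Nd]:
  assumes "\<And>k. P k Lf" "\<And>k r. P (Suc k) r \<Longrightarrow> P k (Nd Lf r)"
    "\<And>k a b r. P k (Nd a (Nd b r)) \<Longrightarrow> P k (Nd (Nd a b) r)"
  shows "P k t"
  by (rule comb_word.induct[of "\<lambda>_. P"]) (use assms in blast)+

lemma min_depth_full_tree [simp]: "min_depth (full_tree n) = n"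
  by (induction n) auto

lemma set_leaves_full_tree: "set (leaves (full_tree n)) = {t. length t = n}"
proof (induction n)
  case (Suc n)
  have "{t :: bool list. length t = Suc n} =
    Cons False ` {t. length t = n} \<union> Cons True ` {t. length t = n}"
    by (auto simp: length_Suc_conv image_iff)
  with Suc show ?case by simp
qed auto

text \<open>The first digits separate the leaves of the two subtrees, so the tree can be read off
  recursively.\<close>

lemma leaves_eqD: "leaves t = leaves t' \<Longrightarrow> t = t'"
proof (induction t arbitrary: t')
  case Lf
  then show ?case by (cases t') (auto simp: Cons_eq_append_conv)
next
  case (Nd l r)
  have *: "filter (\<lambda>s. \<not> hd s) (leaves (Nd a b)) = map (Cons False) (leaves a)"
    "filter hd (leaves (Nd a b)) = map (Cons True) (leaves b)" for a b
    by (simp_all add: filter_map o_def)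
  show ?case
  proof (cases t')
    case Lf
    with Nd.prems show ?thesis
      by (auto simp: append_eq_Cons_conv)
  next
    case t': (Nd a b)
    then have "map (Cons False) (leaves l) = map (Cons False) (leaves a)"
      "map (Cons True) (leaves r) = map (Cons True) (leaves b)"
      using Nd.prems * by metis+
    then have "leaves l = leaves a" "leaves r = leaves b" by (auto simp: inj_map_eq_map)
    with Nd.IH t' show ?thesis by blast
  qed
qed

text \<open>A rotation at 1^n needs 1^n and its left child to be inner vertices, whence
  \<open>n + 2\<close>. The loss of at most one level is recorded because many rotations will be
  applied to one tree in succession.\<close>

lemma rotation_exists:
  "n + 2 \<le> min_depth t \<Longrightarrow> \<exists>t'. rotation n t t' \<and> min_depth t \<le> Suc (min_depth t')"
proof (induction n arbitrary: t)
  case 0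
  then obtain l r where "t = Nd l r" "1 \<le> min_depth l" by (cases t) auto
  then obtain a b where t: "t = Nd (Nd a b) r" by (cases l) auto
  show ?case unfolding t by (rule exI[of _ "Nd a (Nd b r)"]) (auto intro: rot_0)
next
  case (Suc n)
  then obtain l r where t: "t = Nd l r" by (cases t) auto
  then obtain r' where "rotation n r r'" "min_depth r \<le> Suc (min_depth r')"
    using Suc.IH[of r] Suc.prems by auto
  then show ?case unfolding t by (intro exI[of _ "Nd l r'"] conjI rot_Suc) auto
qed

lemma rotation_inverse_exists:
  "n + 2 \<le> min_depth t \<Longrightarrow> \<exists>t'. rotation n t' t \<and> min_depth t \<le> Suc (min_depth t')"
proof (induction n arbitrary: t)
  case 0
  then obtain a t' where "t = Nd a t'" "1 \<le> min_depth t'" by (cases t) auto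
  then obtain b r where t: "t = Nd a (Nd b r)" by (cases t') auto
  show ?case unfolding t by (rule exI[of _ "Nd (Nd a b) r"]) (auto intro: rot_0)
next
  case (Suc n)
  then obtain l r where t: "t = Nd l r" by (cases t) auto
  then obtain r' where "rotation n r' r" "min_depth r \<le> Suc (min_depth r')"
    using Suc.IH[of r] Suc.prems by auto
  then show ?case unfolding t by (intro exI[of _ "Nd l r'"] conjI rot_Suc) auto
qed

lemma carries_under: "carries p t t' \<Longrightarrow> carries (under s p) (s @ t) (s @ t')"
  by (simp add: carries_def act_below_append)

lemma rotation_leaves:
  "rotation n t t' \<Longrightarrow> list_all2 (carries (px (replicate n True))) (leaves t) (leaves t')"
proof (induction rule: rotation.induct)
  case (rot_0 a b r)
  show ?case
    by (auto simp: list.rel_map o_def list_all2_same intro!: list_all2_appendI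
        seq_image_carries seq_image_Nil simp flip: append_assoc)
next
  case (rot_Suc n r r' l)
  have eq: "px (True # s) = under [True] (px s)" for s by (simp add: under_px)
  have "carries (px (True # replicate n True)) (False # t) (False # t)" for t
    using carries_under_parallel[of "[True]" "False # t"] by (simp add: eq Cons_parallelI1)
  moreover have "carries (px (True # replicate n True)) (True # t) (True # t')"
    if "carries (px (replicate n True)) t t'" for t t'
    using carries_under[OF that, of "[True]"] by (simp add: eq)
  moreover from this have "list_all2 (\<lambda>t t'. carries (px (True # replicate n True)) (True # t) (True # t'))
      (leaves r) (leaves r')"
    using rot_Suc.IH by (rule_tac list.rel_mono_strong)
  ultimately show ?case
    by (auto simp: list.rel_map list_all2_same intro!: list_all2_appendI)
qed

text \<open>A group with the relations of the infinite presentation of F and a homomorphism to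
  permutations. It serves both where all relations are given and where they have been derived from
  finitely many.\<close>

locale thompson =
  fixes A :: "nat \<Rightarrow> 'g::group_add" and \<rho> :: "'g \<Rightarrow> bool word permu"
  assumes rel: "n < m \<Longrightarrow> A m + A n = A n + A (Suc m)"
    and hom: "additive_hom \<rho>"
    and \<rho>_A: "\<rho> (A n) = px (replicate n True)"
begin

lemmas hom_simps = additive_hom_simps[OF hom]

text \<open>The combing of \<open>t\<close> may begin with any rotation. If it prescribes one at the
  root while the given one lies further down the spine, the root rotation pushes the lower vertex
  from 1^n to 1^(n+1), and the two orders agree by \<open>rel\<close>.\<close>

lemma comb_word_rotation:
  "rotation n t t' \<Longrightarrow> comb_word A k t = A (k + n) + comb_word A k t'"
proof (induction k t arbitrary: n t' rule: comb_word_induct)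
  case (Lf k)
  then show ?case by (auto elim: rotation.cases)
next
  case (Lf_Nd k r)
  from Lf_Nd.prems obtain m r' where "n = Suc m" "t' = Nd Lf r'" "rotation m r r'"
    by (auto elim: rotation.cases)
  with Lf_Nd.IH show ?case by simp
next
  case (Nd_Nd k a b r)
  from Nd_Nd.prems consider "n = 0" "t' = Nd a (Nd b r)"
    | m r' where "n = Suc m" "t' = Nd (Nd a b) r'" "rotation m r r'"
    by (auto elim: rotation.cases)
  then show ?case
  proof cases
    case 2
    then have "comb_word A k (Nd a (Nd b r)) = A (k + Suc (Suc m)) + comb_word A k (Nd a (Nd b r'))"
      by (intro Nd_Nd.IH rot_Suc)
    then have "comb_word A k (Nd (Nd a b) r)
        = A k + A (Suc (k + Suc m)) + comb_word A k (Nd a (Nd b r'))"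
      by (simp add: add.assoc)
    also have "\<dots> = A (k + Suc m) + (A k + comb_word A k (Nd a (Nd b r')))"
      by (simp add: add.assoc flip: rel)
    finally show ?thesis using 2 by simp
  qed simp
qed

text \<open>\<open>d\<close> is a depth from which \<open>h\<close> acts on every tree, and
  \<open>k\<close> bounds the depth lost on the way. The bound makes the property pass to sums: a
  tree deep enough for the first summand must still be deep enough for the second.\<close>

definition traced :: "'g \<Rightarrow> bool" where
  "traced h \<longleftrightarrow> (\<exists>d k. \<forall>t. d \<le> min_depth t \<longrightarrow> (\<exists>t'. comb_word A 0 t = h + comb_word A 0 t' \<and>
     list_all2 (carries (\<rho> h)) (leaves t) (leaves t') \<and> min_depth t \<le> min_depth t' + k))"

lemma list_all2_carries_uminus:
  "list_all2 (carries (- p)) xs ys \<longleftrightarrow> list_all2 (carries p) ys xs"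
  by (auto simp: list_all2_conv_all_nth carries_uminus)

lemma traced_A: "traced (A n)"
  unfolding traced_def
proof (rule exI[of _ "n + 2"], rule exI[of _ 1], intro allI impI)
  fix t assume "n + 2 \<le> min_depth t"
  then obtain t' where "rotation n t t'" "min_depth t \<le> min_depth t' + 1"
    using rotation_exists by fastforce
  then show "\<exists>t'. comb_word A 0 t = A n + comb_word A 0 t' \<and>
     list_all2 (carries (\<rho> (A n))) (leaves t) (leaves t') \<and> min_depth t \<le> min_depth t' + 1"
    using comb_word_rotation[of n t t' 0] rotation_leaves by (auto simp: \<rho>_A)
qed

lemma traced_uminus_A: "traced (- A n)"
  unfolding traced_def
proof (rule exI[of _ "n + 2"], rule exI[of _ 1], intro allI impI)
  fix t assume "n + 2 \<le> min_depth t"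
  then obtain t' where "rotation n t' t" "min_depth t \<le> min_depth t' + 1"
    using rotation_inverse_exists by fastforce
  then show "\<exists>t'. comb_word A 0 t = - A n + comb_word A 0 t' \<and>
     list_all2 (carries (\<rho> (- A n))) (leaves t) (leaves t') \<and> min_depth t \<le> min_depth t' + 1"
    using comb_word_rotation[of n t' t 0] rotation_leaves
    by (auto simp: \<rho>_A hom_simps list_all2_carries_uminus intro!: exI[of _ t'] simp flip: add.assoc)
qed

lemma traced_add:
  assumes "traced g" "traced h" shows "traced (g + h)"
proof -
  obtain d k d' k' where
    g: "\<And>t. d \<le> min_depth t \<Longrightarrow> \<exists>t'. comb_word A 0 t = g + comb_word A 0 t' \<and>
      list_all2 (carries (\<rho> g)) (leaves t) (leaves t') \<and> min_depth t \<le> min_depth t' + k" and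
    h: "\<And>t. d' \<le> min_depth t \<Longrightarrow> \<exists>t'. comb_word A 0 t = h + comb_word A 0 t' \<and>
      list_all2 (carries (\<rho> h)) (leaves t) (leaves t') \<and> min_depth t \<le> min_depth t' + k'"
    using assms unfolding traced_def by meson
  show ?thesis unfolding traced_def
  proof (rule exI[of _ "d + d' + k"], rule exI[of _ "k + k'"], intro allI impI)
    fix t assume t: "d + d' + k \<le> min_depth t"
    then obtain t1 where t1: "comb_word A 0 t = g + comb_word A 0 t1"
      "list_all2 (carries (\<rho> g)) (leaves t) (leaves t1)" "min_depth t \<le> min_depth t1 + k"
      using g[of t] by auto
    with t obtain t2 where t2: "comb_word A 0 t1 = h + comb_word A 0 t2"
      "list_all2 (carries (\<rho> h)) (leaves t1) (leaves t2)" "min_depth t1 \<le> min_depth t2 + k'"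
      using h[of t1] by auto
    have "list_all2 (carries (\<rho> (g + h))) (leaves t) (leaves t2)"
      by (rule list_all2_trans[OF _ t1(2) t2(2)]) (simp add: hom_simps carries_add)
    then show "\<exists>t'. comb_word A 0 t = g + h + comb_word A 0 t' \<and>
        list_all2 (carries (\<rho> (g + h))) (leaves t) (leaves t') \<and> min_depth t \<le> min_depth t' + (k + k')"
      using t1 t2 by (intro exI[of _ t2]) (auto simp: add.assoc)
  qed
qed

lemma gen_traced: "h \<in> gen (range A) \<Longrightarrow> traced h \<and> traced (- h)"
proof (induction rule: gen.induct)
  case gen_zero
  have "traced 0" unfolding traced_def
    by (rule exI[of _ 0], rule exI[of _ 0]) (auto simp: hom_simps list_all2_same)
  then show ?case by simp
next
  case (gen_add g h)
  then show ?case using traced_add[of "- h" "- g"] by (simp add: traced_add minus_add del: add_uminus_conv_diff)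
qed (auto simp: traced_A traced_uminus_A)

lemma gen_full_tree:
  assumes "h \<in> gen (range A)"
  shows "\<exists>d. \<forall>n\<ge>d. \<exists>t'. comb_word A 0 (full_tree n) = h + comb_word A 0 t' \<and>
     list_all2 (carries (\<rho> h)) (leaves (full_tree n)) (leaves t')"
  using gen_traced[OF assms] unfolding traced_def by (metis min_depth_full_tree)

theorem faithful:
  assumes "h \<in> gen (range A)" "\<rho> h = 0" shows "h = 0"
proof -
  obtain n t' where "comb_word A 0 (full_tree n) = h + comb_word A 0 t'"
    "list_all2 (carries 0) (leaves (full_tree n)) (leaves t')"
    using gen_full_tree[OF assms(1)] assms(2) by (metis order_refl)
  moreover from this have "full_tree n = t'"
    by (intro leaves_eqD) (simp add: list.rel_eq carries_zero[abs_def])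
  ultimately show ?thesis using add_right_cancel[of 0 "comb_word A 0 t'" h] by simp
qed

lemma faithful_eq:
  assumes "g \<in> gen (range A)" "h \<in> gen (range A)" "\<rho> g = \<rho> h" shows "g = h"
  using faithful[of "g - h"] assms by (simp add: gen_diff hom_simps)

text \<open>A sequence is a leaf of the full tree of its own length, and a long sequence makes this
  tree deep enough to be traced.\<close>

lemma gen_carries:
  assumes "h \<in> gen (range A)"
  shows "\<exists>d. \<forall>t. d \<le> length t \<longrightarrow> (\<exists>t'. carries (\<rho> h) t t')"
proof -
  obtain d where d: "\<And>n. d \<le> n \<Longrightarrow> \<exists>t'. list_all2 (carries (\<rho> h)) (leaves (full_tree n)) (leaves t')"
    using gen_full_tree[OF assms] by blast
  have "\<exists>t'. carries (\<rho> h) t t'" if "d \<le> length t" for t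
  proof -
    obtain t' where "list_all2 (carries (\<rho> h)) (leaves (full_tree (length t))) (leaves t')"
      using d \<open>d \<le> length t\<close> by blast
    moreover have "t \<in> set (leaves (full_tree (length t)))" by (simp add: set_leaves_full_tree)
    ultimately show ?thesis by (metis in_set_conv_nth list_all2_nthD)
  qed
  then show ?thesis by blast
qed

end

text \<open>The classical passage from two relations to infinitely many. Conjugation by
  \<open>A 0\<close> raises all positive indices by one, so the main case is \<open>n = 1\<close>,
  where \<open>m = 2\<close> and \<open>m = 3\<close> are the two given relations.\<close>

lemma thompson_relations:
  fixes A :: "nat \<Rightarrow> 'g::group_add"
  assumes A_0: "\<And>m. 0 < m \<Longrightarrow> A m + A 0 = A 0 + A (Suc m)"
    and A_12: "A 2 + A 1 = A 1 + A 3" and A_13: "A 3 + A 1 = A 1 + A 4" and "n < m"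
  shows "A m + A n = A n + A (Suc m)"
proof -
  define r where "r n m \<longleftrightarrow> A m + A n = A n + A (Suc m)" for n m
  have conj: "A (Suc m) = - A 0 + A m + A 0" if "0 < m" for m
    using A_0[OF that] by (simp add: add.assoc)
  have shift: "r (Suc n) (Suc m)" if "0 < n" "n < m" "r n m" for n m
  proof -
    have "A (Suc m) + A (Suc n) = - A 0 + (A m + A n) + A 0"
      using that by (simp add: conj[of n] conj[of m] add.assoc)
    also have "\<dots> = - A 0 + (A n + A (Suc m)) + A 0" using that by (simp add: r_def)
    also have "\<dots> = A (Suc n) + A (Suc (Suc m))"
      using that by (simp add: conj[of n] conj[of "Suc m"] add.assoc)
    finally show ?thesis by (simp add: r_def)
  qed
  have r1: "r 1 m" if "2 \<le> m" for m
    using that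
  proof (induction m rule: less_induct)
    case (less m)
    show ?case
    proof (cases "m \<le> 3")
      case True
      then have "m = 2 \<or> m = 3" using less.prems by auto
      then show ?thesis using A_12 A_13 by (auto simp: r_def eval_nat_numeral)
    next
      case False
      define k where "k = m - 2"
      with False have k: "m = Suc (Suc k)" "2 \<le> k" by simp_all
      have r1k: "r 1 k" "r 1 (Suc k)" using less.IH k by auto
      have "r 2 (Suc k)" using shift[of 1 k] r1k k by (simp add: numeral_2_eq_2)
      moreover from this have "r 3 m" using shift[of 2 "Suc k"] k by (simp add: numeral_3_eq_3 numeral_2_eq_2)
      ultimately have e: "A (Suc k) + A 2 = A 2 + A m" "A m + A 3 = A 3 + A (Suc m)"
        "A (Suc k) + A 1 = A 1 + A m"
        using k r1k by (simp_all add: r_def)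
      \<comment> \<open>The sum of \<open>A (Suc k)\<close>, \<open>A 2\<close> and
        \<open>A 1\<close> is rewritten in two ways, with the relations at the indices 2 and 3
        obtained by shifting and the known one at index 1. Cancelling \<open>A 2\<close> leaves the
        relation for \<open>m\<close>.\<close>
      have "A 2 + (A m + A 1) = A (Suc k) + (A 2 + A 1)" by (simp only: e(1)[symmetric] add.assoc[symmetric])
      also have "\<dots> = (A (Suc k) + A 1) + A 3" by (simp only: A_12 add.assoc)
      also have "\<dots> = A 1 + (A m + A 3)" by (simp only: e(3) add.assoc)
      also have "\<dots> = (A 1 + A 3) + A (Suc m)" by (simp only: e(2) add.assoc)
      also have "\<dots> = A 2 + (A 1 + A (Suc m))" by (simp only: A_12[symmetric] add.assoc)
      finally show ?thesis by (simp add: r_def)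
    qed
  qed
  have "r (Suc i) (Suc i + Suc k)" for i k
  proof (induction i)
    case 0
    show ?case using r1[of "Suc (Suc k)"] by simp
  next
    case (Suc i)
    then show ?case using shift[of "Suc i" "Suc i + Suc k"] by simp
  qed
  note pos = this
  show ?thesis
  proof (cases n)
    case 0
    then show ?thesis using A_0 \<open>n < m\<close> by simp
  next
    case (Suc i)
    define k where "k = m - n - 1"
    with Suc \<open>n < m\<close> have "m = Suc i + Suc k" by simp
    with pos[of i k] Suc show ?thesis by (simp add: r_def)
  qed
qed

section \<open>Standard forms\<close>

definition zmul :: "int \<Rightarrow> 'g::group_add \<Rightarrow> 'g" where
  "zmul n g = (if 0 \<le> n then ((+) g ^^ nat n) 0 else ((+) (- g) ^^ nat (- n)) 0)"

lemma zmul_0 [simp]: "zmul 0 g = 0"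
  by (simp add: zmul_def)

lemma zmul_Suc: "zmul (n + 1) g = g + zmul n g"
proof -
  consider "0 \<le> n" | "n = -1" | "n < -1" by linarith
  then show ?thesis
  proof cases
    case 1
    then have "nat (n + 1) = Suc (nat n)" by simp
    with 1 show ?thesis by (simp add: zmul_def)
  next
    case 3
    then have "nat (- n) = Suc (nat (- (n + 1)))" by simp
    with 3 show ?thesis by (simp add: zmul_def)
  qed (simp add: zmul_def)
qed

lemma zmul_1 [simp]: "zmul 1 g = g"
  using zmul_Suc[of 0 g] by simp

lemma zmul_pred: "zmul (n - 1) g = - g + zmul n g"
  using zmul_Suc[of "n - 1" g] by (simp flip: add.assoc)

lemma zmul_gen: "zmul n g \<in> gen {g}"
  by (induction n rule: int_induct[of _ 0]) (auto simp: zmul_Suc zmul_pred intro: gen_intros)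

lemma zmul_commute: "g + zmul n g = zmul n g + g"
  using comm_gen[OF zmul_gen, of g g n] by (auto simp: comm_def)

lemma zmul_Suc2: "zmul (n + 1) g = zmul n g + g"
  by (simp add: zmul_Suc zmul_commute)

lemma zmul_pred2: "zmul (n - 1) g = zmul n g - g"
  using zmul_Suc2[of "n - 1" g] by simp

lemma zmul_minus_1 [simp]: "zmul (- 1) g = - g"
  using zmul_pred2[of 0 g] by simp

lemma zmul_hom:
  assumes "additive_hom \<rho>" shows "\<rho> (zmul n g) = zmul n (\<rho> g)"
  by (induction n rule: int_induct[of _ 0])
     (simp_all add: zmul_Suc zmul_pred additive_hom_simps[OF assms] del: add_uminus_conv_diff)

lemma zmul_conj: "a + c = c + b \<Longrightarrow> zmul n a + c = c + zmul n b"
proof -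
  assume "a + c = c + b"
  then have "- c + a + c = b" by (simp add: add.assoc)
  moreover have "additive_hom (\<lambda>a. - c + a + c)"
    by (simp add: additive_hom_def add.assoc)
  ultimately have "zmul n b = - c + zmul n a + c" using zmul_hom[of "\<lambda>a. - c + a + c" n a] by simp
  then show ?thesis by (simp add: add.assoc)
qed

lemma conj_swap:
  fixes a b x :: "'g::group_add"
  assumes "a + x = x + b" shows "b - x = - x + a"
proof -
  have "b = - x + (a + x)" by (simp add: assms)
  then show ?thesis by (simp flip: add.assoc)
qed

text \<open>The word \<open>\<Prod> y\<^sub>s^n\<^sub>s\<close> with longer sequences first is recorded by the tree with label \<open>n\<^sub>s\<close> at the
  vertex \<open>s\<close>.\<close>

datatype ltree = L | N ltree int ltree

fun val :: "(bool list \<Rightarrow> 'g::group_add) \<Rightarrow> bool list \<Rightarrow> ltree \<Rightarrow> 'g" where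
  "val Y s L = 0"
| "val Y s (N l n r) = val Y (s @ [False]) l + val Y (s @ [True]) r + zmul n (Y s)"

fun supported :: "(bool list \<Rightarrow> bool) \<Rightarrow> bool list \<Rightarrow> ltree \<Rightarrow> bool" where
  "supported P s L = True"
| "supported P s (N l n r) \<longleftrightarrow>
     (n \<noteq> 0 \<longrightarrow> P s) \<and> supported P (s @ [False]) l \<and> supported P (s @ [True]) r"

text \<open>The largest total exponent along a branch. By \<open>R5\<close> an expansion takes one
  unit from s and puts one unit on each of s0, s10 and s11, no two of which lie on one branch. Hence
  the weight does not grow while \<open>root_size\<close> drops.\<close>

fun weight :: "ltree \<Rightarrow> nat" where
  "weight L = 0"
| "weight (N l n r) = nat \<bar>n\<bar> + max (weight l) (weight r)"

fun root_size :: "ltree \<Rightarrow> nat" where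
  "root_size L = 0"
| "root_size (N l n r) = nat \<bar>n\<bar>"

fun add_root :: "int \<Rightarrow> ltree \<Rightarrow> ltree" where
  "add_root k L = N L k L"
| "add_root k (N l n r) = N l (n + k) r"

text \<open>On the real line \<open>y\<close> is the doubling map and the two digits are the matrices
  \<open>(1 0; 1 1)\<close> and \<open>(1 1; 0 1)\<close>. Along a branch of a tree one multiplies these matrices, and the state
  is a nonzero row vector modulo 2 whose product with the remaining matrices is to be nonzero:
  \<open>Pos = (0 1)\<close>, \<open>Neg = (1 0)\<close>, \<open>Mix = (1 1)\<close>, while \<open>Any\<close> stands for no condition. A tree
  without potential cancellations is one which is \<open>tidy\<close>.\<close>

datatype state = Any | Pos | Neg | Mix

fun step :: "state \<Rightarrow> bool \<Rightarrow> state" where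
  "step Any _ = Any"
| "step Pos b = (if b then Pos else Mix)"
| "step Neg b = (if b then Mix else Neg)"
| "step Mix b = (if b then Neg else Pos)"

fun admits :: "state \<Rightarrow> int \<Rightarrow> bool" where
  "admits Pos n \<longleftrightarrow> 0 < n"
| "admits Neg n \<longleftrightarrow> n < 0"
| "admits _ n \<longleftrightarrow> True"

text \<open>Modulo 2 a power of y is diag(0, 1) for a positive and diag(1, 0) for a negative
  exponent. A nonzero label therefore determines the next state by its sign alone;
  \<open>admits\<close> asks that the state vector is not sent to zero.\<close>

definition sign_state :: "int \<Rightarrow> state" where
  "sign_state n = (if 0 < n then Pos else Neg)"

fun tidy :: "state \<Rightarrow> ltree \<Rightarrow> bool" where
  "tidy q L = True"
| "tidy q (N l n r) \<longleftrightarrow>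
     (if n = 0 then tidy (step q False) l \<and> tidy (step q True) r
      else admits q n \<and> tidy (step (sign_state n) False) l \<and> tidy (step (sign_state n) True) r)"

lemma tidy_Any: "tidy q t \<Longrightarrow> tidy Any t"
  by (induction q t rule: tidy.induct) (auto split: if_splits)

text \<open>In state \<open>Pos\<close> the label at the root is zero or positive, so adding 1
  cancels nothing and the states below the root stay the same.\<close>

lemma tidy_add_root_1: "tidy Pos t \<Longrightarrow> admits q 1 \<Longrightarrow> tidy q (add_root 1 t)"
  by (cases t; cases q) (auto simp: sign_state_def split: if_splits)

lemma tidy_add_root_m1: "tidy Neg t \<Longrightarrow> admits q (-1) \<Longrightarrow> tidy q (add_root (-1) t)"
  by (cases t; cases q) (auto simp: sign_state_def split: if_splits)

lemma weight_add_root: "weight (add_root k t) \<le> weight t + nat \<bar>k\<bar>"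
  by (cases t) auto

lemma val_add_root_1: "val Y s (add_root 1 t) = val Y s t + Y s"
  by (cases t) (simp_all add: zmul_Suc2 add.assoc)

lemma val_add_root_m1: "val Y s (add_root (-1) t) = val Y s t - Y s"
  by (cases t) (simp_all add: zmul_pred2 add_diff_eq)

lemmas val_add_root = val_add_root_1 val_add_root_m1

text \<open>Below a positive label the states at 00, 01 and 1 are \<open>Pos\<close>,
  \<open>Neg\<close> and \<open>Pos\<close>, matching the signs of the exponents in
  \<open>R5\<close>, so each unit is added to a subtree that accepts it. If the root label becomes
  zero, the states reached from \<open>q\<close> at 0, 10 and 11 still admit these signs.\<close>

lemma tidy_expand_pos:
  assumes "tidy q (N (N a 0 b) n r)" "0 < n"
  shows "tidy q (N (add_root 1 a) (n - 1) (N (add_root (-1) b) 0 (add_root 1 r)))"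
  using assms
  by (cases q) (auto simp: sign_state_def intro!: tidy_add_root_1 tidy_add_root_m1 split: if_splits)

lemma tidy_expand_neg:
  assumes "tidy q (N l n (N b 0 r))" "n < 0"
  shows "tidy q (N (N (add_root (-1) l) 0 (add_root 1 b)) (n + 1) (add_root (-1) r))"
  using assms
  by (cases q) (auto simp: sign_state_def intro!: tidy_add_root_1 tidy_add_root_m1 split: if_splits)

text \<open>\<open>P\<close> tells for which \<open>s\<close> the letter y_s is available; the
  values of \<open>Y\<close> elsewhere are arbitrary. The homomorphism \<open>\<rho>\<close> belongs
  to the data because the aim is its injectivity on the subgroup generated by the letters.\<close>

locale LM =
  fixes X Y :: "bool list \<Rightarrow> 'g::group_add" and P :: "bool list \<Rightarrow> bool"
    and \<rho> :: "'g \<Rightarrow> bool word permu"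
  assumes P_append: "P s \<Longrightarrow> P (s @ u)"
    and P_image: "seq_image r s s' \<Longrightarrow> P s \<longleftrightarrow> P s'"
    and x_square: "X s + X s = X (s @ [False]) + X s + X (s @ [True])"
    and x_conj: "seq_image s t t' \<Longrightarrow> X t + X s = X s + X t'"
    and y_conj: "seq_image s t t' \<Longrightarrow> P t \<Longrightarrow> Y t + X s = X s + Y t'"
    and y_comm: "s \<parallel> t \<Longrightarrow> P s \<Longrightarrow> P t \<Longrightarrow> Y s + Y t = Y t + Y s"
    and y_expand: "P s \<Longrightarrow>
      Y s = X s + Y (s @ [False]) - Y (s @ [True, False]) + Y (s @ [True, True])"
    and hom: "additive_hom \<rho>"
    and \<rho>_X: "\<rho> (X s) = px s"
    and \<rho>_Y: "P s \<Longrightarrow> \<rho> (Y s) = py s"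
begin

lemmas hom_simps = additive_hom_simps[OF hom]

text \<open>\<open>XG s\<close> and \<open>XYG s\<close> express that an element is confined to the
  cone below \<open>s\<close>, in an abstract group where no action is at hand to say so.\<close>

definition XG :: "bool list \<Rightarrow> 'g set" where
  "XG s = gen (range (\<lambda>u. X (s @ u)))"

definition XYG :: "bool list \<Rightarrow> 'g set" where
  "XYG s = gen (range (\<lambda>u. X (s @ u)) \<union> {Y (s @ u) |u. P (s @ u)})"

lemma XG_XYG: "XG s \<subseteq> XYG s"
  unfolding XG_def XYG_def by (rule gen_mono) auto

lemma XG_append: "XG (s @ u) \<subseteq> XG s"
  unfolding XG_def by (rule gen_mono) auto

lemma XYG_append: "XYG (s @ u) \<subseteq> XYG s"
  unfolding XYG_def by (rule gen_mono) auto

lemma XG_appendD: "g \<in> XG (s @ u) \<Longrightarrow> g \<in> XG s"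
  using XG_append by blast

lemma X_in_XG [simp]: "X s \<in> XG s"
  unfolding XG_def by (rule gen_incl) (auto intro: range_eqI[of _ _ "[]"])

lemma Y_in_XYG: "P s \<Longrightarrow> Y s \<in> XYG s"
  unfolding XYG_def by (rule gen_incl) (auto intro: exI[of _ "[]"])

lemma XG_closed [intro]:
  "0 \<in> XG s" "g \<in> XG s \<Longrightarrow> h \<in> XG s \<Longrightarrow> g + h \<in> XG s" "g \<in> XG s \<Longrightarrow> - g \<in> XG s"
  unfolding XG_def by (auto intro: gen_intros)

lemma XYG_closed [intro]:
  "0 \<in> XYG s" "g \<in> XYG s \<Longrightarrow> h \<in> XYG s \<Longrightarrow> g + h \<in> XYG s" "g \<in> XYG s \<Longrightarrow> - g \<in> XYG s"
  "g \<in> XYG s \<Longrightarrow> h \<in> XYG s \<Longrightarrow> g - h \<in> XYG s"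
  unfolding XYG_def by (auto intro: gen_intros)

lemma val_in_XYG: "supported P s t \<Longrightarrow> val Y s t \<in> XYG s"
proof (induction t arbitrary: s)
  case (N l n r)
  have "zmul n (Y s) \<in> XYG s"
  proof (cases "n = 0")
    case False
    then have "gen {Y s} \<subseteq> XYG s"
      using N.prems Y_in_XYG[of s] unfolding XYG_def by (intro gen_subsetI) auto
    then show ?thesis using zmul_gen by blast
  qed auto
  with N show ?case using XYG_append by fastforce
qed auto

text \<open>On an incompatible sequence the partial action is the identity, so here
  \<open>R2\<close> and \<open>R3\<close> are commutation relations just like
  \<open>R4\<close>.\<close>

lemma XYG_comm:
  assumes "s \<parallel> t" "g \<in> XYG s" "h \<in> XYG t" shows "comm g h"
  using assms(2,3) unfolding XYG_def
proof (rule comm_gen_gen)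
  fix b c assume b: "b \<in> range (\<lambda>u. X (s @ u)) \<union> {Y (s @ u) |u. P (s @ u)}"
    and c: "c \<in> range (\<lambda>u. X (t @ u)) \<union> {Y (t @ u) |u. P (t @ u)}"
  have par: "s @ u \<parallel> t @ v" "t @ v \<parallel> s @ u" for u v
    using assms(1) parallel_append parallel_commute by blast+
  have "seq_image (s @ u) (t @ v) (t @ v)" "seq_image (t @ v) (s @ u) (s @ u)" for u v
    by (rule seq_image.intros par)+
  note x_conj[OF this(1)] x_conj[OF this(2)] y_conj[OF this(1)] y_conj[OF this(2)]
  with b c par show "comm b c" unfolding comm_def by (auto intro: y_comm)
qed

lemma supported_image: "seq_image r s s' \<Longrightarrow> supported P s t \<longleftrightarrow> supported P s' t"
proof (induction t arbitrary: s s')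
  case (N l n r')
  then show ?case
    using P_image[OF N.prems] N.IH(1)[OF seq_image_append[OF N.prems]]
      N.IH(2)[OF seq_image_append[OF N.prems]] by simp
qed simp

lemma val_conj:
  "seq_image r s s' \<Longrightarrow> supported P s t \<Longrightarrow> val Y s t + X r = X r + val Y s' t"
proof (induction t arbitrary: s s')
  case (N l n r')
  have 1: "val Y (s @ [False]) l + X r = X r + val Y (s' @ [False]) l"
    "val Y (s @ [True]) r' + X r = X r + val Y (s' @ [True]) r'"
    using N by (auto intro!: N.IH seq_image_append)
  have "zmul n (Y s) + X r = X r + zmul n (Y s')"
    by (cases "n = 0") (use N.prems in \<open>auto intro!: zmul_conj y_conj\<close>)
  with 1 show ?case by (simp add: add.assoc) (simp flip: add.assoc)
qed simp

lemma P_supported: "P s \<Longrightarrow> supported P s t"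
  by (induction t arbitrary: s) (auto intro: P_append)

lemma comm_branches:
  assumes "P s" "u \<parallel> v"
  shows "comm (val Y (s @ u) t) (Y (s @ v))" "comm (Y (s @ u)) (Y (s @ v))"
  using assms XYG_comm[of "s @ u" "s @ v"] val_in_XYG[OF P_supported[OF P_append[OF assms(1)]]]
    Y_in_XYG[OF P_append[OF assms(1)]]
  by simp_all

lemma rearrange:
  fixes a :: 'g
  assumes "comm b y0" "comm c y0" "comm c y1"
  shows "a + b + c + (y0 + y1 + y2) = (a + y0) + ((b + y1) + (c + y2))"
proof -
  have "a + b + c + (y0 + y1 + y2) = a + b + (c + y0) + y1 + y2" by (simp add: add.assoc)
  also have "\<dots> = a + (b + y0) + (c + y1) + y2" using assms(2) by (simp add: comm_def add.assoc)
  also have "\<dots> = (a + y0) + ((b + y1) + (c + y2))"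
    using assms by (simp add: comm_def add.assoc)
  finally show ?thesis .
qed

text \<open>After \<open>R5\<close> the factor x_s has to move to the left past the tree. It passes
  the subtrees at 00, 01 and 1, but s.x_s and s0.x_s are undefined, which is why the labels there
  must be zero. The new letters then merge into the subtrees because incompatible ones
  commute.\<close>

lemma expand_pos:
  assumes "P s"
  shows "val Y s (N (N a 0 b) 0 r) + Y s =
    X s + ((val Y (s @ [False]) a + Y (s @ [False])) +
      ((val Y (s @ [True, False]) b - Y (s @ [True, False])) +
       (val Y (s @ [True, True]) r + Y (s @ [True, True]))))"
proof -
  note P = P_append[OF assms] P_supported[OF P_append[OF assms]]
  note im = seq_image.intros(2-4)[of s "[]", simplified]
  let ?a = "val Y (s @ [False]) a" and ?b = "val Y (s @ [True, False]) b"
    and ?r = "val Y (s @ [True, True]) r"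
  have "val Y s (N (N a 0 b) 0 r) + X s = val Y (s @ [False, False]) a + (val Y (s @ [False, True]) b + (val Y (s @ [True]) r + X s))"
    by (simp add: add.assoc)
  also have "\<dots> = X s + ?a + ?b + ?r"
    using val_conj[OF im(1) P(2), of a] val_conj[OF im(2) P(2), of b] val_conj[OF im(3) P(2), of r]
    by (simp add: add.assoc) (simp flip: add.assoc)
  finally have *: "val Y s (N (N a 0 b) 0 r) + X s = X s + ?a + ?b + ?r" .
  have "val Y s (N (N a 0 b) 0 r) + Y s = val Y s (N (N a 0 b) 0 r) + X s
      + (Y (s @ [False]) + - Y (s @ [True, False]) + Y (s @ [True, True]))"
    using y_expand[OF assms] by (simp add: add.assoc flip: add_uminus_conv_diff del: val.simps)
  also have "\<dots> = X s + (?a + ?b + ?r + (Y (s @ [False]) + - Y (s @ [True, False]) + Y (s @ [True, True])))"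
    unfolding * by (simp only: add.assoc)
  also have "?a + ?b + ?r + (Y (s @ [False]) + - Y (s @ [True, False]) + Y (s @ [True, True]))
      = (?a + Y (s @ [False])) + ((?b + - Y (s @ [True, False])) + (?r + Y (s @ [True, True])))"
  proof (rule rearrange)
    show "comm ?b (Y (s @ [False]))" "comm ?r (Y (s @ [False]))" "comm ?r (- Y (s @ [True, False]))"
      by (auto intro!: comm_branches assms comm_uminus2 simp: parallel_def)
  qed
  finally show ?thesis by simp
qed

text \<open>The mirror image: the inverse of x_s passes the subtrees at 0, 10 and 11, but not a
  power at s1, which is outside the range of the partial action.\<close>

lemma expand_neg:
  assumes "P s"
  shows "val Y s (N l 0 (N b 0 r)) - Y s =
    - X s + ((val Y (s @ [False, False]) l - Y (s @ [False, False])) +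
      ((val Y (s @ [False, True]) b + Y (s @ [False, True])) +
       (val Y (s @ [True]) r - Y (s @ [True]))))"
proof -
  note P = P_append[OF assms] P_supported[OF P_append[OF assms]]
  note im = seq_image.intros(2-4)[of s "[]", simplified]
  let ?l = "val Y (s @ [False]) l" and ?b = "val Y (s @ [True, False]) b"
    and ?r = "val Y (s @ [True, True]) r"
    and ?y0 = "Y (s @ [False])" and ?y1 = "Y (s @ [True, False])" and ?y2 = "Y (s @ [True, True])"
  let ?l' = "val Y (s @ [False, False]) (add_root (-1) l)"
    and ?b' = "val Y (s @ [False, True]) (add_root 1 b)"
    and ?r' = "val Y (s @ [True]) (add_root (-1) r)"
  have "comm (- ?y2) (?y1 + - ?y0)" "comm ?y1 (- ?y0)"
    by (auto intro!: comm_branches assms comm_uminus2 comm_uminus comm_add2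
        simp: parallel_def simp del: add_uminus_conv_diff)
  then have y: "- ?y2 + (?y1 + - ?y0) = - ?y0 + ?y1 + - ?y2" by (simp add: comm_def)
  have "val Y s (N l 0 (N b 0 r)) - Y s = ?l + ?b + ?r + (- ?y2 + (?y1 + - ?y0)) + - X s"
    by (subst y_expand[OF assms])
       (simp add: add.assoc minus_add diff_conv_add_uminus del: add_uminus_conv_diff)
  also have "\<dots> = ?l + ?b + ?r + (- ?y0 + ?y1 + - ?y2) + - X s" by (simp only: y)
  also have "?l + ?b + ?r + (- ?y0 + ?y1 + - ?y2) = (?l + - ?y0) + ((?b + ?y1) + (?r + - ?y2))"
    by (rule rearrange)
       (auto intro!: comm_branches assms comm_uminus2 simp: parallel_def)
  also have "\<dots> = val Y (s @ [False]) (add_root (-1) l) + (val Y (s @ [True, False]) (add_root 1 b) +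
      val Y (s @ [True, True]) (add_root (-1) r))"
    by (simp add: val_add_root)
  also have "\<dots> = - X s + (?l' + (?b' + ?r')) + X s"
    using val_conj[OF im(1) P(2), of "add_root (-1) l"] val_conj[OF im(2) P(2), of "add_root 1 b"]
      val_conj[OF im(3) P(2), of "add_root (-1) r"]
    by (simp add: add.assoc) (simp flip: add.assoc)
  finally show ?thesis
    by (simp add: val_add_root add.assoc diff_conv_add_uminus del: add_uminus_conv_diff)
qed

text \<open>The root label is removed one unit at a time. Before each expansion the label at s0 (for
  a positive root) or s1 (for a negative one) is cleared by recursion; that subtree has smaller
  weight since the root label is missing from it. Each step leaves an element of F on the left and
  keeps the tree tidy.\<close>

lemma zero_root:
  assumes "supported P s t"
  shows "\<exists>g\<in>XG s. \<exists>l r. val Y s t = g + val Y s (N l 0 r) \<and> supported P s (N l 0 r) \<and>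
    weight (N l 0 r) \<le> weight t \<and> (\<forall>q. tidy q t \<longrightarrow> tidy q (N l 0 r))"
  using assms
proof (induction t arbitrary: s rule: wf_induct_rule[OF wf_measures[of "[weight, root_size]"]])
  case (1 t)
  consider "t = L" | l r where "t = N l 0 r"
    | (pos) l n r where "t = N l n r" "0 < n" | (neg) l n r where "t = N l n r" "n < 0"
    by (cases t) (metis linorder_neqE)+
  then show ?case
  proof cases
    case pos
    have Ps: "P s" using pos 1 by auto
    note P = P_append[OF Ps] P_supported[OF P_append[OF Ps]] P_supported[OF Ps]
    have "weight l < weight t" using pos by auto
    then obtain g a b where g: "g \<in> XG (s @ [False])"
      "val Y (s @ [False]) l = g + val Y (s @ [False]) (N a 0 b)"
      "weight (N a 0 b) \<le> weight l" "\<And>q. tidy q l \<Longrightarrow> tidy q (N a 0 b)"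
      using "1.IH"[of l "s @ [False]"] P by auto
    define t' where "t' = N (add_root 1 a) (n - 1) (N (add_root (-1) b) 0 (add_root 1 r))"
    have "val Y s t = g + (val Y s (N (N a 0 b) 0 r) + Y s) + zmul (n - 1) (Y s)"
      using g(2) pos zmul_Suc[of "n - 1" "Y s"] by (simp add: add.assoc)
    also have "\<dots> = (g + X s) + val Y s t'"
      unfolding expand_pos[OF Ps] by (simp add: t'_def val_add_root add.assoc)
    finally have v: "val Y s t = (g + X s) + val Y s t'" .
    \<comment> \<open>Every branch gains at most one unit and loses the one taken from the
      root.\<close>
    have "weight t' \<le> weight t" "root_size t' < root_size t"
      using weight_add_root[of 1 a] weight_add_root[of "-1" b] weight_add_root[of 1 r] pos g(3)
      by (auto simp: t'_def)
    then have "(t', t) \<in> measures [weight, root_size]" by auto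
    from "1.IH"[OF this P(3)] obtain g' l' r' where g': "g' \<in> XG s"
      "val Y s t' = g' + val Y s (N l' 0 r')" "supported P s (N l' 0 r')"
      "weight (N l' 0 r') \<le> weight t'" "\<And>q. tidy q t' \<Longrightarrow> tidy q (N l' 0 r')" by blast
    have "tidy q (N l' 0 r')" if "tidy q t" for q
    proof -
      have "tidy q (N (N a 0 b) n r)" using that pos g(4)[of "step (sign_state n) False"] by auto
      then have "tidy q t'" unfolding t'_def using pos by (intro tidy_expand_pos)
      then show ?thesis by (rule g'(5))
    qed
    moreover have "g + X s + g' \<in> XG s"
      using g(1) g'(1) XG_append X_in_XG[of s] unfolding XG_def by (meson gen_add subsetD)
    moreover have "val Y s t = (g + X s + g') + val Y s (N l' 0 r')"
      using v g'(2) by (simp only: add.assoc)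
    ultimately show ?thesis
      using g'(3) le_trans[OF g'(4) \<open>weight t' \<le> weight t\<close>] by blast
  next
    case neg
    have Ps: "P s" using neg 1 by auto
    note P = P_append[OF Ps] P_supported[OF P_append[OF Ps]] P_supported[OF Ps]
    have "weight r < weight t" using neg by auto
    then obtain g b c where g: "g \<in> XG (s @ [True])"
      "val Y (s @ [True]) r = g + val Y (s @ [True]) (N b 0 c)"
      "weight (N b 0 c) \<le> weight r" "\<And>q. tidy q r \<Longrightarrow> tidy q (N b 0 c)"
      using "1.IH"[of r "s @ [True]"] P by auto
    define t' where "t' = N (N (add_root (-1) l) 0 (add_root 1 b)) (n + 1) (add_root (-1) c)"
    have "comm (val Y (s @ [False]) l) g"
      using g(1) XG_XYG val_in_XYG[OF P(2)]
      by (intro XYG_comm[of "s @ [False]" "s @ [True]"]) (auto simp: parallel_def)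
    then have "val Y (s @ [False]) l + g = g + val Y (s @ [False]) l" by (simp add: comm_def)
    then have "val Y (s @ [False]) l + (g + h) = g + (val Y (s @ [False]) l + h)" for h
      by (simp flip: add.assoc)
    then have "val Y s t = g + (val Y s (N l 0 (N b 0 c)) - Y s) + zmul (n + 1) (Y s)"
      using g(2) neg zmul_pred[of "n + 1" "Y s"]
      by (simp add: add.assoc diff_conv_add_uminus del: add_uminus_conv_diff)
    also have "\<dots> = (g - X s) + val Y s t'"
      unfolding expand_neg[OF Ps]
      by (simp add: t'_def val_add_root add.assoc) (simp flip: add_uminus_conv_diff add: add.assoc)
    finally have v: "val Y s t = (g - X s) + val Y s t'" .
    have "weight t' \<le> weight t" "root_size t' < root_size t"
      using weight_add_root[of "-1" l] weight_add_root[of 1 b] weight_add_root[of "-1" c] neg g(3)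
      by (auto simp: t'_def)
    then have "(t', t) \<in> measures [weight, root_size]" by auto
    from "1.IH"[OF this P(3)] obtain g' l' r' where g': "g' \<in> XG s"
      "val Y s t' = g' + val Y s (N l' 0 r')" "supported P s (N l' 0 r')"
      "weight (N l' 0 r') \<le> weight t'" "\<And>q. tidy q t' \<Longrightarrow> tidy q (N l' 0 r')" by blast
    have "tidy q (N l' 0 r')" if "tidy q t" for q
    proof -
      have "tidy q (N l n (N b 0 c))" using that neg g(4)[of "step (sign_state n) True"] by auto
      then have "tidy q t'" unfolding t'_def using neg by (intro tidy_expand_neg)
      then show ?thesis by (rule g'(5))
    qed
    moreover have "g - X s + g' \<in> XG s"
      using g(1) g'(1) XG_append X_in_XG[of s] unfolding XG_def by (meson gen_add gen_diff subsetD)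
    moreover have "val Y s t = (g - X s + g') + val Y s (N l' 0 r')"
      using v g'(2) by (simp only: add.assoc)
    ultimately show ?thesis
      using g'(3) le_trans[OF g'(4) \<open>weight t' \<le> weight t\<close>] by blast
  next
    case 1
    then show ?thesis by (auto intro!: bexI[of _ 0] exI[of _ L])
  next
    case 2
    then show ?thesis using "1.prems" by (intro bexI[of _ 0] exI[of _ l] exI[of _ r]) auto
  qed
qed

section \<open>Standard forms absorb the generators\<close>

definition standard :: "bool list \<Rightarrow> 'g \<Rightarrow> bool" where
  "standard s h \<longleftrightarrow> (\<exists>g\<in>XG s. \<exists>t. h = g + val Y s t \<and> supported P s t \<and> tidy Any t)"

lemma standardI: "g \<in> XG s \<Longrightarrow> supported P s t \<Longrightarrow> tidy Any t \<Longrightarrow> standard s (g + val Y s t)"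
  by (auto simp: standard_def)

lemma standard_val: "supported P s t \<Longrightarrow> tidy Any t \<Longrightarrow> standard s (val Y s t)"
  using standardI[of 0 s t] by auto

lemma standard_left: "g \<in> XG s \<Longrightarrow> standard s h \<Longrightarrow> standard s (g + h)"
  unfolding standard_def by (metis XG_closed(2) add.assoc)

lemma standard_branches:
  assumes "standard (s @ [False]) h" "standard (s @ [True]) h'" shows "standard s (h + h')"
proof -
  obtain g t g' t' where *: "g \<in> XG (s @ [False])" "h = g + val Y (s @ [False]) t"
      "supported P (s @ [False]) t" "tidy Any t"
      "g' \<in> XG (s @ [True])" "h' = g' + val Y (s @ [True]) t'"
      "supported P (s @ [True]) t'" "tidy Any t'"
    using assms by (auto simp: standard_def)
  have "comm (val Y (s @ [False]) t) g'"
    using *(3,5) XG_XYG val_in_XYG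
    by (intro XYG_comm[of "s @ [False]" "s @ [True]"]) (auto simp: parallel_def)
  then have c: "val Y (s @ [False]) t + (g' + k) = g' + (val Y (s @ [False]) t + k)" for k
    by (simp add: comm_def flip: add.assoc)
  then have "h + h' = (g + g') + val Y s (N t 0 t')" by (simp add: * add.assoc)
  moreover have "g + g' \<in> XG s" using *(1,5) XG_append by blast
  ultimately show ?thesis using * by (auto intro: standardI simp del: val.simps)
qed

lemma standard_zero_root:
  assumes "standard s h"
  obtains g l r where "g \<in> XG s" "h = g + val Y s (N l 0 r)"
    "supported P s (N l 0 r)" "tidy Any (N l 0 r)"
proof -
  obtain g t where *: "g \<in> XG s" "h = g + val Y s t" "supported P s t" "tidy Any t"
    using assms by (auto simp: standard_def)
  from zero_root[OF *(3)] obtain g' l r where "g' \<in> XG s" "val Y s t = g' + val Y s (N l 0 r)"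
    "supported P s (N l 0 r)" "tidy Any (N l 0 r)" using *(4) by blast
  with * show thesis by (intro that[of "g + g'" l r]) (auto simp: add.assoc)
qed

text \<open>Where a \<open>y\<^sub>s\<close> would meet its inverse it is expanded. It cannot do so through a nonzero label at
  \<open>s0\<close>, since the state \<open>Mix\<close> admits all labels; there one may pass to a zero label at \<open>s0\<close>.\<close>

lemma standard_insert:
  "P s \<Longrightarrow> tidy Any t \<Longrightarrow> standard s (val Y s t + Y s) \<and> standard s (val Y s t - Y s)"
proof (induction t arbitrary: s rule: measure_induct_rule[of size])
  case (less t)
  note P = P_supported[OF less.prems(1)] P_append[OF less.prems(1)]
    P_supported[OF P_append[OF less.prems(1)]]
  show ?case
  proof (cases t)
    case L
    have "standard s (val Y s (add_root 1 L))" "standard s (val Y s (add_root (-1) L))"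
      using standard_val[of s "add_root 1 L"] standard_val[of s "add_root (-1) L"] less.prems(1)
      by (simp_all add: sign_state_def)
    then show ?thesis unfolding L val_add_root by blast
  next
    case (N l n r)
    show ?thesis
    proof (cases "n = 0")
      case False
      have t: "tidy Any l" "tidy Any r" using less.prems(2) False by (auto simp: N intro: tidy_Any)
      have "tidy Any (add_root 1 t)" "tidy Any (add_root (-1) t)"
        using less.prems(2) False t by (auto simp: N sign_state_def split: if_splits)
      then have "standard s (val Y s (add_root 1 t))" "standard s (val Y s (add_root (-1) t))"
        using P standard_val by blast+
      then show ?thesis unfolding val_add_root by blast
    next
      case True
      then have t: "tidy Any l" "tidy Any r" using less.prems(2) by (auto simp: N)
      have r: "standard (s @ u) (val Y (s @ u) r + Y (s @ u))"
        "standard (s @ u) (val Y (s @ u) l - Y (s @ u))" for u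
        using less.IH[of r] less.IH[of l] P t N by auto
      have "\<exists>g a b. g \<in> XG (s @ [False]) \<and> val Y (s @ [False]) l = g + val Y (s @ [False]) (N a 0 b)
        \<and> standard (s @ [False]) (val Y (s @ [False]) a + Y (s @ [False]))
        \<and> standard (s @ [True, False]) (val Y (s @ [True, False]) b - Y (s @ [True, False]))"
      proof (cases "root_size l = 0")
        case True
        \<comment> \<open>An empty tree counts as a zero label above two empty trees. In either case
          \<open>a\<close> and \<open>b\<close> are smaller than \<open>t\<close>, so the induction
          applies to them.\<close>
        obtain a b where ab: "val Y (s @ [False]) l = val Y (s @ [False]) (N a 0 b)"
          "tidy Any a" "tidy Any b" "size a < size t" "size b < size t"
        proof (cases l)
          case L
          then show thesis using that[of L L] by (simp add: N)
        next
          case (N a m b)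
          then show thesis using that[of a b] True t \<open>t = _\<close> by simp
        qed
        then show ?thesis
          using less.IH[of a "s @ [False]"] less.IH[of b "s @ [True, False]"] P
          by (intro exI[of _ 0] exI[of _ a] exI[of _ b]) auto
      next
        case False
        then have mix: "tidy Mix l" using t by (cases l) auto
        obtain g a b where g: "g \<in> XG (s @ [False])"
          "val Y (s @ [False]) l = g + val Y (s @ [False]) (N a 0 b)"
          "\<And>q. tidy q l \<Longrightarrow> tidy q (N a 0 b)"
          using zero_root[OF P(3)[of "[False]" l]] by blast
        have "tidy Pos a" "tidy Neg b" using g(3)[OF mix] by simp_all
        then have "standard (s @ u) (val Y (s @ u) (add_root 1 a))"
          "standard (s @ u) (val Y (s @ u) (add_root (-1) b))" for u
          by (auto intro!: standard_val tidy_add_root_1 tidy_add_root_m1 simp: P)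
        with g show ?thesis unfolding val_add_root by blast
      qed
      then obtain g a b where g: "g \<in> XG (s @ [False])"
        "val Y (s @ [False]) l = g + val Y (s @ [False]) (N a 0 b)"
        "standard (s @ [False]) (val Y (s @ [False]) a + Y (s @ [False]))"
        "standard (s @ [True, False]) (val Y (s @ [True, False]) b - Y (s @ [True, False]))"
        by blast
      have "val Y s t + Y s = g + (val Y s (N (N a 0 b) 0 r) + Y s)"
        using g(2) by (simp add: N True add.assoc)
      then have e: "val Y s t + Y s = (g + X s) + ((val Y (s @ [False]) a + Y (s @ [False])) +
        ((val Y (s @ [True, False]) b - Y (s @ [True, False])) +
         (val Y (s @ [True, True]) r + Y (s @ [True, True]))))"
        unfolding expand_pos[OF less.prems(1)] by (simp only: add.assoc)
      have b: "standard (s @ [True]) ((val Y (s @ [True, False]) b - Y (s @ [True, False])) +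
         (val Y (s @ [True, True]) r + Y (s @ [True, True])))"
        by (rule standard_branches) (use g(4) r(1)[of "[True, True]"] in simp_all)
      have x: "g + X s \<in> XG s" by (intro XG_closed XG_appendD[OF g(1)] X_in_XG)
      have pos: "standard s (val Y s t + Y s)"
        unfolding e by (rule standard_left[OF x standard_branches[OF g(3) b]])
      have "\<exists>g b c. g \<in> XG (s @ [True]) \<and> val Y (s @ [True]) r = g + val Y (s @ [True]) (N b 0 c)
        \<and> standard (s @ [False, True]) (val Y (s @ [False, True]) b + Y (s @ [False, True]))
        \<and> standard (s @ [True]) (val Y (s @ [True]) c - Y (s @ [True]))"
      proof (cases "root_size r = 0")
        case True
        obtain b c where bc: "val Y (s @ [True]) r = val Y (s @ [True]) (N b 0 c)"
          "tidy Any b" "tidy Any c" "size b < size t" "size c < size t"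
        proof (cases r)
          case L
          then show thesis using that[of L L] by (simp add: N)
        next
          case (N b m c)
          then show thesis using that[of b c] True t \<open>t = _\<close> by simp
        qed
        then show ?thesis
          using less.IH[of c "s @ [True]"] less.IH[of b "s @ [False, True]"] P
          by (intro exI[of _ 0] exI[of _ b] exI[of _ c]) auto
      next
        case False
        then have mix: "tidy Mix r" using t by (cases r) auto
        obtain g b c where g: "g \<in> XG (s @ [True])"
          "val Y (s @ [True]) r = g + val Y (s @ [True]) (N b 0 c)"
          "\<And>q. tidy q r \<Longrightarrow> tidy q (N b 0 c)"
          using zero_root[OF P(3)[of "[True]" r]] by blast
        have "tidy Pos b" "tidy Neg c" using g(3)[OF mix] by simp_all
        then have "standard (s @ u) (val Y (s @ u) (add_root 1 b))"
          "standard (s @ u) (val Y (s @ u) (add_root (-1) c))" for u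
          by (auto intro!: standard_val tidy_add_root_1 tidy_add_root_m1 simp: P)
        with g show ?thesis unfolding val_add_root by blast
      qed
      then obtain g b c where g: "g \<in> XG (s @ [True])"
        "val Y (s @ [True]) r = g + val Y (s @ [True]) (N b 0 c)"
        "standard (s @ [False, True]) (val Y (s @ [False, True]) b + Y (s @ [False, True]))"
        "standard (s @ [True]) (val Y (s @ [True]) c - Y (s @ [True]))"
        by blast
      have "comm (val Y (s @ [False]) l) g"
        using g(1) XG_XYG val_in_XYG[OF P(3)]
        by (intro XYG_comm[of "s @ [False]" "s @ [True]"]) (auto simp: parallel_def)
      then have "val Y (s @ [False]) l + (g + h) = g + (val Y (s @ [False]) l + h)" for h
        by (simp add: comm_def flip: add.assoc)
      then have "val Y s t - Y s = g + (val Y s (N l 0 (N b 0 c)) - Y s)"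
        using g(2) by (simp add: N True add.assoc diff_conv_add_uminus del: add_uminus_conv_diff)
      then have e: "val Y s t - Y s = (g + - X s) + (((val Y (s @ [False, False]) l - Y (s @ [False, False])) +
        (val Y (s @ [False, True]) b + Y (s @ [False, True]))) +
         (val Y (s @ [True]) c - Y (s @ [True])))"
        unfolding expand_neg[OF less.prems(1)] by (simp only: add.assoc)
      have b: "standard (s @ [False]) ((val Y (s @ [False, False]) l - Y (s @ [False, False])) +
        (val Y (s @ [False, True]) b + Y (s @ [False, True])))"
        by (rule standard_branches) (use g(3) r(2)[of "[False, False]"] in simp_all)
      have x: "g + - X s \<in> XG s" by (intro XG_closed XG_appendD[OF g(1)] X_in_XG)
      have "standard s (val Y s t - Y s)"
        unfolding e by (rule standard_left[OF x standard_branches[OF b g(4)]])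
      with pos show ?thesis by blast
    qed
  qed
qed

lemma standard_add_Y:
  assumes "standard s h" "P s" shows "standard s (h + Y s)" "standard s (h - Y s)"
proof -
  obtain g t where "g \<in> XG s" "h = g + val Y s t" "tidy Any t"
    using assms(1) by (auto simp: standard_def)
  then show "standard s (h + Y s)" "standard s (h - Y s)"
    using standard_left[of g s "val Y s t + Y s"] standard_left[of g s "val Y s t - Y s"]
      standard_insert[OF assms(2), of t] by (simp_all add: add.assoc add_diff_eq)
qed

text \<open>The labels at s and s0 are cleared for x_s, those at s and s1 for its inverse; then the
  partial action regroups the three remaining subtrees. Zero labels keep the state
  \<open>Any\<close>, so the regrouped tree is again tidy.\<close>

lemma standard_add_X:
  assumes "standard s h" shows "standard s (h + X s)" "standard s (h - X s)"
proof -
  note im = seq_image.intros(2-4)[of s "[]", simplified]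
  obtain g l r where g: "g \<in> XG s" "h = g + val Y s (N l 0 r)"
    "supported P s (N l 0 r)" "tidy Any (N l 0 r)"
    using standard_zero_root[OF assms] .
  obtain g1 a b where a: "g1 \<in> XG (s @ [False])"
    "val Y (s @ [False]) l = g1 + val Y (s @ [False]) (N a 0 b)"
    "supported P (s @ [False]) (N a 0 b)" "tidy Any (N a 0 b)"
    using g standard_zero_root[OF standard_val, of "s @ [False]" l] by auto
  obtain g2 c d where c: "g2 \<in> XG (s @ [True])"
    "val Y (s @ [True]) r = g2 + val Y (s @ [True]) (N c 0 d)"
    "supported P (s @ [True]) (N c 0 d)" "tidy Any (N c 0 d)"
    using g standard_zero_root[OF standard_val, of "s @ [True]" r] by auto
  have "val Y s (N (N a 0 b) 0 r) + X s = X s + val Y s (N a 0 (N b 0 r))"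
    using val_conj[OF im(1), of a] val_conj[OF im(2), of b] val_conj[OF im(3), of r] a(3) g(3)
    by (simp add: add.assoc) (simp flip: add.assoc)
  then have e1: "h + X s = (g + g1 + X s) + val Y s (N a 0 (N b 0 r))"
    using g(2) a(2) by (simp add: add.assoc)
  have "supported P s (N a 0 (N b 0 r))"
    using a(3) g(3) supported_image[OF im(1)] supported_image[OF im(2)] supported_image[OF im(3)]
    by simp
  moreover have "tidy Any (N a 0 (N b 0 r))" using a(4) g(4) by simp
  moreover have "g + g1 + X s \<in> XG s" by (intro XG_closed XG_appendD[OF a(1)] g(1) X_in_XG)
  ultimately show "standard s (h + X s)" unfolding e1 by (intro standardI)
  have "val Y s (N (N l 0 c) 0 d) + X s = X s + val Y s (N l 0 (N c 0 d))"
    using val_conj[OF im(1), of l] val_conj[OF im(2), of c] val_conj[OF im(3), of d] c(3) g(3)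
      supported_image[OF im(1)] supported_image[OF im(2)] supported_image[OF im(3)]
    by (simp add: add.assoc) (simp flip: add.assoc)
  then have x: "val Y s (N l 0 (N c 0 d)) - X s = - X s + val Y s (N (N l 0 c) 0 d)"
    by (rule conj_swap)
  have "comm (val Y (s @ [False]) l) g2"
    using c(1) g(3) XG_XYG val_in_XYG
    by (intro XYG_comm[of "s @ [False]" "s @ [True]"]) (auto simp: parallel_def)
  then have "val Y (s @ [False]) l + (g2 + k) = g2 + (val Y (s @ [False]) l + k)" for k
    by (simp add: comm_def flip: add.assoc)
  then have "h - X s = (g + g2) + (val Y s (N l 0 (N c 0 d)) - X s)"
    using g(2) c(2) by (simp add: add.assoc diff_conv_add_uminus del: add_uminus_conv_diff)
  then have e2: "h - X s = (g + g2 + - X s) + val Y s (N (N l 0 c) 0 d)"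
    unfolding x by (simp only: add.assoc)
  have "supported P s (N (N l 0 c) 0 d)"
    using c(3) g(3) supported_image[OF im(1)] supported_image[OF im(2)] supported_image[OF im(3)]
    by simp
  moreover have "tidy Any (N (N l 0 c) 0 d)" using c(4) g(4) by simp
  moreover have "g + g2 + - X s \<in> XG s" by (intro XG_closed XG_appendD[OF c(1)] g(1) X_in_XG)
  ultimately show "standard s (h - X s)" unfolding e2 by (intro standardI)
qed

text \<open>Once the root label is cleared, \<open>k\<close> affects only the subtree to which it
  belongs, since it commutes with the other one. Descending along \<open>t\<close> reduces a
  generator to a factor at the root.\<close>

lemma standard_below:
  assumes "standard s h" "k \<in> XYG (s @ t)"
    "\<And>h. standard (s @ t) h \<Longrightarrow> standard (s @ t) (h + k)"
  shows "standard s (h + k)"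
  using assms
proof (induction t arbitrary: s h)
  case (Cons b t)
  obtain g l r where g: "g \<in> XG s" "h = g + val Y s (N l 0 r)"
    "supported P s (N l 0 r)" "tidy Any (N l 0 r)"
    using standard_zero_root[OF Cons.prems(1)] .
  then have lr: "standard (s @ [False]) (val Y (s @ [False]) l)"
    "standard (s @ [True]) (val Y (s @ [True]) r)"
    by (auto intro: standard_val)
  show ?case
  proof (cases b)
    case True
    have "standard (s @ [True]) (val Y (s @ [True]) r + k)"
      using Cons.IH[of "s @ [True]"] Cons.prems lr True by simp
    then have "standard s (g + (val Y (s @ [False]) l + (val Y (s @ [True]) r + k)))"
      using lr g(1) standard_left standard_branches by blast
    then show ?thesis by (simp add: g(2) add.assoc)
  next
    case False
    have "standard (s @ [False]) (val Y (s @ [False]) l + k)"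
      using Cons.IH[of "s @ [False]"] Cons.prems lr False by simp
    then have 1: "standard s (g + ((val Y (s @ [False]) l + k) + val Y (s @ [True]) r))"
      using lr g(1) standard_left standard_branches by blast
    have "k \<in> XYG (s @ [False])" using Cons.prems(2) XYG_append[of "s @ [False]" t] False by auto
    then have "comm k (val Y (s @ [True]) r)"
      using g(3) val_in_XYG by (intro XYG_comm[of "s @ [False]" "s @ [True]"]) (auto simp: parallel_def)
    then show ?thesis using 1 by (simp add: g(2) comm_def add.assoc)
  qed
qed simp

lemma standard_XYG:
  assumes "h \<in> XYG []" shows "standard [] h"
proof -
  have gens: "standard [] (f + X s)" "standard [] (f - X s)" "P s \<Longrightarrow> standard [] (f + Y s)"
    "P s \<Longrightarrow> standard [] (f - Y s)" if "standard [] f" for f s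
  proof -
    have "X s \<in> XYG s" by (rule subsetD[OF XG_XYG X_in_XG])
    then show "standard [] (f + X s)" "standard [] (f - X s)"
      using standard_below[of "[]" f "X s" s] standard_below[of "[]" f "- X s" s] that standard_add_X
      by auto
    assume "P s"
    then show "standard [] (f + Y s)" "standard [] (f - Y s)"
      using standard_below[of "[]" f "Y s" s] standard_below[of "[]" f "- Y s" s] that standard_add_Y
        Y_in_XYG XYG_closed(3)[OF Y_in_XYG] by auto
  qed
  have "standard [] f \<Longrightarrow> standard [] (f + h) \<and> standard [] (f - h)" for f
    using assms unfolding XYG_def
  proof (induction h arbitrary: f rule: gen.induct)
    case (gen_incl b)
    then show ?case using gens by auto
  next
    case (gen_add g h)
    then have "standard [] (f + g + h)" "standard [] (f - h - g)" by blast+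
    then show ?case by (simp add: add.assoc diff_diff_eq2 minus_add diff_conv_add_uminus del: add_uminus_conv_diff)
  qed auto
  from this[of 0] standard_val[of "[]" L] show ?thesis by simp
qed

end

section \<open>Words without potential cancellations act nontrivially\<close>

text \<open>\<open>rep \<xi> p q\<close> means that the eventually constant sequence \<open>\<xi>\<close> codes the point \<open>p / q\<close> of the
  projective line, where \<open>0\<eta>\<close> and \<open>1\<eta>\<close> code \<open>x / (1 + x)\<close> and \<open>1 + x\<close> if \<open>\<eta>\<close> codes \<open>x\<close>.\<close>

inductive rep :: "bool word \<Rightarrow> int \<Rightarrow> int \<Rightarrow> bool" where
  rep_0: "0 < c \<Longrightarrow> rep (\<lambda>_. False) 0 c"
| rep_1: "0 < c \<Longrightarrow> rep (\<lambda>_. True) c 0"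
| rep_False: "rep \<xi> p q \<Longrightarrow> rep ([False] \<frown> \<xi>) p (p + q)"
| rep_True: "rep \<xi> p q \<Longrightarrow> rep ([True] \<frown> \<xi>) (p + q) q"

lemma const_word: "[b] \<frown> (\<lambda>_. b) = (\<lambda>_. b)"
  by (auto simp: fun_eq_iff conc_def)

lemma conc_const_iff: "[b] \<frown> \<xi> = (\<lambda>_. c) \<longleftrightarrow> b = c \<and> \<xi> = (\<lambda>_. c)"
proof
  assume eq: "[b] \<frown> \<xi> = (\<lambda>_. c)"
  then have "([b] \<frown> \<xi>) 0 = c" by simp
  then have "b = c" by simp
  then have "[b] \<frown> \<xi> = [b] \<frown> (\<lambda>_. c)" using eq const_word[of c] by simp
  then show "b = c \<and> \<xi> = (\<lambda>_. c)" using \<open>b = c\<close> by simp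
qed (auto simp: const_word)

lemma Cons_conc_eq_iff: "[b] \<frown> \<xi> = [c] \<frown> \<zeta> \<longleftrightarrow> b = c \<and> \<xi> = \<zeta>"
  by (simp add: concat_eq)

lemma rep_const: "rep \<xi> p q \<Longrightarrow> (\<xi> = (\<lambda>_. False) \<longrightarrow> p = 0) \<and> (\<xi> = (\<lambda>_. True) \<longrightarrow> q = 0)"
  by (induction rule: rep.induct) (auto simp: conc_const_iff fun_eq_iff[of "\<lambda>_. _" "\<lambda>_. _"])

text \<open>Homogeneous coordinates are determined up to a factor, hence the cross products. A
  constant sequence also arises by adding a digit to itself; \<open>rep_const\<close> handles this
  overlap of the rules.\<close>

lemma rep_unique: "rep \<xi> p q \<Longrightarrow> rep \<xi> p' q' \<Longrightarrow> p * q' = p' * q"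
proof (induction arbitrary: p' q' rule: rep.induct)
  case (rep_0 c)
  then show ?case using rep_const by auto
next
  case (rep_1 c)
  then show ?case using rep_const by auto
next
  case (rep_False \<xi> p q)
  from rep_False.prems show ?case
  proof (cases rule: rep.cases)
    case rep_0
    then have "\<xi> = (\<lambda>_. False)" by (simp add: conc_const_iff)
    then have "p = 0" using rep_False.hyps rep_const by auto
    with rep_0 show ?thesis by simp
  next
    case rep_1
    then show ?thesis by (simp add: conc_const_iff)
  next
    case (rep_False \<zeta> r)
    then show ?thesis using rep_False.IH[of p' r] by (simp add: Cons_conc_eq_iff algebra_simps)
  qed (simp add: Cons_conc_eq_iff)
next
  case (rep_True \<xi> p q)
  from rep_True.prems show ?case
  proof (cases rule: rep.cases)
    case rep_1
    then have "\<xi> = (\<lambda>_. True)" by (simp add: conc_const_iff)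
    then have "q = 0" using rep_True.hyps rep_const by auto
    with rep_1 show ?thesis by simp
  next
    case rep_0
    then show ?thesis by (simp add: conc_const_iff)
  next
    case (rep_True \<zeta> r)
    then show ?thesis using rep_True.IH[of r q'] by (simp add: Cons_conc_eq_iff algebra_simps)
  qed (simp add: Cons_conc_eq_iff)
qed

section \<open>The map y in homogeneous coordinates\<close>

lemma const_wordI:
  assumes "\<xi> = replicate (Suc k) b \<frown> \<xi>" shows "\<xi> = (\<lambda>_. b)"
proof
  show "\<xi> n = b" for n
  proof (induction n rule: less_induct)
    case (less n)
    have "\<xi> n = (replicate (Suc k) b \<frown> \<xi>) n" using assms by simp
    also have "\<dots> = b" using less[of "n - Suc k"] by (cases "n < Suc k") (auto simp del: replicate_Suc)
    finally show ?case .
  qed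
qed

lemma cantor_y_const: "cantor_y (\<lambda>_. b) = (\<lambda>_. b)"
  and cantor_y_inv_const: "cantor_y_inv (\<lambda>_. b) = (\<lambda>_. b)"
proof -
  have c: "[b] \<frown> (\<lambda>_. b) = (\<lambda>_. b)" "[b, b] \<frown> (\<lambda>_. b) = (\<lambda>_. b)" for b
    using const_word[of b] conc_conc[of "[b]" "[b]" "\<lambda>_. b"] by simp_all
  have "cantor_y (\<lambda>_. False) = replicate (Suc 0) False \<frown> cantor_y (\<lambda>_. False)"
    using cantor_y_simps(1)[of "\<lambda>_. False"] unfolding c replicate.simps .
  then have 1: "cantor_y (\<lambda>_. False) = (\<lambda>_. False)" by (rule const_wordI)
  have "cantor_y (\<lambda>_. True) = replicate (Suc (Suc 0)) True \<frown> cantor_y (\<lambda>_. True)"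
    using cantor_y_simps(3)[of "\<lambda>_. True"] unfolding c replicate.simps .
  then have 2: "cantor_y (\<lambda>_. True) = (\<lambda>_. True)" by (rule const_wordI)
  have "cantor_y_inv (\<lambda>_. False) = replicate (Suc (Suc 0)) False \<frown> cantor_y_inv (\<lambda>_. False)"
    using cantor_y_inv_simps(1)[of "\<lambda>_. False"] unfolding c replicate.simps .
  then have 3: "cantor_y_inv (\<lambda>_. False) = (\<lambda>_. False)" by (rule const_wordI)
  have "cantor_y_inv (\<lambda>_. True) = replicate (Suc 0) True \<frown> cantor_y_inv (\<lambda>_. True)"
    using cantor_y_inv_simps(3)[of "\<lambda>_. True"] unfolding c replicate.simps .
  then have 4: "cantor_y_inv (\<lambda>_. True) = (\<lambda>_. True)" by (rule const_wordI)
  show "cantor_y (\<lambda>_. b) = (\<lambda>_. b)" "cantor_y_inv (\<lambda>_. b) = (\<lambda>_. b)"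
    by (cases b; simp add: 1 2 3 4)+
qed

definition doubles :: "bool word \<Rightarrow> int \<Rightarrow> int \<Rightarrow> bool" where
  "doubles \<xi> p q \<longleftrightarrow> rep (cantor_y \<xi>) (2 * p) q \<and> rep (cantor_y_inv \<xi>) p (2 * q)"

lemma rep_False_False: "rep \<xi> p q \<Longrightarrow> rep ([False, False] \<frown> \<xi>) p (2 * p + q)"
  using rep_False[OF rep_False[of \<xi> p q]] by (simp add: algebra_simps)

lemma rep_True_True: "rep \<xi> p q \<Longrightarrow> rep ([True, True] \<frown> \<xi>) (p + 2 * q) q"
  using rep_True[OF rep_True[of \<xi> p q]] by (simp add: algebra_simps)

lemma rep_False_True: "rep \<xi> p q \<Longrightarrow> rep ([False, True] \<frown> \<xi>) (p + q) (p + 2 * q)"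
  using rep_False[OF rep_True[of \<xi> p q]] by (simp add: algebra_simps)

lemma rep_True_False: "rep \<xi> p q \<Longrightarrow> rep ([True, False] \<frown> \<xi>) (2 * p + q) (p + q)"
  using rep_True[OF rep_False[of \<xi> p q]] by (simp add: algebra_simps)

text \<open>Implications written as disjunctions, leading from \<open>\<xi>\<close> and a sequence
  with one more digit to one with two more. In each case one of y and its inverse reads both digits
  and continues with \<open>\<xi>\<close>, while the other reads one digit and continues with the
  sequence longer by one.\<close>

lemma doubles_digits:
  "doubles \<xi> p q \<Longrightarrow> doubles ([False, False] \<frown> \<xi>) p (2 * p + q) \<or> \<not> doubles ([False] \<frown> \<xi>) p (p + q)"
  "doubles \<xi> p q \<Longrightarrow> doubles ([True, True] \<frown> \<xi>) (p + 2 * q) q \<or> \<not> doubles ([True] \<frown> \<xi>) (p + q) q"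
  "doubles \<xi> p q \<Longrightarrow> doubles ([False, True] \<frown> \<xi>) (p + q) (p + 2 * q) \<or> \<not> doubles ([True] \<frown> \<xi>) (p + q) q"
  "doubles \<xi> p q \<Longrightarrow> doubles ([True, False] \<frown> \<xi>) (2 * p + q) (p + q) \<or> \<not> doubles ([False] \<frown> \<xi>) p (p + q)"
proof -
  assume d: "doubles \<xi> p q"
  note y = d[unfolded doubles_def, THEN conjunct1] and z = d[unfolded doubles_def, THEN conjunct2]
  have F: "cantor_y_inv ([False, b] \<frown> \<xi>) = [False, False] \<frown> cantor_y_inv ([b] \<frown> \<xi>)" for b
    using cantor_y_inv_simps(1)[of "[b] \<frown> \<xi>"] by simp
  have T: "cantor_y ([True, b] \<frown> \<xi>) = [True, True] \<frown> cantor_y ([b] \<frown> \<xi>)" for b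
    using cantor_y_simps(3)[of "[b] \<frown> \<xi>"] by simp
  show "doubles ([False, False] \<frown> \<xi>) p (2 * p + q) \<or> \<not> doubles ([False] \<frown> \<xi>) p (p + q)"
    using rep_False[OF y] rep_False_False[of "cantor_y_inv ([False] \<frown> \<xi>)" p "2 * (p + q)"]
    unfolding doubles_def F by (auto simp: algebra_simps)
  show "doubles ([True, True] \<frown> \<xi>) (p + 2 * q) q \<or> \<not> doubles ([True] \<frown> \<xi>) (p + q) q"
    using rep_True[OF z] rep_True_True[of "cantor_y ([True] \<frown> \<xi>)" "2 * (p + q)" q]
    unfolding doubles_def T by (auto simp: algebra_simps)
  show "doubles ([False, True] \<frown> \<xi>) (p + q) (p + 2 * q) \<or> \<not> doubles ([True] \<frown> \<xi>) (p + q) q"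
    using rep_True_False[OF z] rep_False_False[of "cantor_y_inv ([True] \<frown> \<xi>)" "p + q" "2 * q"]
    unfolding doubles_def F by (auto simp: algebra_simps)
  show "doubles ([True, False] \<frown> \<xi>) (2 * p + q) (p + q) \<or> \<not> doubles ([False] \<frown> \<xi>) p (p + q)"
    using rep_False_True[OF y] rep_True_True[of "cantor_y ([False] \<frown> \<xi>)" "2 * p" "p + q"]
    unfolding doubles_def T by (auto simp: algebra_simps)
qed

text \<open>Since \<open>y\<close> reads two digits at a time, the induction carries the sequences with one more digit.\<close>

lemma rep_doubles:
  "rep \<xi> p q \<Longrightarrow> doubles \<xi> p q \<and> doubles ([False] \<frown> \<xi>) p (p + q) \<and> doubles ([True] \<frown> \<xi>) (p + q) q"
proof (induction rule: rep.induct)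
  case (rep_0 c)
  have 1: "doubles (\<lambda>_. False) 0 c"
    using rep_0 by (simp add: doubles_def cantor_y_const cantor_y_inv_const rep.rep_0)
  have "[True] \<frown> (\<lambda>_. False) = [True, False] \<frown> (\<lambda>_. False)"
    using const_word[of False] conc_conc[of "[True]" "[False]" "\<lambda>_. False"] by simp
  then have "cantor_y_inv ([True] \<frown> (\<lambda>_. False)) = [False, True] \<frown> (\<lambda>_. False)"
    using cantor_y_inv_simps(2)[of "\<lambda>_. False"] by (simp add: cantor_y_const)
  then have "doubles ([True] \<frown> (\<lambda>_. False)) c c"
    using rep_False_True[OF rep.rep_0[OF rep_0]] rep_True_True[OF rep.rep_0[OF rep_0]]
    by (simp add: doubles_def cantor_y_const)
  with 1 show ?case by (simp add: const_word)
next
  case (rep_1 c)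
  have 1: "doubles (\<lambda>_. True) c 0"
    using rep_1 by (simp add: doubles_def cantor_y_const cantor_y_inv_const rep.rep_1)
  have "[False] \<frown> (\<lambda>_. True) = [False, True] \<frown> (\<lambda>_. True)"
    using const_word[of True] conc_conc[of "[False]" "[True]" "\<lambda>_. True"] by simp
  then have "cantor_y ([False] \<frown> (\<lambda>_. True)) = [True, False] \<frown> (\<lambda>_. True)"
    using cantor_y_simps(2)[of "\<lambda>_. True"] by (simp add: cantor_y_inv_const)
  then have "doubles ([False] \<frown> (\<lambda>_. True)) c c"
    using rep_True_False[OF rep.rep_1[OF rep_1]] rep_False_False[OF rep.rep_1[OF rep_1]]
    by (simp add: doubles_def cantor_y_inv_const)
  with 1 show ?case by (simp add: const_word)
next
  case (rep_False \<xi> p q)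
  then show ?case using doubles_digits(1,4)[of \<xi> p q] by (simp add: algebra_simps)
next
  case (rep_True \<xi> p q)
  then show ?case using doubles_digits(2,3)[of \<xi> p q] by (simp add: algebra_simps)
qed

lemma rep_cantor_y: "rep \<xi> p q \<Longrightarrow> rep (cantor_y \<xi>) (2 * p) q"
  and rep_cantor_y_inv: "rep \<xi> p q \<Longrightarrow> rep (cantor_y_inv \<xi>) p (2 * q)"
  using rep_doubles by (auto simp: doubles_def)

lemma app_py_conc: "app (py s) (s \<frown> \<xi>) = s \<frown> cantor_y \<xi>"
  and app_uminus_py_conc: "app (- py s) (s \<frown> \<xi>) = s \<frown> cantor_y_inv \<xi>"
proof -
  show *: "app (py s) (s \<frown> \<xi>) = s \<frown> cantor_y \<xi>" for \<xi>
    by (simp add: app_py y_at_def)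
  show "app (- py s) (s \<frown> \<xi>) = s \<frown> cantor_y_inv \<xi>"
    using app_uminus_app(1)[of "py s" "s \<frown> cantor_y_inv \<xi>"] by (simp add: *)
qed

text \<open>One of \<open>nat n\<close> and \<open>nat (- n)\<close> is zero, so powers of either
  sign act as integral diagonal matrices, with determinant 2^|n|.\<close>

lemma rep_zmul_py:
  assumes "rep \<xi> p q"
  shows "\<exists>\<zeta>. app (zmul n (py s)) (s \<frown> \<xi>) = s \<frown> \<zeta> \<and> rep \<zeta> (2 ^ nat n * p) (2 ^ nat (- n) * q)"
proof (induction n rule: int_induct[of _ 0])
  case base
  show ?case using assms by auto
next
  case (step1 n)
  then obtain \<zeta> where "app (zmul n (py s)) (s \<frown> \<xi>) = s \<frown> \<zeta>"
    "rep \<zeta> (2 ^ nat n * p) (2 ^ nat (- n) * q)" by blast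
  moreover have "nat (n + 1) = Suc (nat n)" "nat (- n) = 0" "nat (- (n + 1)) = 0"
    using step1 by simp_all
  ultimately show ?case
    using rep_cantor_y[of \<zeta> "2 ^ nat n * p"]
    by (intro exI[of _ "cantor_y \<zeta>"]) (simp add: zmul_Suc2 app_py_conc mult.assoc)
next
  case (step2 n)
  then obtain \<zeta> where "app (zmul n (py s)) (s \<frown> \<xi>) = s \<frown> \<zeta>"
    "rep \<zeta> (2 ^ nat n * p) (2 ^ nat (- n) * q)" by blast
  moreover have "zmul (n - 1) (py s) = zmul n (py s) + - py s" by (simp add: zmul_pred2)
  moreover have "nat (- (n - 1)) = Suc (nat (- n))" "nat n = 0" "nat (n - 1) = 0"
    using step2 by simp_all
  ultimately show ?case
    using rep_cantor_y_inv[of \<zeta> _ "2 ^ nat (- n) * q"]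
    by (intro exI[of _ "cantor_y_inv \<zeta>"])
       (simp add: app_uminus_py_conc mult.assoc del: add_uminus_conv_diff)
qed

text \<open>The exponent of 2 in the determinant of the matrix along the branch
  \<open>u\<close>.\<close>

fun branch_weight :: "ltree \<Rightarrow> bool list \<Rightarrow> nat" where
  "branch_weight (N l n r) (b # u) = nat \<bar>n\<bar> + branch_weight (if b then r else l) u"
| "branch_weight _ _ = 0"

fun zero_tree :: "ltree \<Rightarrow> bool" where
  "zero_tree L = True"
| "zero_tree (N l n r) \<longleftrightarrow> n = 0 \<and> zero_tree l \<and> zero_tree r"

lemma val_zero_tree: "zero_tree t \<Longrightarrow> val Y s t = 0"
  by (induction t arbitrary: s) auto

text \<open>The branch can be prolonged at will, so that it leaves the tree and is carried to a
  single cone by a given element of F.\<close>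

lemma branch_weight_pos: "\<not> zero_tree t \<Longrightarrow> \<exists>u. k \<le> length u \<and> 0 < branch_weight t u"
proof (induction t)
  case (N l n r)
  then consider "n \<noteq> 0" | "\<not> zero_tree l" | "\<not> zero_tree r" by auto
  then show ?case
  proof cases
    case 1
    then show ?thesis by (intro exI[of _ "True # replicate k True"]) auto
  next
    case 2
    then obtain u where "k \<le> length u" "0 < branch_weight l u" using N by blast
    then show ?thesis by (intro exI[of _ "False # u"]) auto
  next
    case 3
    then obtain u where "k \<le> length u" "0 < branch_weight r u" using N by blast
    then show ?thesis by (intro exI[of _ "True # u"]) auto
  qed
qed simp

text \<open>The row vector of the state times the matrix (a b; c d) is nonzero modulo 2; for
  \<open>Any\<close>, the matrix itself is.\<close>

fun odd_row :: "state \<Rightarrow> int \<Rightarrow> int \<Rightarrow> int \<Rightarrow> int \<Rightarrow> bool" where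
  "odd_row Any a b c d \<longleftrightarrow> odd a \<or> odd b \<or> odd c \<or> odd d"
| "odd_row Pos a b c d \<longleftrightarrow> odd c \<or> odd d"
| "odd_row Neg a b c d \<longleftrightarrow> odd a \<or> odd b"
| "odd_row Mix a b c d \<longleftrightarrow> odd (a + c) \<or> odd (b + d)"

lemma odd_row_det_1: "a * d - b * c = 1 \<Longrightarrow> odd_row q a b c d"
proof -
  assume "a * d - b * c = 1"
  then have "odd (a * d - b * c)" by simp
  then show ?thesis by (cases q) auto
qed

lemma odd_row_step_False: "odd_row (step q False) a b c d \<Longrightarrow> odd_row q a b (a + c) (b + d)"
  by (cases q) auto

lemma odd_row_step_True: "odd_row (step q True) a b c d \<Longrightarrow> odd_row q (a + c) (b + d) c d"
  by (cases q) auto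

lemma odd_row_scale:
  assumes "n \<noteq> 0" "admits q n" "odd_row (sign_state n) a b c d"
  shows "odd_row q (2 ^ nat n * a) (2 ^ nat n * b) (2 ^ nat (- n) * c) (2 ^ nat (- n) * d)"
  using assms by (cases q; cases "0 < n") (auto simp: sign_state_def)

lemma word_matrix:
  "\<exists>a b c d :: int. a * d - b * c = 1 \<and> (\<forall>\<xi> p q. rep \<xi> p q \<longrightarrow> rep (u \<frown> \<xi>) (a * p + b * q) (c * p + d * q))"
proof (induction u)
  case Nil
  show ?case by (rule exI[of _ 1], rule exI[of _ 0], rule exI[of _ 0], rule exI[of _ 1]) simp
next
  case (Cons e u)
  then obtain a b c d :: int where *: "a * d - b * c = 1"
    "\<And>\<xi> p q. rep \<xi> p q \<Longrightarrow> rep (u \<frown> \<xi>) (a * p + b * q) (c * p + d * q)" by blast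
  show ?case
  proof (cases e)
    case True
    have "rep ((e # u) \<frown> \<xi>) ((a + c) * p + (b + d) * q) (c * p + d * q)" if "rep \<xi> p q" for \<xi> p q
      using rep_True[OF *(2)[OF that]] True by (simp add: algebra_simps)
    moreover have "(a + c) * d - (b + d) * c = 1" using *(1) by (simp add: algebra_simps)
    ultimately show ?thesis by blast
  next
    case False
    have "rep ((e # u) \<frown> \<xi>) (a * p + b * q) ((a + c) * p + (b + d) * q)" if "rep \<xi> p q" for \<xi> p q
      using rep_False[OF *(2)[OF that]] False by (simp add: algebra_simps)
    moreover have "a * (b + d) - b * (a + c) = 1" using *(1) by (simp add: algebra_simps)
    ultimately show ?thesis by blast
  qed
qed

text \<open>The two matrices agree at three points of the projective line, so they are proportional, and the
  first one is divisible by 2 unless \<open>k = 0\<close>.\<close>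

lemma proportional_matrices:
  fixes a b c d :: int
  assumes det: "a * d - b * c = 2 ^ k" and det': "a' * d' - b' * c' = 1"
    and odd: "odd a \<or> odd b \<or> odd c \<or> odd d"
    and e: "a * c' = a' * c" "b * d' = b' * d" "(a + b) * (c' + d') = (a' + b') * (c + d)"
  shows "k = 0"
proof -
  \<comment> \<open>The diagonal entries of the inverse of the second matrix times the first. The
    points 0 and infinity make the columns proportional with these factors, and the third point
    makes the factors equal.\<close>
  define \<alpha> \<beta> where "\<alpha> = d' * a - b' * c" and "\<beta> = a' * d - c' * b"
  have 1: "a = a' * \<alpha>" "c = c' * \<alpha>" "b = b' * \<beta>" "d = d' * \<beta>"
    unfolding \<alpha>_def \<beta>_def using det' e(1,2) by algebra+
  have "(\<alpha> - \<beta>) * (a' * d' - b' * c') = 0" using e(3) unfolding 1 by algebra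
  then have 2: "\<alpha> = \<beta>" using det' by simp
  then have "odd \<alpha>" using odd unfolding 1 by auto
  moreover have "\<alpha> * \<alpha> * (a' * d' - b' * c') = 2 ^ k"
    using det unfolding 1 2 by (simp add: algebra_simps)
  ultimately have "odd ((2 :: int) ^ k)" using det' by (metis even_mult_iff mult.right_neutral)
  then show ?thesis by (cases k) auto
qed

context LM
begin

lemma app_val_outside:
  "supported P s t \<Longrightarrow> (\<And>\<eta>. \<xi> \<noteq> s \<frown> \<eta>) \<Longrightarrow> app (\<rho> (val Y s t)) \<xi> = \<xi>"
proof (induction t arbitrary: s)
  case (N l n r)
  have o: "\<xi> \<noteq> (s @ u) \<frown> \<eta>" for u \<eta> using N.prems(2) by (simp flip: conc_conc)
  have y: "app (zmul n (\<rho> (Y s))) \<xi> = \<xi>"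
  proof (cases "n = 0")
    case False
    then have "\<rho> (Y s) = py s" using N.prems(1) \<rho>_Y by auto
    moreover have "app (zmul n (py s)) \<xi> = \<xi>"
    proof -
      have "app (under s (zmul n (py []))) \<xi> = \<xi>"
        using N.prems(2) by (simp add: act_below_outside)
      then show ?thesis using zmul_hom[OF additive_hom_under, of s n "py []"] by (simp add: under_py)
    qed
    ultimately show ?thesis by simp
  qed simp
  show ?case
    using N.IH(1)[of "s @ [False]"] N.IH(2)[of "s @ [True]"] N.prems(1) o y
    by (simp add: hom_simps zmul_hom[OF hom])
qed (simp add: hom_simps)

text \<open>The subtrees act before the power at \<open>s\<close>, so the matrix is the diagonal one
  times the digit times the matrix of the subtree, and the state vector moves through it from the
  left. The length of \<open>u\<close> ensures that the branch leaves the tree; the remaining digits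
  give determinant 1, where every state is acceptable.\<close>

lemma branch_matrix:
  assumes "supported P s t" "tidy q t" "size t \<le> length u"
  shows "\<exists>a b c d :: int. a * d - b * c = 2 ^ branch_weight t u \<and> odd_row q a b c d \<and>
    (\<forall>\<eta> x z. rep \<eta> x z \<longrightarrow> (\<exists>\<xi>. app (\<rho> (val Y s t)) (s \<frown> u \<frown> \<eta>) = s \<frown> \<xi> \<and>
      rep \<xi> (a * x + b * z) (c * x + d * z)))"
  using assms
proof (induction t arbitrary: s q u)
  case L
  obtain a b c d :: int where *: "a * d - b * c = 1"
    "\<And>\<xi> p q. rep \<xi> p q \<Longrightarrow> rep (u \<frown> \<xi>) (a * p + b * q) (c * p + d * q)"
    using word_matrix by blast
  have "\<exists>\<xi>. app (\<rho> (val Y s L)) (s \<frown> u \<frown> \<eta>) = s \<frown> \<xi> \<and> rep \<xi> (a * x + b * z) (c * x + d * z)"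
    if "rep \<eta> x z" for \<eta> x z
    by (rule exI[of _ "u \<frown> \<eta>"]) (simp add: hom_simps *(2)[OF that])
  moreover have "a * d - b * c = 2 ^ branch_weight L u" using *(1) by simp
  ultimately show ?case using odd_row_det_1[OF *(1)] by blast
next
  case (N l n r)
  obtain e v where u: "u = e # v" using N.prems(3) by (cases u) auto
  define q' where "q' = (if n = 0 then q else sign_state n)"
  have t: "tidy (step q' False) l" "tidy (step q' True) r" "n = 0 \<or> admits q n"
    using N.prems(2) by (auto simp: q'_def split: if_splits)
  define m where "m = branch_weight (if e then r else l) v"
  have "\<exists>a b c d :: int. a * d - b * c = 2 ^ m \<and> odd_row q' a b c d \<and>
    (\<forall>\<eta> x z. rep \<eta> x z \<longrightarrow> (\<exists>\<xi>. app (\<rho> (val Y (s @ [False]) l + val Y (s @ [True]) r)) (s \<frown> u \<frown> \<eta>)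
      = s \<frown> \<xi> \<and> rep \<xi> (a * x + b * z) (c * x + d * z)))"
  proof (cases e)
    case True
    obtain a b c d :: int where *: "a * d - b * c = 2 ^ m" "odd_row (step q' True) a b c d"
      "\<And>\<eta> x z. rep \<eta> x z \<Longrightarrow> \<exists>\<xi>. app (\<rho> (val Y (s @ [True]) r)) ((s @ [True]) \<frown> v \<frown> \<eta>)
        = (s @ [True]) \<frown> \<xi> \<and> rep \<xi> (a * x + b * z) (c * x + d * z)"
      using N.IH(2)[of "s @ [True]" "step q' True" v] N.prems t True unfolding u m_def by auto
    have out: "app (\<rho> (val Y (s @ [False]) l)) ((s @ [True] @ v) \<frown> \<eta>) = (s @ [True] @ v) \<frown> \<eta>" for \<eta>
      using N.prems(1) conc_neq_parallel[of "s @ [True] @ v" "s @ [False]"]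
      by (intro app_val_outside) (auto simp: Cons_parallelI1)
    have "\<exists>\<xi>. app (\<rho> (val Y (s @ [False]) l + val Y (s @ [True]) r)) (s \<frown> u \<frown> \<eta>)
      = s \<frown> \<xi> \<and> rep \<xi> ((a + c) * x + (b + d) * z) (c * x + d * z)" if r: "rep \<eta> x z" for \<eta> x z
    proof -
      obtain \<xi> where \<xi>: "app (\<rho> (val Y (s @ [True]) r)) ((s @ [True]) \<frown> v \<frown> \<eta>)
        = (s @ [True]) \<frown> \<xi>" "rep \<xi> (a * x + b * z) (c * x + d * z)" using *(3)[OF r] by blast
      then show ?thesis
        using rep_True[OF \<xi>(2)] out[of \<eta>]
        by (intro exI[of _ "[True] \<frown> \<xi>"]) (simp add: hom_simps u True algebra_simps)
    qed
    moreover have "(a + c) * d - (b + d) * c = 2 ^ m" using *(1) by (simp add: algebra_simps)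
    ultimately show ?thesis using odd_row_step_True[OF *(2)] by blast
  next
    case False
    obtain a b c d :: int where *: "a * d - b * c = 2 ^ m" "odd_row (step q' False) a b c d"
      "\<And>\<eta> x z. rep \<eta> x z \<Longrightarrow> \<exists>\<xi>. app (\<rho> (val Y (s @ [False]) l)) ((s @ [False]) \<frown> v \<frown> \<eta>)
        = (s @ [False]) \<frown> \<xi> \<and> rep \<xi> (a * x + b * z) (c * x + d * z)"
      using N.IH(1)[of "s @ [False]" "step q' False" v] N.prems t False unfolding u m_def by auto
    have out: "app (\<rho> (val Y (s @ [True]) r)) ((s @ [False]) \<frown> \<eta>) = (s @ [False]) \<frown> \<eta>" for \<eta>
      using N.prems(1) conc_neq_parallel[of "s @ [False]" "s @ [True]"]
      by (intro app_val_outside) (auto simp: Cons_parallelI1)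
    have "\<exists>\<xi>. app (\<rho> (val Y (s @ [False]) l + val Y (s @ [True]) r)) (s \<frown> u \<frown> \<eta>)
      = s \<frown> \<xi> \<and> rep \<xi> (a * x + b * z) ((a + c) * x + (b + d) * z)" if r: "rep \<eta> x z" for \<eta> x z
    proof -
      obtain \<xi> where \<xi>: "app (\<rho> (val Y (s @ [False]) l)) ((s @ [False]) \<frown> v \<frown> \<eta>)
        = (s @ [False]) \<frown> \<xi>" "rep \<xi> (a * x + b * z) (c * x + d * z)" using *(3)[OF r] by blast
      then show ?thesis
        using rep_False[OF \<xi>(2)] out[of \<xi>]
        by (intro exI[of _ "[False] \<frown> \<xi>"]) (simp add: hom_simps u False algebra_simps)
    qed
    moreover have "a * (b + d) - b * (a + c) = 2 ^ m" using *(1) by (simp add: algebra_simps)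
    ultimately show ?thesis using odd_row_step_False[OF *(2)] by blast
  qed
  then obtain a b c d :: int where *: "a * d - b * c = 2 ^ m" "odd_row q' a b c d"
    "\<And>\<eta> x z. rep \<eta> x z \<Longrightarrow> \<exists>\<xi>. app (\<rho> (val Y (s @ [False]) l + val Y (s @ [True]) r)) (s \<frown> u \<frown> \<eta>)
      = s \<frown> \<xi> \<and> rep \<xi> (a * x + b * z) (c * x + d * z)" by blast
  let ?m = "(2 :: int) ^ nat n" and ?m' = "(2 :: int) ^ nat (- n)"
  have "?m * ?m' = 2 ^ nat \<bar>n\<bar>" by (cases "0 \<le> n") auto
  moreover have "(?m * a) * (?m' * d) - (?m * b) * (?m' * c) = (?m * ?m') * (a * d - b * c)"
    by (simp add: algebra_simps)
  ultimately have "(?m * a) * (?m' * d) - (?m * b) * (?m' * c) = 2 ^ (nat \<bar>n\<bar> + m)"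
    using *(1) by (simp add: power_add)
  moreover have "odd_row q (?m * a) (?m * b) (?m' * c) (?m' * d)"
    using *(2) odd_row_scale[of n q a b c d] t(3) by (cases "n = 0") (auto simp: q'_def)
  moreover have "\<exists>\<xi>. app (\<rho> (val Y s (N l n r))) (s \<frown> u \<frown> \<eta>) = s \<frown> \<xi> \<and>
      rep \<xi> (?m * a * x + ?m * b * z) (?m' * c * x + ?m' * d * z)" if r: "rep \<eta> x z" for \<eta> x z
  proof -
    obtain \<xi> where \<xi>: "app (\<rho> (val Y (s @ [False]) l + val Y (s @ [True]) r)) (s \<frown> u \<frown> \<eta>)
      = s \<frown> \<xi>" "rep \<xi> (a * x + b * z) (c * x + d * z)" using *(3)[OF r] by blast
    have "zmul n (\<rho> (Y s)) = zmul n (py s)"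
      using N.prems(1) \<rho>_Y by (cases "n = 0") auto
    with rep_zmul_py[OF \<xi>(2), of n s] show ?thesis
      using \<xi>(1) by (auto simp: hom_simps zmul_hom[OF hom] algebra_simps)
  qed
  ultimately show ?case unfolding u branch_weight.simps m_def[symmetric] by blast
qed

definition A :: "nat \<Rightarrow> 'g" where
  "A n = X (replicate n True)"

sublocale thompson: thompson A \<rho>
proof
  show "n < m \<Longrightarrow> A m + A n = A n + A (Suc m)" for n m
    unfolding A_def by (intro x_conj seq_image_spine)
qed (simp_all add: hom A_def \<rho>_X)

text \<open>Conjugation by x and x_1 moves x_s along the orbits, and for the two representatives off
  the right spine \<open>x_square\<close> is solved for its first summand.\<close>

lemma X_in_gen_A: "X s \<in> gen (range A)"
proof (rule orbit_induct)
  have A: "A n \<in> gen (range A)" for n by (auto intro: gen_intros)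
  have X: "X [] \<in> gen (range A)" "X [True] \<in> gen (range A)" "X [True, True] \<in> gen (range A)"
    using A[of 0] A[of 1] A[of 2] by (simp_all add: A_def numeral_2_eq_2)
  have inv: "X t \<in> gen (range A) \<longleftrightarrow> X t' \<in> gen (range A)"
    if "X s \<in> gen (range A)" "seq_image s t t'" for s t t'
  proof -
    have e: "X t + X s = X s + X t'" by (rule x_conj[OF that(2)])
    have "X t = X s + X t' - X s" by (simp flip: e)
    moreover have "X t' = - X s + (X t + X s)" by (simp add: e)
    ultimately show ?thesis using that(1) gen_intros by metis
  qed
  show "seq_image [] t t' \<Longrightarrow> X t \<in> gen (range A) \<longleftrightarrow> X t' \<in> gen (range A)"
    "seq_image [True] t t' \<Longrightarrow> X t \<in> gen (range A) \<longleftrightarrow> X t' \<in> gen (range A)" for t t'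
    using inv X by blast+
  show "X [] \<in> gen (range A)" "X [True] \<in> gen (range A)" by (fact X)+
  have "X [False] = X [] + X [] - X [True] - X []"
    using x_square[of "[]"] by simp
  then show "X [False] \<in> gen (range A)" using X by (simp add: gen_intros)
  have "X [True, False] = X [True] + X [True] - X [True, True] - X [True]"
    using x_square[of "[True]"] by simp
  then show "X [True, False] \<in> gen (range A)" using X by (simp add: gen_intros)
qed

theorem LM_faithful:
  assumes "h \<in> XYG []" "\<rho> h = 0" shows "h = 0"
proof -
  obtain g t where g: "g \<in> XG []" and h: "h = g + val Y [] t"
    and t: "supported P [] t" "tidy Any t"
    using standard_XYG[OF assms(1)] by (auto simp: standard_def)
  have "XG [] \<subseteq> gen (range A)"
    unfolding XG_def by (rule gen_subsetI) (auto intro: X_in_gen_A)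
  with g have gA: "g \<in> gen (range A)" by blast
  show ?thesis
  proof (cases "zero_tree t")
    case True
    then have "h = g" by (simp add: h val_zero_tree)
    then show ?thesis using thompson.faithful gA assms(2) by simp
  next
    case False
    have g': "- g \<in> gen (range A)" using gA by (rule gen_uminus)
    obtain d where d: "\<And>v. d \<le> length v \<Longrightarrow> \<exists>v'. carries (\<rho> (- g)) v v'"
      using thompson.gen_carries[OF g'] by blast
    \<comment> \<open>The branch meets a nonzero label, leaves the tree, and is long enough for
      \<open>- g\<close> to carry its cone.\<close>
    obtain u where u: "max d (size t) \<le> length u" "0 < branch_weight t u"
      using branch_weight_pos[OF False] by blast
    obtain w where w: "carries (\<rho> (- g)) u w" using d[of u] u by auto
    have "\<rho> (val Y [] t) = \<rho> (- g)"
      using assms(2) by (simp add: h hom_simps eq_neg_iff_add_eq_0) (metis minus_unique minus_minus neg_eq_iff_add_eq_0)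
    then have w': "app (\<rho> (val Y [] t)) (u \<frown> \<eta>) = w \<frown> \<eta>" for \<eta>
      using w by (simp add: carries_def)
    obtain a b c e :: int where M: "a * e - b * c = 2 ^ branch_weight t u" "odd_row Any a b c e"
      "\<And>\<eta> x z. rep \<eta> x z \<Longrightarrow> \<exists>\<xi>. app (\<rho> (val Y [] t)) ([] \<frown> u \<frown> \<eta>) = [] \<frown> \<xi> \<and>
        rep \<xi> (a * x + b * z) (c * x + e * z)"
      using branch_matrix[OF t, of u] u by auto
    obtain a' b' c' e' :: int where W: "a' * e' - b' * c' = 1"
      "\<And>\<xi> p q. rep \<xi> p q \<Longrightarrow> rep (w \<frown> \<xi>) (a' * p + b' * q) (c' * p + e' * q)"
      using word_matrix[of w] by blast
    have cross: "(a * x + b * z) * (c' * x + e' * z) = (a' * x + b' * z) * (c * x + e * z)"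
      if r: "rep \<eta> x z" for \<eta> x z
    proof -
      have "rep (w \<frown> \<eta>) (a * x + b * z) (c * x + e * z)" using M(3)[OF r] by (auto simp: w')
      then show ?thesis using W(2)[OF r] by (rule rep_unique)
    qed
    \<comment> \<open>The three points 0, infinity and 1; evaluation there gives the columns of the
      matrices and their sum.\<close>
    have "rep (\<lambda>_. False) 0 1" "rep (\<lambda>_. True) 1 0" by (auto intro: rep.intros)
    moreover from rep_False[OF this(2)] have "rep ([False] \<frown> (\<lambda>_. True)) 1 1" by simp
    ultimately have "branch_weight t u = 0"
      using cross[of "\<lambda>_. False" 0 1] cross[of "\<lambda>_. True" 1 0] cross[of "[False] \<frown> (\<lambda>_. True)" 1 1]
        M(2) by (intro proportional_matrices[OF M(1) W(1)]) auto
    with u show ?thesis by simp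
  qed
qed

end

section \<open>The infinite presentations\<close>

lemma homeo_group_bij: "f \<in> carrier homeo_group \<Longrightarrow> bij f"
  by (auto simp: homeo_group_def dest: homeo_imp_bij)

lemma Permu_eq_iff: "bij f \<Longrightarrow> bij g \<Longrightarrow> Permu f = Permu g \<longleftrightarrow> f = g"
  by (simp add: Permu_inject)

lemma Permu_comp: "bij f \<Longrightarrow> bij g \<Longrightarrow> Permu (g \<circ> f) = Permu f + Permu g"
  by (rule permu_eqI) (simp add: app_Permu bij_comp)

lemma Permu_id: "Permu id = 0"
  by (rule permu_eqI) (simp add: app_Permu)

lemma Permu_ident [simp]: "Permu (\<lambda>a. a) = 0"
  using Permu_id by (simp add: id_def)

lemma Permu_inv:
  fixes f :: "'c::topological_space \<Rightarrow> 'c"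
  assumes "f \<in> carrier homeo_group"
  shows "Permu (inv\<^bsub>homeo_group\<^esub> f) = - Permu f"
proof -
  interpret group "homeo_group :: ('c \<Rightarrow> 'c) monoid" by (rule group_homeo_group)
  have "inv\<^bsub>homeo_group\<^esub> f \<circ> f = id"
    using r_inv[OF assms] by (simp add: homeo_group_def)
  then have "Permu f + Permu (inv\<^bsub>homeo_group\<^esub> f) = 0"
    using assms homeo_group_bij inv_closed by (metis Permu_comp Permu_id)
  then show ?thesis by (simp add: eq_neg_iff_add_eq_0 minus_unique)
qed

lemma Permu_generate:
  fixes B :: "('c::topological_space \<Rightarrow> 'c) set"
  assumes "f \<in> generate homeo_group B" "B \<subseteq> carrier homeo_group"
  shows "Permu f \<in> gen (Permu ` B)"
  using assms(1)
proof induction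
  case one
  then show ?case by (simp add: homeo_group_def Permu_id gen_intros)
next
  case (incl f)
  then show ?case by (auto intro: gen_intros)
next
  case (inv f)
  then have "- Permu f \<in> gen (Permu ` B)" by (auto intro: gen_intros)
  moreover have "f \<in> carrier homeo_group" using inv assms(2) by blast
  ultimately show ?case by (simp add: Permu_inv)
next
  case (eng f g)
  interpret group "homeo_group :: ('c \<Rightarrow> 'c) monoid" by (rule group_homeo_group)
  have "f \<in> carrier homeo_group" "g \<in> carrier homeo_group"
    using eng assms(2) generate_in_carrier by blast+
  then have "bij f" "bij g" by (auto intro: homeo_group_bij)
  then have "Permu (f \<otimes>\<^bsub>homeo_group\<^esub> g) = Permu f + Permu g"
    by (simp add: homeo_group_def Permu_comp)
  then show ?case using eng by (simp add: gen_intros)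
qed

text \<open>A homeomorphism is determined by its permutation, so the criterion can be checked in
  \<open>permu\<close>. The letters have an arbitrary type because they are maps in the infinite
  presentations and natural numbers in the finite ones.\<close>

theorem homeo_presentation:
  fixes B :: "('c::topological_space \<Rightarrow> 'c) set" and S :: "'a set"
  defines "G \<equiv> subgroup_generated homeo_group B"
  assumes B: "B \<subseteq> carrier homeo_group" and \<phi>: "\<phi> \<in> S \<rightarrow> carrier G"
    and R: "R \<subseteq> words_over S \<times> words_over S"
    and gen: "\<And>b. b \<in> B \<Longrightarrow> Permu b \<in> gen ((\<lambda>a. Permu (\<phi> a)) ` S)"
    and rel: "\<And>u v. (u, v) \<in> R \<Longrightarrow> ev (\<lambda>a. Permu (\<phi> a)) u = ev (\<lambda>a. Permu (\<phi> a)) v"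
    and faithful: "\<And>(\<psi> :: 'a \<Rightarrow> 'a letter list set permu) w.
      (\<forall>(u, v)\<in>R. ev \<psi> u = ev \<psi> v) \<Longrightarrow> w \<in> words_over S \<Longrightarrow>
      ev (\<lambda>a. Permu (\<phi> a)) w = 0 \<Longrightarrow> ev \<psi> w = 0"
  shows "presentation G \<phi> S R"
proof -
  interpret H: group "homeo_group :: ('c \<Rightarrow> 'c) monoid" by (rule group_homeo_group)
  interpret G: group G unfolding G_def by (rule H.group_subgroup_generated)
  have car: "carrier G \<subseteq> carrier homeo_group"
    unfolding G_def by (rule H.carrier_subgroup_generated_subset)
  have val: "Permu (word_val G \<phi> w) = ev (\<lambda>a. Permu (\<phi> a)) w" if "w \<in> words_over S" for w
    using that
  proof (induction w)
    case Nil
    show ?case by (simp add: word_val_def G_def homeo_group_def Permu_id)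
  next
    case (Cons l w)
    then have *: "word_val G \<phi> w \<in> carrier G" "\<phi> (fst l) \<in> carrier G"
      using \<phi> by (auto intro: G.word_val_closed)
    then have l: "letter_val G \<phi> l \<in> carrier G" by (simp add: letter_val_def)
    have inv: "inv\<^bsub>G\<^esub> \<phi> (fst l) = inv\<^bsub>homeo_group\<^esub> \<phi> (fst l)"
      using * unfolding G_def by simp
    have "word_val G \<phi> (l # w) = word_val G \<phi> w \<circ> letter_val G \<phi> l"
      by (simp add: word_val_def G_def homeo_group_def)
    then have "Permu (word_val G \<phi> (l # w)) = Permu (letter_val G \<phi> l) + Permu (word_val G \<phi> w)"
      using * l car by (simp add: Permu_comp homeo_group_bij subset_iff)
    also have "Permu (letter_val G \<phi> l) = (if snd l then Permu (\<phi> (fst l)) else - Permu (\<phi> (fst l)))"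
      using * car by (auto simp: letter_val_def inv Permu_inv)
    finally show ?case using Cons by simp
  qed
  have val_eq: "word_val G \<phi> w = f \<longleftrightarrow> ev (\<lambda>a. Permu (\<phi> a)) w = Permu f"
    if "w \<in> words_over S" "f \<in> carrier G" for w f
    using that car G.word_val_closed[OF \<phi>]
    by (simp add: Permu_eq_iff homeo_group_bij subset_iff flip: val)
  show ?thesis
  proof (rule presentation_criterion)
    show "carrier G \<subseteq> word_val G \<phi> ` words_over S"
    proof
      fix f assume f: "f \<in> carrier G"
      have "f \<in> generate homeo_group B"
        using f B unfolding G_def carrier_subgroup_generated by (simp add: Int_absorb1)
      then have "Permu f \<in> gen (Permu ` B)" using B by (rule Permu_generate)
      also have "gen (Permu ` B) \<subseteq> gen ((\<lambda>a. Permu (\<phi> a)) ` S)"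
        by (rule gen_subsetI) (use gen in auto)
      finally obtain w where "w \<in> words_over S" "ev (\<lambda>a. Permu (\<phi> a)) w = Permu f"
        using gen_imp_ev by blast
      with val_eq[of w f] f show "f \<in> word_val G \<phi> ` words_over S" by blast
    qed
    show "word_val G \<phi> u = word_val G \<phi> v" if "(u, v) \<in> R" for u v
      using rel[OF that] R that val_eq[of u "word_val G \<phi> v"] G.word_val_closed[OF \<phi>] val by auto
    show "ev \<psi> w = 0" if "\<forall>(u, v)\<in>R. ev \<psi> u = ev \<psi> v" "w \<in> words_over S" "word_val G \<phi> w = \<one>\<^bsub>G\<^esub>"
      for \<psi> :: "'a \<Rightarrow> 'a letter list set permu" and w
    proof -
      have "\<one>\<^bsub>G\<^esub> = id" by (simp add: G_def homeo_group_def)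
      with that(3) have "ev (\<lambda>a. Permu (\<phi> a)) w = 0" using val[OF that(2)] by (simp add: Permu_id)
      with that show ?thesis by (intro faithful)
    qed
  qed (use \<phi> R G.is_group in auto)
qed

text \<open>Satisfied by all sequences, which gives G, and by the nonconstant ones, which gives
  G_0.\<close>

locale good_labels =
  fixes P :: "bool list \<Rightarrow> bool"
  assumes good_append: "P s \<Longrightarrow> P (s @ u)"
    and good_image: "seq_image r s s' \<Longrightarrow> P s \<longleftrightarrow> P s'"
begin

definition gens :: "(bool word \<Rightarrow> bool word) set" where
  "gens = X_gens \<union> {y_at s |s. P s}"

lemma gens_homeo: "gens \<subseteq> carrier homeo_group"
  using S_gens_homeo by (auto simp: gens_def S_gens_def Y_gens_def)

lemma x_at_gens [simp]: "x_at s \<in> gens"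
  by (simp add: gens_def X_gens_def)

lemma y_at_gens [simp]: "P s \<Longrightarrow> y_at s \<in> gens"
  by (auto simp: gens_def)

definition rels :: "(bool word \<Rightarrow> bool word) relation set" where
  "rels = R_rels \<inter> (words_over gens \<times> words_over gens)"

text \<open>The group in which the relations are tested need not map to permutations of the Cantor
  space. Pairing each letter with its permutation makes \<open>snd\<close> the required
  homomorphism, and \<open>fst\<close> recovers the value under test.\<close>

lemma LM_pair:
  fixes X Y :: "bool list \<Rightarrow> 'g::group_add"
  assumes "\<And>s. X s + X s = X (s @ [False]) + X s + X (s @ [True])"
    and "\<And>s t t'. seq_image s t t' \<Longrightarrow> X t + X s = X s + X t'"
    and "\<And>s t t'. seq_image s t t' \<Longrightarrow> P t \<Longrightarrow> Y t + X s = X s + Y t'"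
    and "\<And>s t. s \<parallel> t \<Longrightarrow> P s \<Longrightarrow> P t \<Longrightarrow> Y s + Y t = Y t + Y s"
    and "\<And>s. P s \<Longrightarrow> Y s = X s + Y (s @ [False]) - Y (s @ [True, False]) + Y (s @ [True, True])"
  shows "LM (\<lambda>s. (X s, px s)) (\<lambda>s. (Y s, py s)) P snd"
proof
  fix s t t' u
  show "P s \<Longrightarrow> P (s @ u)" by (rule good_append)
  show "seq_image s t t' \<Longrightarrow> P t \<longleftrightarrow> P t'" by (rule good_image)
  show "(X s, px s) + (X s, px s) =
    (X (s @ [False]), px (s @ [False])) + (X s, px s) + (X (s @ [True]), px (s @ [True]))"
    unfolding add_Pair assms(1) px_square[of s] ..
  show "(X t, px t) + (X s, px s) = (X s, px s) + (X t', px t')" if "seq_image s t t'"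
    unfolding add_Pair assms(2)[OF that] px_conj[OF that] ..
  show "(Y t, py t) + (X s, px s) = (X s, px s) + (Y t', py t')" if "seq_image s t t'" "P t"
    unfolding add_Pair assms(3)[OF that] py_conj[OF that(1)] ..
  show "(Y s, py s) + (Y t, py t) = (Y t, py t) + (Y s, py s)" if "s \<parallel> t" "P s" "P t"
    unfolding add_Pair assms(4)[OF that] py_comm[OF that(1)] ..
  show "(Y s, py s) = (X s, px s) + (Y (s @ [False]), py (s @ [False]))
    - (Y (s @ [True, False]), py (s @ [True, False])) + (Y (s @ [True, True]), py (s @ [True, True]))"
    if "P s"
    unfolding add_Pair diff_Pair by (rule arg_cong2[where f = Pair, OF assms(5)[OF that] py_expand])
qed (simp_all add: additive_hom_def)

theorem presentation_gens:
  "presentation (subgroup_generated homeo_group gens) (\<lambda>g. g) gens rels"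
proof (rule homeo_presentation[OF gens_homeo])
  interpret H: group "homeo_group :: (bool word \<Rightarrow> bool word) monoid" by (rule group_homeo_group)
  show "(\<lambda>g. g) \<in> gens \<rightarrow> carrier (subgroup_generated homeo_group gens)"
    using H.subgroup_generated_subset_carrier_subset[OF gens_homeo] by auto
  show "rels \<subseteq> words_over gens \<times> words_over gens" by (auto simp: rels_def)
  show "Permu g \<in> gen ((\<lambda>a. Permu a) ` gens)" if "g \<in> gens" for g
    using that by (auto intro: gen_intros)
  show "ev Permu u = ev Permu v" if "(u, v) \<in> rels" for u v
  proof -
    have "(u, v) \<in> R_rels" using that by (simp add: rels_def)
    then show ?thesis
    proof cases
      case (R1 s)
      then show ?thesis using px_square[of s] by (simp add: xl_def add.assoc flip: px_def)
    next
      case (R2 s t t')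
      then show ?thesis using px_conj by (simp add: xl_def flip: px_def)
    next
      case (R3 s t t')
      then show ?thesis using py_conj by (simp add: xl_def yl_def flip: px_def py_def)
    next
      case (R4 s t)
      then show ?thesis using py_comm by (simp add: yl_def flip: py_def)
    next
      case (R5 s)
      then show ?thesis using py_expand[of s]
        by (simp add: xl_def yl_def inv_letter_def add.assoc diff_conv_add_uminus
            del: add_uminus_conv_diff flip: px_def py_def)
    qed
  qed
  fix \<psi> :: "(bool word \<Rightarrow> bool word) \<Rightarrow> (bool word \<Rightarrow> bool word) letter list set permu" and w
  assume rel: "\<forall>(u, v)\<in>rels. ev \<psi> u = ev \<psi> v" and w: "w \<in> words_over gens" "ev Permu w = 0"
  have R: "ev \<psi> u = ev \<psi> v" if "(u, v) \<in> R_rels" "u \<in> words_over gens" "v \<in> words_over gens" for u v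
    using that rel by (auto simp: rels_def)
  interpret LM "\<lambda>s. (\<psi> (x_at s), px s)" "\<lambda>s. (\<psi> (y_at s), py s)" P snd
  proof (rule LM_pair)
    show "\<psi> (x_at s) + \<psi> (x_at s) = \<psi> (x_at (s @ [False])) + \<psi> (x_at s) + \<psi> (x_at (s @ [True]))" for s
      using R[OF R1[of s]] by (simp add: xl_def add.assoc)
    show "\<psi> (x_at t) + \<psi> (x_at s) = \<psi> (x_at s) + \<psi> (x_at t')" if "seq_image s t t'" for s t t'
      using R[OF R2[OF that]] by (simp add: xl_def)
    show "\<psi> (y_at t) + \<psi> (x_at s) = \<psi> (x_at s) + \<psi> (y_at t')" if "seq_image s t t'" "P t" for s t t'
      using R[OF R3[OF that(1)]] that good_image by (simp add: xl_def yl_def)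
    show "\<psi> (y_at s) + \<psi> (y_at t) = \<psi> (y_at t) + \<psi> (y_at s)" if "s \<parallel> t" "P s" "P t" for s t
      using R[OF R4[OF that(1)]] that by (simp add: yl_def)
    show "\<psi> (y_at s) = \<psi> (x_at s) + \<psi> (y_at (s @ [False])) - \<psi> (y_at (s @ [True, False]))
      + \<psi> (y_at (s @ [True, True]))" if "P s" for s
      using R[OF R5[of s]] that good_append[OF that]
      by (simp add: xl_def yl_def inv_letter_def add.assoc diff_conv_add_uminus del: add_uminus_conv_diff)
  qed
  let ?k = "\<lambda>g. (\<psi> g, Permu g)"
  have "ev ?k w \<in> gen (?k ` gens)" using w(1) by (rule ev_in_gen)
  also have "gen (?k ` gens) \<subseteq> XYG []"
    unfolding XYG_def by (rule gen_mono) (auto simp: gens_def X_gens_def px_def py_def)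
  finally have "ev ?k w \<in> XYG []" .
  moreover have "snd (ev ?k w) = 0"
    using w(2) ev_hom[of snd ?k w] by (simp add: additive_hom_def)
  ultimately have "ev ?k w = 0" by (rule LM_faithful)
  then show "ev \<psi> w = 0"
    using ev_hom[of fst ?k w] by (simp add: additive_hom_def)
qed

end

section \<open>Finite presentations\<close>

lemma parallel_append_cases:
  assumes "t \<parallel> r @ w"
  obtains "t \<parallel> r" | v where "t = r @ v" "v \<parallel> w"
proof (cases "t \<parallel> r")
  case False
  then have "Sublist.prefix r t"
    using assms unfolding parallel_def by (metis Sublist.prefix_prefix)
  then obtain v where "t = r @ v" by (auto simp: Sublist.prefix_def)
  with assms that(2) show thesis by simp
qed (use that(1) in blast)

lemma parallel_Cons_cases:
  assumes "v \<parallel> b # w"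
  obtains v' where "v = (\<not> b) # v'" | v' where "v = b # v'" "v' \<parallel> w"
  using assms by (cases v) (auto simp: parallel_def)

lemma seq_image_Cons:
  "seq_image r (r @ False # False # u) (r @ False # u)"
  "seq_image r (r @ False # True # u) (r @ True # False # u)"
  "seq_image r (r @ True # u) (r @ True # True # u)"
  using seq_image.intros(2-4)[of r u] by simp_all

text \<open>Whenever \<open>t.x\<^sub>s\<close> is defined, it can be computed step by step along the words which express \<open>x\<^sub>s\<close>
  through \<open>x\<close> and \<open>x\<^sub>1\<close>, all intermediate steps being defined. Hence relation (3) need only be
  verified for these two.\<close>

lemma seq_image_conj_False:
  assumes s: "seq_image r (r @ False # c # u) s'" "s' = r @ (if c then [True, False] else [False]) @ u"
    and t: "seq_image (r @ False # c # u) t t2"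
  obtains t1 t3 where "seq_image r t t1" "seq_image s' t1 t3" "seq_image r t2 t3"
  using t
proof cases
  case 1
  have *: "r @ v \<parallel> s'" if "v \<parallel> (if c then [True, False] else [False]) @ u" for v
    using that s(2) by simp
  from 1(2) show thesis
  proof (cases rule: parallel_append_cases)
    case 1
    then have "t \<parallel> s'" using s(2) parallel_append[of t r "[]"] by simp
    with 1 \<open>t2 = t\<close> show thesis by (intro that[of t t]) (auto intro: seq_image.intros(1))
  next
    case (2 v)
    from 2(2) show thesis
    proof (cases rule: parallel_Cons_cases)
      case (1 v')
      then have "r @ True # True # v' \<parallel> s'" by (auto simp: s(2) parallel_def)
      then show thesis using 1 2 \<open>t2 = t\<close> seq_image_Cons(3)[of r v']
        by (intro that[of "r @ True # True # v'" "r @ True # True # v'"])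
           (auto intro: seq_image.intros(1))
    next
      case (2 v')
      \<comment> \<open>\<open>v'\<close> is incompatible with some sequence and hence nonempty; its
        first digit decides which clause of x_r applies.\<close>
      define t1 where "t1 = r @ (if hd v' then [True, False] else [False]) @ tl v'"
      from 2(2) have v': "v' = hd v' # tl v'" by (cases v') (auto simp: parallel_def)
      have "seq_image r t t1"
        using seq_image_Cons(1,2)[of r "tl v'"] v' \<open>t = r @ v\<close> 2 unfolding t1_def
        by (cases "hd v'") auto
      moreover have "t1 \<parallel> s'"
        using 2(2) v' unfolding t1_def s(2) by (cases v') (auto simp: parallel_def split: if_splits)
      ultimately show thesis
        using \<open>t2 = t\<close> by (intro that[of t1 t1]) (auto intro: seq_image.intros(1))
    qed
  qed
next
  case (2 v)
  then show thesis
    using seq_image_append[OF s(1)] seq_image.intros(2)[of s' v]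
    by (intro that[of "s' @ [False, False] @ v" "s' @ [False] @ v"]) (auto simp del: append_assoc simp: append_assoc[symmetric])
next
  case (3 v)
  then show thesis
    using seq_image_append[OF s(1)] seq_image.intros(3)[of s' v]
    by (intro that[of "s' @ [False, True] @ v" "s' @ [True, False] @ v"]) (auto simp del: append_assoc simp: append_assoc[symmetric])
next
  case (4 v)
  then show thesis
    using seq_image_append[OF s(1)] seq_image.intros(4)[of s' v]
    by (intro that[of "s' @ [True] @ v" "s' @ [True, True] @ v"]) (auto simp del: append_assoc simp: append_assoc[symmetric])
qed

text \<open>Follows x_(r11u) as the conjugate of x_(r1u) by x_r, so the first step goes backwards.
  It exists because \<open>t\<close> is neither r1 nor an initial segment of \<open>r\<close>, the
  only sequences outside the range of the partial action of x_r.\<close>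

lemma seq_image_conj_True:
  assumes t: "seq_image (r @ True # True # u) t t2"
  obtains t0 t3 where "seq_image r t0 t" "seq_image (r @ True # u) t0 t3" "seq_image r t3 t2"
proof -
  define s s0 where "s = r @ True # True # u" and "s0 = r @ True # u"
  have s: "seq_image r s0 s" unfolding s_def s0_def by (rule seq_image_Cons)
  have "\<exists>t0 t3. seq_image r t0 t \<and> seq_image s0 t0 t3 \<and> seq_image r t3 t2"
    using t unfolding s_def[symmetric]
  proof cases
    case 1
    from 1(2)[unfolded s_def] show ?thesis
    proof (cases rule: parallel_append_cases)
      case 1
      then have "t \<parallel> s0" using parallel_append[of t r "[]"] by (simp add: s0_def)
      with 1 \<open>t2 = t\<close> show ?thesis by (intro exI[of _ t]) (auto intro: seq_image.intros(1))
    next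
      case (2 v)
      have "\<exists>t0. seq_image r t0 t \<and> t0 \<parallel> s0"
        using 2(2)
      proof (cases rule: parallel_Cons_cases)
        case (1 v')
        then show ?thesis using seq_image_Cons(1)[of r v'] \<open>t = r @ v\<close>
          by (intro exI[of _ "r @ False # False # v'"]) (auto simp: s0_def parallel_def)
      next
        case v': (2 v')
        from v'(2) show ?thesis
        proof (cases rule: parallel_Cons_cases)
          case (1 v'')
          then show ?thesis using seq_image_Cons(2)[of r v''] \<open>t = r @ v\<close> v'
            by (intro exI[of _ "r @ False # True # v''"]) (auto simp: s0_def parallel_def)
        next
          case (2 v'')
          then show ?thesis using seq_image_Cons(3)[of r v''] \<open>t = r @ v\<close> v'
            by (intro exI[of _ "r @ True # v''"]) (auto simp: s0_def parallel_def)
        qed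
      qed
      with \<open>t2 = t\<close> show ?thesis by (auto intro: seq_image.intros(1))
    qed
  next
    case (2 v)
    then show ?thesis
      using seq_image_append[OF s, of "[False, False] @ v"] seq_image_append[OF s, of "[False] @ v"]
        seq_image.intros(2)[of s0 v] by auto
  next
    case (3 v)
    then show ?thesis
      using seq_image_append[OF s, of "[False, True] @ v"] seq_image_append[OF s, of "[True, False] @ v"]
        seq_image.intros(3)[of s0 v] by auto
  next
    case (4 v)
    then show ?thesis
      using seq_image_append[OF s, of "[True] @ v"] seq_image_append[OF s, of "[True, True] @ v"]
        seq_image.intros(4)[of s0 v] by auto
  qed
  with that show thesis by (auto simp: s0_def)
qed

text \<open>Follows the formula for x at r0 obtained from \<open>R1\<close>: twice x_r, then the
  inverse of x at r1, then the inverse of x_r.\<close>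

lemma seq_image_left_child:
  assumes "seq_image (r @ [False]) t t2"
  obtains t1 p q where "seq_image r t t1" "seq_image r t1 p" "seq_image (r @ [True]) q p" "seq_image r t2 q"
proof -
  note im = seq_image_Cons
  have "\<exists>t1 p q. seq_image r t t1 \<and> seq_image r t1 p \<and> seq_image (r @ [True]) q p \<and> seq_image r t2 q"
    using assms
  proof cases
    case 1
    from 1(2) show ?thesis
    proof (cases rule: parallel_append_cases)
      case 1
      then have "seq_image r t t" "seq_image (r @ [True]) t t"
        using parallel_append[of t r "[]" "[True]"] by (auto intro: seq_image.intros(1))
      with \<open>t2 = t\<close> show ?thesis by blast
    next
      case (2 v)
      from 2(2) obtain v' where "v = True # v'"
        by (cases rule: parallel_Cons_cases) (auto simp: parallel_def)
      then show ?thesis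
        using \<open>t2 = t\<close> 2(1) im(3)[of r v'] im(3)[of r "True # v'"] im(3)[of "r @ [True]" v']
        by (intro exI[of _ "r @ True # True # v'"] exI[of _ "r @ True # True # True # v'"]) auto
    qed
  next
    case (2 v)
    have "seq_image (r @ [True]) (r @ False # v) (r @ False # v)"
      by (rule seq_image.intros(1)) (auto simp: parallel_def)
    then show ?thesis using 2 im(1)[of r "False # v"] im(1)[of r v] by auto
  next
    case (3 v)
    then show ?thesis
      using im(1)[of r "True # v"] im(2)[of r v] im(1)[of "r @ [True]" v] im(2)[of r "False # v"]
      by auto
  next
    case (4 v)
    then show ?thesis
      using im(2)[of r v] im(3)[of r "False # v"] im(2)[of "r @ [True]" v] im(2)[of r "True # v"]
      by auto
  qed
  with that show thesis by blast
qed

text \<open>Each clause mirrors a formula for x_s, either \<open>R1\<close> solved for x at r0 or a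
  conjugation by x_r. Thus what holds for x and x_1 and passes along these formulas holds for every
  x_s.\<close>

lemma seq_induct:
  assumes base: "Q []" "Q [True]"
    and left: "\<And>r. Q r \<Longrightarrow> Q (r @ [True]) \<Longrightarrow> Q (r @ [False])"
    and FF: "\<And>r u. Q r \<Longrightarrow> Q (r @ False # u) \<Longrightarrow> Q (r @ False # False # u)"
    and FT: "\<And>r u. Q r \<Longrightarrow> Q (r @ True # False # u) \<Longrightarrow> Q (r @ False # True # u)"
    and TT: "\<And>r u. Q r \<Longrightarrow> Q (r @ True # u) \<Longrightarrow> Q (r @ True # True # u)"
  shows "Q s"
proof -
  have 10: "Q (True # False # u)" for u
  proof (induction u)
    case Nil
    show ?case using left[of "[True]"] TT[of "[]" "[]"] base by simp
  next
    case (Cons b u)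
    then show ?case
      using FF[of "[True]" u] FT[of "[True]" u] TT[of "[]" "False # u"] base by (cases b) auto
  qed
  have 1: "Q (True # u)" for u
  proof (induction u)
    case (Cons b u)
    then show ?case using TT[of "[]" u] 10 base by (cases b) auto
  qed (simp add: base)
  have "Q (False # u)" for u
  proof (induction u)
    case Nil
    show ?case using left[of "[]"] base by simp
  next
    case (Cons b u)
    then show ?case using FF[of "[]" u] FT[of "[]" u] 10 base by (cases b) auto
  qed
  with 1 base show ?thesis by (cases s) (metis (full_types))+
qed

text \<open>Letter \<open>0\<close> stands for \<open>x\<close>, letter \<open>1\<close> for \<open>x\<^sub>1\<close>, and letter \<open>k + 2\<close> for \<open>y\<^sub>s\<close> where \<open>s\<close> is the
  \<open>k\<close>-th entry of \<open>base_seqs\<close>.\<close>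

definition base_seqs :: "bool list list" where
  "base_seqs = [[True, False], [False], [True], []]"

abbreviation ltr :: "nat \<Rightarrow> nat letter" where "ltr k \<equiv> (k, True)"
abbreviation inv_ltr :: "nat \<Rightarrow> nat letter" where "inv_ltr k \<equiv> (k, False)"

text \<open>Conjugates the letter of y at 10 along the orbit: x_1 sends 100u to 10u, and it sends
  101u to 110u, which the inverse of x sends to 10u.\<close>

fun y10_word :: "bool list \<Rightarrow> nat letter list" where
  "y10_word [] = [ltr 2]"
| "y10_word (False # u) = [ltr 1] @ y10_word u @ [inv_ltr 1]"
| "y10_word (True # u) = [ltr 1, inv_ltr 0] @ y10_word u @ [ltr 0, inv_ltr 1]"

fun y_word :: "bool list \<Rightarrow> nat letter list" where
  "y_word [] = [ltr 5]"
| "y_word [False] = [ltr 3]"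
| "y_word [True] = [ltr 4]"
| "y_word (False # False # u) = [ltr 0] @ y_word (False # u) @ [inv_ltr 0]"
| "y_word (False # True # u) = [ltr 0] @ y10_word u @ [inv_ltr 0]"
| "y_word (True # True # u) = [inv_ltr 0] @ y_word (True # u) @ [ltr 0]"
| "y_word (True # False # u) = y10_word u"

fun a_word :: "nat \<Rightarrow> nat letter list" where
  "a_word 0 = [ltr 0]"
| "a_word (Suc 0) = [ltr 1]"
| "a_word (Suc (Suc n)) = [inv_ltr 0] @ a_word (Suc n) @ [ltr 0]"

text \<open>\<open>R1\<close> at the root, solved for x at 0. Similarly \<open>x00_word\<close> is a
  conjugate of this, and \<open>x10_word\<close> comes from \<open>R1\<close> at the vertex
  1.\<close>

definition x0_word :: "nat letter list" where
  "x0_word = [ltr 0, ltr 0, inv_ltr 1, inv_ltr 0]"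

definition x00_word :: "nat letter list" where
  "x00_word = [ltr 0] @ x0_word @ [inv_ltr 0]"

definition x10_word :: "nat letter list" where
  "x10_word = [ltr 1, ltr 1] @ inv_word (a_word 2) @ [inv_ltr 1]"

definition y_expand_rel :: "bool list \<Rightarrow> nat letter list \<Rightarrow> nat relation" where
  "y_expand_rel s xw = (y_word s, xw @ y_word (s @ [False]) @
     inv_word (y_word (s @ [True, False])) @ y_word (s @ [True, True]))"

definition comm_rel :: "nat letter list \<Rightarrow> nat letter list \<Rightarrow> nat relation" where
  "comm_rel u v = (u @ v, v @ u)"

text \<open>Incompatible sequences have a common stem \<open>w\<close> followed by different digits.
  The stem and both tails can be brought to representatives, so pairs of such sequences suffice for
  \<open>R4\<close>.\<close>

definition pair_seqs :: "bool list set" where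
  "pair_seqs = (\<lambda>(w, b, u). w @ b # u) ` (set base_seqs \<times> UNIV \<times> set base_seqs)"

text \<open>The two defining relations of F, with x at 1^(n+2) abbreviating a conjugate of x at
  1^(n+1) by x.\<close>

definition x_relations :: "nat relation set" where
  "x_relations = {(a_word 2 @ a_word 1, a_word 1 @ a_word 3), (a_word 3 @ a_word 1, a_word 1 @ a_word 4)}"

text \<open>Elements of F fixing the cone below 10 pointwise act in the cones below 0 and 11; these
  copies of F are generated by x at 0, 00 and at 11, 111. For the representatives 0 and 1 one copy
  remains, and for the empty sequence none.\<close>

definition comm_pairs :: "(bool list \<times> nat letter list) set" where
  "comm_pairs = {([True, False], a_word 2), ([True, False], a_word 3), ([True, False], x0_word),
     ([True, False], x00_word), ([False], a_word 1), ([False], a_word 2), ([True], x0_word),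
     ([True], x00_word)}"

definition expand_pairs :: "(bool list \<times> nat letter list) set" where
  "expand_pairs =
     {([], a_word 0), ([True], a_word 1), ([False], x0_word), ([True, False], x10_word)}"

definition y_relations :: "(bool list \<Rightarrow> bool) \<Rightarrow> nat relation set" where
  "y_relations P =
     {comm_rel (y_word s) w |s w. P s \<and> (s, w) \<in> comm_pairs} \<union>
     {y_expand_rel s w |s w. P s \<and> (s, w) \<in> expand_pairs} \<union>
     {comm_rel (y_word s) (y_word t) |s t. P s \<and> P t \<and> s \<parallel> t \<and> (s, t) \<in> pair_seqs \<times> pair_seqs}"

lemma finite_x_relations: "finite x_relations"
  by (simp add: x_relations_def)

lemma finite_y_relations: "finite (y_relations P)"
proof -
  have "y_relations P \<subseteq> (\<lambda>(s, w). comm_rel (y_word s) w) ` comm_pairs \<union>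
    (\<lambda>(s, w). y_expand_rel s w) ` expand_pairs \<union>
    (\<lambda>(s, t). comm_rel (y_word s) (y_word t)) ` (pair_seqs \<times> pair_seqs)"
    unfolding y_relations_def by (intro Un_mono) (rule subsetI, force)+
  moreover have "finite comm_pairs" "finite expand_pairs" "finite pair_seqs"
    by (simp_all add: comm_pairs_def expand_pairs_def pair_seqs_def)
  ultimately show ?thesis by (meson finite_SigmaI finite_UnI finite_imageI finite_subset)
qed

definition base_gen :: "nat \<Rightarrow> bool word \<Rightarrow> bool word" where
  "base_gen k = (if k = 0 then x_at [] else if k = 1 then x_at [True] else y_at (base_seqs ! (k - 2)))"

lemma Permu_base_gen:
  "Permu (base_gen 0) = px []" "Permu (base_gen (Suc 0)) = px [True]" "Permu (base_gen 2) = py [True, False]"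
  "Permu (base_gen 3) = py [False]" "Permu (base_gen 4) = py [True]" "Permu (base_gen 5) = py []"
  by (simp_all add: base_gen_def base_seqs_def px_def py_def numeral_eq_Suc)

abbreviation base_val :: "nat letter list \<Rightarrow> bool word permu" where
  "base_val \<equiv> ev (\<lambda>k. Permu (base_gen k))"

lemma conj_eqs:
  fixes a b c :: "'g::group_add"
  assumes "a + c = c + b" shows "c + b - c = a" "- c + a + c = b"
  using assms by (metis add_diff_cancel, metis add.assoc minus_add_cancel)

lemma base_val_y10: "base_val (y10_word u) = py (True # False # u)"
proof (induction u rule: y10_word.induct)
  case (2 u)
  then show ?case
    using conj_eqs(1)[OF py_conj[OF seq_image_True(1)[of u]]]
    by (simp add: Permu_base_gen add.assoc diff_conv_add_uminus del: add_uminus_conv_diff)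
next
  case (3 u)
  have "px [True] + (- px [] + py (True # False # u) + px []) - px [True] = py (True # False # True # u)"
    using conj_eqs(1)[OF py_conj[OF seq_image_True(2)[of u]]]
      conj_eqs(2)[OF py_conj[OF seq_image_Nil(3)[of "False # u"]]] by simp
  with 3 show ?case
    by (simp add: Permu_base_gen add.assoc diff_conv_add_uminus del: add_uminus_conv_diff)
qed (simp add: Permu_base_gen)

lemma base_val_y: "base_val (y_word s) = py s"
proof (induction s rule: y_word.induct)
  case (4 u)
  then show ?case using conj_eqs(1)[OF py_conj[OF seq_image_Nil(1)[of u]]]
    by (simp add: Permu_base_gen add.assoc diff_conv_add_uminus del: add_uminus_conv_diff)
next
  case (5 u)
  show ?case using conj_eqs(1)[OF py_conj[OF seq_image_Nil(2)[of u]]]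
    by (simp add: Permu_base_gen base_val_y10 add.assoc diff_conv_add_uminus del: add_uminus_conv_diff)
next
  case (6 u)
  then show ?case using conj_eqs(2)[OF py_conj[OF seq_image_Nil(3)[of u]]]
    by (simp add: Permu_base_gen add.assoc diff_conv_add_uminus del: add_uminus_conv_diff)
qed (simp_all add: Permu_base_gen base_val_y10)

lemma base_val_a: "base_val (a_word n) = px (replicate n True)"
proof (induction n rule: a_word.induct)
  case (3 n)
  then show ?case using conj_eqs(2)[OF px_conj[OF seq_image_Nil(3)[of "replicate n True"]]]
    by (simp add: Permu_base_gen add.assoc)
qed (simp_all add: Permu_base_gen)

lemma base_val_a_numeral:
  "base_val (a_word 1) = px [True]" "base_val (a_word 2) = px [True, True]"
  "base_val (a_word 3) = px [True, True, True]" "base_val (a_word 4) = px [True, True, True, True]"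
  by (simp_all only: base_val_a) (simp_all add: eval_nat_numeral)

lemma square_solve:
  fixes a b c :: "'g::group_add"
  assumes "a + a = b + a + c" shows "b = a + a - c - a"
proof -
  have "a + a - c - a = b + a + c - c - a" by (simp only: assms)
  then show ?thesis by simp
qed

lemma base_val_x0: "base_val x0_word = px [False]"
  using square_solve[OF px_square[of "[]"]]
  by (simp add: x0_word_def Permu_base_gen add.assoc diff_conv_add_uminus del: add_uminus_conv_diff)

lemma base_val_x00: "base_val x00_word = px [False, False]"
  using conj_eqs(1)[OF px_conj[OF seq_image_Nil(1)[of "[]"]]]
  by (simp add: x00_word_def base_val_x0 Permu_base_gen add.assoc diff_conv_add_uminus
      del: add_uminus_conv_diff)

lemma base_val_x10: "base_val x10_word = px [True, False]"
  using square_solve[OF px_square[of "[True]"]]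
  by (simp add: x10_word_def base_val_a_numeral Permu_base_gen add.assoc diff_conv_add_uminus
      del: add_uminus_conv_diff)

lemma base_val_relations:
  assumes "(u, v) \<in> x_relations \<union> y_relations P" shows "base_val u = base_val v"
proof -
  have x: "px (replicate m True) + px (replicate n True) = px (replicate n True) + px (replicate (Suc m) True)"
    if "n < m" for m n
    using px_conj[OF seq_image_spine[OF that]] .
  have c: "comm (py s) (px t)" if "s \<parallel> t" for s t
    using comm_under[OF that, of "py []" "px []"] by (simp add: under_px under_py)
  note vals = base_val_y base_val_a_numeral base_val_a[of 0] base_val_x0 base_val_x00
    base_val_x10 Permu_base_gen
  from assms consider "(u, v) \<in> x_relations"
    | s w where "(u, v) = comm_rel (y_word s) w" "(s, w) \<in> comm_pairs"
    | s w where "(u, v) = y_expand_rel s w" "(s, w) \<in> expand_pairs"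
    | s t where "(u, v) = comm_rel (y_word s) (y_word t)" "s \<parallel> t"
    unfolding y_relations_def by blast
  then show ?thesis
  proof cases
    case 1
    then show ?thesis
      using x[of 1 2] x[of 1 3] by (auto simp: x_relations_def vals) (simp_all add: eval_nat_numeral)
  next
    case (2 s w)
    then have "comm (py s) (base_val w)"
      unfolding comm_pairs_def by (auto simp: vals intro!: c simp: parallel_def)
    with 2 show ?thesis by (simp add: comm_rel_def vals comm_def)
  next
    case (3 s w)
    then have "base_val w = px s" unfolding expand_pairs_def by (auto simp: vals)
    with 3 show ?thesis using py_expand[of s]
      by (simp add: y_expand_rel_def vals add.assoc diff_conv_add_uminus del: add_uminus_conv_diff)
  next
    case (4 s t)
    then show ?thesis using py_comm by (simp add: comm_rel_def vals)
  qed
qed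

text \<open>\<open>R3\<close> in a form that can be followed along sums and inverses of
  \<open>x\<close>; equations and commutation are transported with it.\<close>

definition intertwines :: "'g::group_add \<Rightarrow> 'g \<Rightarrow> 'g \<Rightarrow> bool" where
  "intertwines a x b \<longleftrightarrow> a + x = x + b"

lemma intertwines_compose: "intertwines a x b \<Longrightarrow> intertwines b y c \<Longrightarrow> intertwines a (x + y) c"
  unfolding intertwines_def by (metis add.assoc)

lemma intertwines_inverse: "intertwines a x b \<Longrightarrow> intertwines b (- x) a"
  unfolding intertwines_def using conj_swap[of a x b] by simp

lemma intertwines_conv: "intertwines a x b \<longleftrightarrow> b = - x + a + x"
  unfolding intertwines_def by (metis add.assoc add_minus_cancel minus_add_cancel)

lemma intertwines_add: "intertwines a x b \<Longrightarrow> intertwines a' x b' \<Longrightarrow> intertwines (a + a') x (b + b')"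
  unfolding intertwines_conv by (simp add: add.assoc)

lemma intertwines_uminus: "intertwines a x b \<Longrightarrow> intertwines (- a) x (- b)"
  unfolding intertwines_conv by (simp add: minus_add add.assoc)

lemma intertwines_eq_iff: "intertwines a x b \<Longrightarrow> intertwines a' x b' \<Longrightarrow> a = a' \<longleftrightarrow> b = b'"
  unfolding intertwines_conv by simp

lemma intertwines_comm_iff: "intertwines a x b \<Longrightarrow> intertwines a' x b' \<Longrightarrow> comm a a' \<longleftrightarrow> comm b b'"
  unfolding comm_def by (intro intertwines_eq_iff intertwines_add)

definition base_letters :: "(bool list \<Rightarrow> bool) \<Rightarrow> nat set" where
  "base_letters P = {0, 1} \<union> {k + 2 |k. k < 4 \<and> P (base_seqs ! k)}"

text \<open>The permutations themselves with the identity homomorphism; this yields that every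
  \<open>px s\<close> is generated by those on the right spine.\<close>

interpretation perm: LM px py "\<lambda>_. True" id
  by standard
     ((rule px_square py_expand TrueI refl | erule px_conj py_conj py_comm | simp add: additive_hom_def)+)

locale finite_rels = good_labels P
  for P :: "bool list \<Rightarrow> bool" +
  fixes \<psi> :: "nat \<Rightarrow> 'g::group_add" and \<rho> :: "'g \<Rightarrow> bool word permu"
  assumes hom: "additive_hom \<rho>"
    and \<rho>_\<psi>: "\<rho> (\<psi> k) = Permu (base_gen k)"
    and relations: "(u, v) \<in> x_relations \<union> y_relations P \<Longrightarrow> ev \<psi> u = ev \<psi> v"
begin

definition A :: "nat \<Rightarrow> 'g" where
  "A n = ev \<psi> (a_word n)"

lemma \<rho>_ev: "\<rho> (ev \<psi> w) = base_val w"
  using ev_hom[OF hom, of \<psi> w] by (simp add: \<rho>_\<psi>)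

lemma A_rec: "A 0 = \<psi> 0" "A (Suc 0) = \<psi> 1" "A (Suc (Suc n)) = - A 0 + A (Suc n) + A 0"
  by (simp_all add: A_def add.assoc)

sublocale thompson: thompson A \<rho>
proof
  show "A m + A n = A n + A (Suc m)" if "n < m" for n m
  proof (rule thompson_relations[OF _ _ _ that])
    show "A m + A 0 = A 0 + A (Suc m)" if "0 < m" for m
      using that A_rec(3)[of "m - 1"] by (simp add: add.assoc)
    show "A 2 + A 1 = A 1 + A 3" "A 3 + A 1 = A 1 + A 4"
      using relations[of "a_word 2 @ a_word 1" "a_word 1 @ a_word 3"]
        relations[of "a_word 3 @ a_word 1" "a_word 1 @ a_word 4"]
      by (simp_all add: x_relations_def A_def del: a_word.simps One_nat_def)
  qed
qed (simp_all add: hom A_def \<rho>_ev base_val_a)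

text \<open>Chosen through its action rather than as a word: F is already known to embed, so a
  single element generated by the \<open>A n\<close> lies over \<open>px s\<close>, and relations
  among the x_s hold because they hold for permutations.\<close>

definition X :: "bool list \<Rightarrow> 'g" where
  "X s = (SOME h. h \<in> gen (range A) \<and> \<rho> h = px s)"

lemma X_props: "X s \<in> gen (range A)" "\<rho> (X s) = px s"
proof -
  have "perm.A n \<in> \<rho> ` range A" for n
    unfolding perm.A_def by (auto simp: thompson.\<rho>_A intro: image_eqI[of _ \<rho> "A n"])
  then have "gen (range perm.A) \<subseteq> gen (\<rho> ` range A)" by (intro gen_mono) auto
  then have "\<exists>h. h \<in> gen (range A) \<and> \<rho> h = px s"
    using gen_image[OF hom] perm.X_in_gen_A by blast
  then show "X s \<in> gen (range A)" "\<rho> (X s) = px s"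
    unfolding X_def by (rule someI2_ex; simp)+
qed

lemma X_eqI: "h \<in> gen (range A) \<Longrightarrow> \<rho> h = px s \<Longrightarrow> X s = h"
  using thompson.faithful_eq X_props by metis

lemma X_replicate: "X (replicate n True) = A n"
  by (rule X_eqI) (auto intro: gen_intros simp: thompson.\<rho>_A)

lemma ev_X:
  assumes "w \<in> words_over {0, 1}" "base_val w = px s" shows "ev \<psi> w = X s"
proof (rule X_eqI[symmetric])
  have "gen (\<psi> ` {0, 1}) \<subseteq> gen (range A)"
    using A_rec(1,2) by (intro gen_mono) (auto intro: range_eqI[of _ A 0] range_eqI[of _ A "Suc 0"])
  then show "ev \<psi> w \<in> gen (range A)" using ev_in_gen[OF assms(1)] by blast
qed (simp add: \<rho>_ev assms(2))

lemma x_square: "X s + X s = X (s @ [False]) + X s + X (s @ [True])"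
  by (rule thompson.faithful_eq) (auto intro: gen_intros X_props simp: thompson.hom_simps X_props px_square)

lemma x_conj: "seq_image s t t' \<Longrightarrow> X t + X s = X s + X t'"
  by (rule thompson.faithful_eq) (auto intro: gen_intros X_props simp: thompson.hom_simps X_props px_conj)

lemma x_comm: "s \<parallel> t \<Longrightarrow> comm (X s) (X t)"
  using x_conj[OF seq_image.intros(1)] by (simp add: comm_def)

lemma x_intertwines: "seq_image s t t' \<Longrightarrow> intertwines (X t) (X s) (X t')"
  by (simp add: intertwines_def x_conj)

definition Y :: "bool list \<Rightarrow> 'g" where
  "Y s = ev \<psi> (y_word s)"

lemma X_A: "X [] = A 0" "X [True] = A 1"
  using X_replicate[of 0] X_replicate[of 1] by simp_all

text \<open>True by construction of the words, which conjugate along these very steps. The steps of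
  x_1 on sequences beginning with 0 or 11 are missing here and rest on the commutation
  relations.\<close>

lemma Y_intertwines:
  "intertwines (Y (False # False # u)) (A 0) (Y (False # u))"
  "intertwines (Y (False # True # u)) (A 0) (Y (True # False # u))"
  "intertwines (Y (True # u)) (A 0) (Y (True # True # u))"
  "intertwines (Y (True # False # False # u)) (A 1) (Y (True # False # u))"
  "intertwines (Y (True # False # True # u)) (A 1) (Y (True # True # False # u))"
  by (simp_all add: intertwines_conv Y_def A_rec add.assoc)

text \<open>The mirror image of the family \<open>A\<close>, along the left spine.\<close>

definition Z :: "nat \<Rightarrow> 'g" where
  "Z k = X (replicate (Suc k) False)"

lemma Z_intertwines: "intertwines (Z (Suc k)) (A 0) (Z k)"
  using x_intertwines[OF seq_image_Nil(1)[of "replicate k False"]] by (simp add: Z_def X_A)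

lemma Z_intertwines_Z: "intertwines (Z (Suc (Suc k))) (Z 0) (Z (Suc k))"
  using x_intertwines[OF seq_image_Cons(1)[of "[False]" "replicate k False"]] by (simp add: Z_def)

lemma Z_comm: "comm (Z k) (A 1)"
  unfolding Z_def X_A(2)[symmetric] by (rule x_comm) (simp add: parallel_def)

lemma A_intertwines: "n < m \<Longrightarrow> intertwines (A m) (A n) (A (Suc m))"
  by (simp add: intertwines_def thompson.rel)

lemma comm_intertwines_iff: "comm x g \<Longrightarrow> intertwines a x b \<Longrightarrow> comm g a \<longleftrightarrow> comm g b"
  by (rule intertwines_comm_iff[of g x g]) (simp_all add: intertwines_def comm_def)

text \<open>\<open>A (Suc j)\<close> conjugates each later element to the next, so commuting with
  two consecutive ones is enough. This is how finitely many commutation relations suffice.\<close>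

lemma comm_A_all:
  assumes "comm g (A (Suc j))" "comm g (A (Suc (Suc j)))" shows "comm g (A (Suc j + n))"
proof -
  have "comm g (A (Suc j + n)) \<and> comm g (A (Suc (Suc j + n)))"
  proof (induction n)
    case (Suc n)
    then show ?case
      using comm_intertwines_iff[OF comm_sym[OF assms(1)] A_intertwines[of "Suc j" "Suc (Suc j + n)"]] by simp
  qed (use assms in simp)
  then show ?thesis by blast
qed

lemma comm_Z_all:
  assumes "comm g (Z 0)" "comm g (Z 1)" shows "comm g (Z k)"
proof -
  have "comm g (Z k) \<and> comm g (Z (Suc k))"
  proof (induction k)
    case (Suc k)
    then show ?case using comm_intertwines_iff[OF comm_sym[OF assms(1)] Z_intertwines_Z[of k]] by simp
  qed (use assms in simp)
  then show ?thesis by blast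
qed

lemma y_relation:
  assumes "P s" "(s, w) \<in> comm_pairs" shows "comm (Y s) (ev \<psi> w)"
proof -
  have "comm_rel (y_word s) w \<in> y_relations P" using assms by (auto simp: y_relations_def)
  then show ?thesis
    using relations[of "y_word s @ w" "w @ y_word s"] by (simp add: comm_rel_def comm_def Y_def)
qed

lemma ev_x0: "ev \<psi> x0_word = Z 0"
  using ev_X[of x0_word "[False]"] base_val_x0 by (simp add: x0_word_def Z_def)

lemma ev_x00: "ev \<psi> x00_word = Z 1"
  using ev_X[of x00_word "[False, False]"] base_val_x00 by (simp add: x00_word_def x0_word_def Z_def)

lemma base_comms:
  "P [True, False] \<Longrightarrow> comm (Y [True, False]) (A (2 + n)) \<and> comm (Y [True, False]) (Z k)"
  "P [False] \<Longrightarrow> comm (Y [False]) (A (Suc n))"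
  "P [True] \<Longrightarrow> comm (Y [True]) (Z k)"
proof -
  show "comm (Y [True, False]) (A (2 + n)) \<and> comm (Y [True, False]) (Z k)" if "P [True, False]"
    using y_relation[OF that, of "a_word 2"] y_relation[OF that, of "a_word 3"]
      y_relation[OF that, of x0_word] y_relation[OF that, of x00_word]
      comm_A_all[of "Y [True, False]" 1 n] comm_Z_all[of "Y [True, False]" k]
    by (simp add: comm_pairs_def ev_x0 ev_x00 numeral_2_eq_2 numeral_3_eq_3 flip: A_def del: a_word.simps)
  show "comm (Y [False]) (A (Suc n))" if "P [False]"
    using y_relation[OF that, of "a_word 1"] y_relation[OF that, of "a_word 2"]
      comm_A_all[of "Y [False]" 0 n]
    by (simp add: comm_pairs_def numeral_2_eq_2 flip: A_def del: a_word.simps)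
  show "comm (Y [True]) (Z k)" if "P [True]"
    using y_relation[OF that, of x0_word] y_relation[OF that, of x00_word] comm_Z_all[of "Y [True]" k]
    by (simp add: comm_pairs_def ev_x0 ev_x00)
qed

text \<open>Conjugation by \<open>A 1\<close> or \<open>A 0\<close> shortens the sequence. Both
  raise the index of \<open>A (2 + n)\<close>, while \<open>A 1\<close> commutes with
  \<open>Z k\<close> and \<open>A 0\<close> lowers the index of \<open>Z\<close>; hence the claim
  for all \<open>n\<close> and \<open>k\<close> at once.\<close>

lemma comm_Y10:
  "P (True # False # u) \<Longrightarrow>
    comm (Y (True # False # u)) (A (2 + n)) \<and> comm (Y (True # False # u)) (Z k)"
proof (induction u arbitrary: n k)
  case Nil
  then show ?case using base_comms by blast
next
  case (Cons c u)
  show ?case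
  proof (cases c)
    case False
    have "P (True # False # u)" using Cons.prems good_image[OF seq_image_True(1)[of u]] False by simp
    note IH = Cons.IH[OF this]
    have "comm (Y (True # False # c # u)) (A (2 + n))"
      using intertwines_comm_iff[OF Y_intertwines(4)[of u] A_intertwines[of 1 "2 + n"]] IH[of "Suc n" k] False by simp
    moreover have "comm (Y (True # False # c # u)) (Z k)"
      using intertwines_comm_iff[OF Y_intertwines(4)[of u], of "Z k" "Z k"] IH[of n k] Z_comm[of k] False
      by (simp add: intertwines_def comm_def)
    ultimately show ?thesis by blast
  next
    case True
    have "P (True # False # u)"
      using Cons.prems good_image[OF seq_image_True(2)[of u]] True
        good_image[OF seq_image_Nil(3)[of "False # u"]] by simp
    note IH = Cons.IH[OF this]
    have "comm (Y (True # True # False # u)) (A (Suc (2 + n)))"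
      using intertwines_comm_iff[OF Y_intertwines(3)[of "False # u"] A_intertwines[of 0 "2 + n"]] IH[of n k] by simp
    then have "comm (Y (True # False # c # u)) (A (2 + n))"
      using intertwines_comm_iff[OF Y_intertwines(5)[of u] A_intertwines[of 1 "2 + n"]] True by simp
    moreover have "comm (Y (True # True # False # u)) (Z k)"
      using intertwines_comm_iff[OF Y_intertwines(3)[of "False # u"] Z_intertwines[of k]] IH[of n "Suc k"] by simp
    then have "comm (Y (True # False # c # u)) (Z k)"
      using intertwines_comm_iff[OF Y_intertwines(5)[of u], of "Z k" "Z k"] Z_comm[of k] True
      by (simp add: intertwines_def comm_def)
    ultimately show ?thesis by blast
  qed
qed

lemma comm_Y0: "P (False # u) \<Longrightarrow> comm (Y (False # u)) (A (Suc n))"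
proof (induction u arbitrary: n)
  case Nil
  then show ?case using base_comms by blast
next
  case (Cons c u)
  show ?case
  proof (cases c)
    case False
    have "P (False # u)" using Cons.prems good_image[OF seq_image_Nil(1)[of u]] False by simp
    then show ?thesis
      using intertwines_comm_iff[OF Y_intertwines(1)[of u] A_intertwines[of 0 "Suc n"]] Cons.IH[of "Suc n"] False by simp
  next
    case True
    have "P (True # False # u)" using Cons.prems good_image[OF seq_image_Nil(2)[of u]] True by simp
    then show ?thesis
      using intertwines_comm_iff[OF Y_intertwines(2)[of u] A_intertwines[of 0 "Suc n"]] comm_Y10[of u n] True by simp
  qed
qed

lemma comm_Y1: "P (True # u) \<Longrightarrow> comm (Y (True # u)) (Z k)"
proof (induction u arbitrary: k)
  case Nil
  then show ?case using base_comms by blast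
next
  case (Cons c u)
  show ?case
  proof (cases c)
    case False
    then show ?thesis using comm_Y10 Cons.prems by simp
  next
    case True
    have "P (True # u)" using Cons.prems good_image[OF seq_image_Nil(3)[of u]] True by simp
    then show ?thesis
      using intertwines_comm_iff[OF Y_intertwines(3)[of u] Z_intertwines[of k]] Cons.IH[of "Suc k"] True by simp
  qed
qed

text \<open>\<open>R1\<close> at the root writes x_1 as the inverse of x, the inverse of x_0, x and
  x again. This takes 11u to 1u, where x_0 commutes with the letter, then back to 11u and on to
  111u.\<close>

lemma Y_intertwines_A1: "P (True # True # u) \<Longrightarrow> intertwines (Y (True # True # u)) (A 1) (Y (True # True # True # u))"
proof -
  assume P: "P (True # True # u)"
  then have "P (True # u)" using good_image[OF seq_image_Nil(3)[of u]] by simp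
  then have "comm (Y (True # u)) (Z 0)" by (rule comm_Y1)
  then have t: "intertwines (Y (True # u)) (- Z 0) (Y (True # u))"
    using comm_uminus2[of "Y (True # u)" "Z 0"] by (simp add: intertwines_def comm_def)
  have Z: "Z 0 = A 0 + A 0 - A 1 - A 0"
    using square_solve[OF x_square[of "[]"]] by (simp add: Z_def X_A)
  have "intertwines (Y (True # True # u)) (- A 0 + - Z 0 + A 0 + A 0) (Y (True # True # True # u))"
    by (rule intertwines_compose[OF intertwines_compose[OF intertwines_compose[OF intertwines_inverse[OF Y_intertwines(3)] t] Y_intertwines(3)] Y_intertwines(3)])
  then show ?thesis unfolding Z by (simp add: minus_diff_eq minus_add add.assoc diff_conv_add_uminus del: add_uminus_conv_diff)
qed

lemma y_intertwines: "seq_image s t t' \<Longrightarrow> P t \<Longrightarrow> intertwines (Y t) (X s) (Y t')"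
proof -
  define Q where "Q s \<longleftrightarrow> (\<forall>t t'. seq_image s t t' \<longrightarrow> P t \<longrightarrow> intertwines (Y t) (X s) (Y t'))" for s
  have QD: "intertwines (Y t) (X s) (Y t')" if "Q s" "seq_image s t t'" "P t \<or> P t'" for s t t'
    using that good_image unfolding Q_def by blast
  have "Q s" for s
  proof (rule seq_induct)
    show "Q []" unfolding Q_def
    proof (intro allI impI)
      show "intertwines (Y t) (X []) (Y t')" if "seq_image [] t t'" for t t'
        using that Y_intertwines(1-3) by cases (auto simp: X_A)
    qed
    show "Q [True]" unfolding Q_def
    proof (intro allI impI)
      fix t t' assume "seq_image [True] t t'" and P: "P t"
      then show "intertwines (Y t) (X [True]) (Y t')"
      proof cases
        case 1
        then obtain u where "t = False # u"
          by (cases t) (auto simp: parallel_def)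
        with 1 P comm_Y0[of u 0] show ?thesis by (simp add: intertwines_def comm_def X_A)
      next
        case (4 u)
        then show ?thesis using Y_intertwines_A1[of u] P by (simp add: X_A)
      qed (use Y_intertwines(4,5) in \<open>auto simp: X_A\<close>)
    qed
  next
    fix r assume Q: "Q r" "Q (r @ [True])"
    show "Q (r @ [False])" unfolding Q_def
    proof (intro allI impI)
      fix t t2 assume t: "seq_image (r @ [False]) t t2" "P t"
      from seq_image_left_child[OF t(1)] obtain t1 p q where
        im: "seq_image r t t1" "seq_image r t1 p" "seq_image (r @ [True]) q p" "seq_image r t2 q" .
      have P: "P t1" "P p" "P q" "P t2"
        using t(2) good_image[OF im(1)] good_image[OF im(2)] good_image[OF im(3)] good_image[OF im(4)]
        by simp_all
      \<comment> \<open>The four summands take \<open>t\<close> to \<open>t1\<close>,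
        \<open>p\<close>, \<open>q\<close> and \<open>t2\<close> in turn.\<close>
      have "X (r @ [False]) = X r + X r + - X (r @ [True]) + - X r"
        using square_solve[OF x_square[of r]] by simp
      then show "intertwines (Y t) (X (r @ [False])) (Y t2)"
        using im P t(2) Q by (auto intro!: intertwines_compose intertwines_inverse QD simp del: add_uminus_conv_diff)
    qed
  next
    fix r u assume Q: "Q r" "Q (r @ False # u)"
    show "Q (r @ False # False # u)" unfolding Q_def
    proof (intro allI impI)
      fix t t2 assume t: "seq_image (r @ False # False # u) t t2" "P t"
      have s: "seq_image r (r @ False # False # u) (r @ False # u)" by (rule seq_image_Cons)
      from seq_image_conj_False[OF s _ t(1)] obtain t1 t3 where
        im: "seq_image r t t1" "seq_image (r @ False # u) t1 t3" "seq_image r t2 t3" by auto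
      have P: "P t1" "P t3" "P t2"
        using t(2) good_image[OF im(1)] good_image[OF im(2)] good_image[OF im(3)] by simp_all
      have "X (r @ False # False # u) = X r + X (r @ False # u) + - X r"
        using conj_eqs(1)[OF x_conj[OF s]] by simp
      then show "intertwines (Y t) (X (r @ False # False # u)) (Y t2)"
        using im P t(2) Q by (auto intro!: intertwines_compose intertwines_inverse QD simp del: add_uminus_conv_diff)
    qed
  next
    fix r u assume Q: "Q r" "Q (r @ True # False # u)"
    show "Q (r @ False # True # u)" unfolding Q_def
    proof (intro allI impI)
      fix t t2 assume t: "seq_image (r @ False # True # u) t t2" "P t"
      have s: "seq_image r (r @ False # True # u) (r @ True # False # u)" by (rule seq_image_Cons)
      from seq_image_conj_False[OF s _ t(1)] obtain t1 t3 where
        im: "seq_image r t t1" "seq_image (r @ True # False # u) t1 t3" "seq_image r t2 t3" by auto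
      have P: "P t1" "P t3" "P t2"
        using t(2) good_image[OF im(1)] good_image[OF im(2)] good_image[OF im(3)] by simp_all
      have "X (r @ False # True # u) = X r + X (r @ True # False # u) + - X r"
        using conj_eqs(1)[OF x_conj[OF s]] by simp
      then show "intertwines (Y t) (X (r @ False # True # u)) (Y t2)"
        using im P t(2) Q by (auto intro!: intertwines_compose intertwines_inverse QD simp del: add_uminus_conv_diff)
    qed
  next
    fix r u assume Q: "Q r" "Q (r @ True # u)"
    show "Q (r @ True # True # u)" unfolding Q_def
    proof (intro allI impI)
      fix t t2 assume t: "seq_image (r @ True # True # u) t t2" "P t"
      have s: "seq_image r (r @ True # u) (r @ True # True # u)" by (rule seq_image_Cons)
      from seq_image_conj_True[OF t(1)] obtain t0 t3 where
        im: "seq_image r t0 t" "seq_image (r @ True # u) t0 t3" "seq_image r t3 t2" .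
      have P: "P t0" "P t3" "P t2"
        using t(2) good_image[OF im(1)] good_image[OF im(2)] good_image[OF im(3)] by simp_all
      have "X (r @ True # True # u) = - X r + X (r @ True # u) + X r"
        using conj_eqs(2)[OF x_conj[OF s]] by simp
      then show "intertwines (Y t) (X (r @ True # True # u)) (Y t2)"
        using im P t(2) Q by (auto intro!: intertwines_compose intertwines_inverse QD simp del: add_uminus_conv_diff)
    qed
  qed
  then show "seq_image s t t' \<Longrightarrow> P t \<Longrightarrow> intertwines (Y t) (X s) (Y t')" using QD by blast
qed

text \<open>Conjugation by x_r carries both sides of \<open>R5\<close> at \<open>t\<close> to both
  sides at t.x_r, so the relation is needed only at the four orbit representatives.\<close>

lemma y_expand:
  assumes "P s"
  shows "Y s = X s + Y (s @ [False]) - Y (s @ [True, False]) + Y (s @ [True, True])"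
proof -
  define D where "D s = X s + Y (s @ [False]) + - Y (s @ [True, False]) + Y (s @ [True, True])" for s
  have inv: "(P t \<longrightarrow> Y t = D t) \<longleftrightarrow> (P t' \<longrightarrow> Y t' = D t')" if "seq_image r t t'" for r t t'
  proof (cases "P t")
    case True
    have "intertwines (D t) (X r) (D t')"
      unfolding D_def using that good_append[OF True]
      by (intro intertwines_add intertwines_uminus x_intertwines y_intertwines seq_image_append) simp_all
    then show ?thesis
      using intertwines_eq_iff[OF y_intertwines[OF that True]] True good_image[OF that] by simp
  qed (use that good_image in simp)
  have base: "P t \<longrightarrow> Y t = D t" if "(t, w) \<in> expand_pairs" "ev \<psi> w = X t" for t w
  proof
    assume "P t"
    then have "y_expand_rel t w \<in> y_relations P" using that(1) by (auto simp: y_relations_def)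
    then show "Y t = D t"
      using relations[of "fst (y_expand_rel t w)" "snd (y_expand_rel t w)"] that(2)
      by (simp add: y_expand_rel_def Y_def D_def add.assoc diff_conv_add_uminus del: add_uminus_conv_diff)
  qed
  have "P s \<longrightarrow> Y s = D s"
  proof (rule orbit_induct)
    show "P [] \<longrightarrow> Y [] = D []"
      by (rule base[of _ "a_word 0"]) (simp_all add: expand_pairs_def X_A A_rec)
    show "P [False] \<longrightarrow> Y [False] = D [False]"
      by (rule base[of _ x0_word]) (simp_all add: expand_pairs_def ev_x0 Z_def)
    show "P [True] \<longrightarrow> Y [True] = D [True]"
      by (rule base[of _ "a_word 1"]) (simp_all add: expand_pairs_def X_A A_rec)
    show "P [True, False] \<longrightarrow> Y [True, False] = D [True, False]"
    proof (rule base[of _ x10_word])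
      show "ev \<psi> x10_word = X [True, False]"
        by (rule ev_X[OF _ base_val_x10]) (simp add: x10_word_def words_over_append inv_word_def
            inv_letter_def numeral_2_eq_2)
    qed (simp add: expand_pairs_def)
  qed (fact inv)+
  with assms show ?thesis by (simp add: D_def)
qed

text \<open>The stem and the tails move independently: an x acting below one of the two branches
  changes only the tail there, and a step applied to \<open>w\<close> changes only the stem.\<close>

lemma y_comm_split:
  assumes "b \<noteq> c"
  shows "P (w @ b # u) \<longrightarrow> P (w @ c # v) \<longrightarrow> comm (Y (w @ b # u)) (Y (w @ c # v))"
proof -
  define C where "C w u v \<longleftrightarrow> (P (w @ b # u) \<longrightarrow> P (w @ c # v) \<longrightarrow> comm (Y (w @ b # u)) (Y (w @ c # v)))"
    for w u v
  have inv: "C w u v \<longleftrightarrow> C w' u' v'"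
    if "seq_image r (w @ b # u) (w' @ b # u')" "seq_image r (w @ c # v) (w' @ c # v')" for r w w' u u' v v'
    using intertwines_comm_iff[OF y_intertwines[OF that(1)] y_intertwines[OF that(2)]] good_image[OF that(1)] good_image[OF that(2)]
    unfolding C_def by blast
  have inv_u: "C w u v \<longleftrightarrow> C w u' v" if "seq_image q u u'" for q w u u' v
    using seq_image_prepend[OF that, of "w @ [b]"] assms
    by (intro inv[of "(w @ [b]) @ q"] seq_image.intros(1)) (auto simp: parallel_def)
  have inv_v: "C w u v \<longleftrightarrow> C w u v'" if "seq_image q v v'" for q w u v v'
    using seq_image_prepend[OF that, of "w @ [c]"] assms
    by (intro inv[of "(w @ [c]) @ q"] seq_image.intros(1)) (auto simp: parallel_def)
  have inv_w: "C w u v \<longleftrightarrow> C w' u v" if "seq_image q w w'" for q w w' u v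
    using that by (intro inv[of q] seq_image_append)
  have base: "C w u v" if "w \<in> set base_seqs" "u \<in> set base_seqs" "v \<in> set base_seqs" for w u v
    unfolding C_def
  proof (intro impI)
    assume "P (w @ b # u)" "P (w @ c # v)"
    moreover have "w @ b # u \<in> pair_seqs" "w @ c # v \<in> pair_seqs"
      using that by (auto simp: pair_seqs_def image_iff intro!: bexI)
    moreover have "w @ b # u \<parallel> w @ c # v" using assms by (simp add: Cons_parallelI1)
    ultimately have "comm_rel (y_word (w @ b # u)) (y_word (w @ c # v)) \<in> y_relations P"
      by (auto simp: y_relations_def)
    then show "comm (Y (w @ b # u)) (Y (w @ c # v))"
      using relations[of "y_word (w @ b # u) @ y_word (w @ c # v)" "y_word (w @ c # v) @ y_word (w @ b # u)"]
      by (simp add: comm_rel_def comm_def Y_def)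
  qed
  \<comment> \<open>Orbit inductions over \<open>u\<close>, \<open>v\<close> and \<open>w\<close>,
    each relying on the previous one at the representatives.\<close>
  have "C w u v" if "w \<in> set base_seqs" "v \<in> set base_seqs" for w u v
    by (rule orbit_induct[of "\<lambda>u. C w u v"]) (use that base inv_u in \<open>auto simp: base_seqs_def\<close>)
  then have "C w u v" if "w \<in> set base_seqs" for w u v
    by (rule_tac orbit_induct[of "\<lambda>v. C w u v"]) (use that inv_v in \<open>auto simp: base_seqs_def\<close>)
  then have "C w u v" for w u v
    by (rule_tac orbit_induct[of "\<lambda>w. C w u v"]) (use inv_w in \<open>auto simp: base_seqs_def\<close>)
  then show ?thesis by (simp add: C_def)
qed

sublocale lm: LM X Y P \<rho>
proof
  show "P s \<Longrightarrow> P (s @ u)" for s u by (rule good_append)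
  show "seq_image r s s' \<Longrightarrow> P s \<longleftrightarrow> P s'" for r s s' by (rule good_image)
  show "Y t + X s = X s + Y t'" if "seq_image s t t'" "P t" for s t t'
    using y_intertwines[OF that] by (simp add: intertwines_def)
  show "Y s + Y t = Y t + Y s" if st: "s \<parallel> t" "P s" "P t" for s t
  proof -
    obtain w b u c v where *: "b \<noteq> c" "s = w @ b # u" "t = w @ c # v"
      using parallel_decomp[OF st(1)] by blast
    have "P (w @ b # u)" "P (w @ c # v)" using st(2,3) *(2,3) by simp_all
    then have "comm (Y (w @ b # u)) (Y (w @ c # v))"
      using y_comm_split[OF *(1), of w u v] by (rule_tac mp[OF mp])
    then show ?thesis by (simp only: *(2,3) comm_def)
  qed
  show "\<rho> (Y s) = py s" for s by (simp add: Y_def \<rho>_ev base_val_y)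
  show "X s + X s = X (s @ [False]) + X s + X (s @ [True])" for s by (rule x_square)
  show "seq_image s t t' \<Longrightarrow> X t + X s = X s + X t'" for s t t' by (rule x_conj)
  show "P s \<Longrightarrow>
    Y s = X s + Y (s @ [False]) - Y (s @ [True, False]) + Y (s @ [True, True])" for s
    by (rule y_expand)
  show "additive_hom \<rho>" by (rule hom)
  show "\<rho> (X s) = px s" for s by (rule X_props)
qed

lemma ev_faithful:
  assumes "w \<in> words_over (base_letters P)" "base_val w = 0" shows "ev \<psi> w = 0"
proof (rule lm.LM_faithful)
  have "\<psi> k \<in> lm.XYG []" if "k \<in> base_letters P" for k
  proof -
    have "ev \<psi> (y_word (base_seqs ! j)) = \<psi> (j + 2)" if "j < 4" for j
    proof -
      have "j \<in> {0, 1, 2, 3}" using that by auto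
      then show ?thesis by (auto simp: base_seqs_def numeral_eq_Suc)
    qed
    then have "\<psi> k \<in> {X [], X [True]} \<union> {Y s |s. P s}"
      using that A_rec(1,2) X_A by (force simp: base_letters_def Y_def)
    then show ?thesis unfolding lm.XYG_def by (intro gen_incl) auto
  qed
  then have "gen (\<psi> ` base_letters P) \<subseteq> lm.XYG []"
    unfolding lm.XYG_def by (intro gen_subsetI) auto
  then show "ev \<psi> w \<in> lm.XYG []" using ev_in_gen[OF assms(1)] by blast
qed (simp add: \<rho>_ev assms(2))

end

section \<open>Finite presentations for both choices of generators\<close>

lemma finite_base_letters: "finite (base_letters P)"
  by (simp add: base_letters_def)

context good_labels
begin

lemma y10_word_over: "P (True # False # u) \<Longrightarrow> y10_word u \<in> words_over (base_letters P)"
proof (induction u rule: y10_word.induct)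
  case 1
  then show ?case by (auto simp: base_letters_def base_seqs_def intro!: exI[of _ 0])
next
  case (2 u)
  then have "P (True # False # u)" using good_image[OF seq_image_True(1)[of u]] by simp
  with 2 show ?case by (simp add: words_over_append base_letters_def)
next
  case (3 u)
  then have "P (True # False # u)"
    using good_image[OF seq_image_True(2)[of u]] good_image[OF seq_image_Nil(3)[of "False # u"]]
    by simp
  with 3 show ?case by (simp add: words_over_append base_letters_def)
qed

lemma y_word_over: "P s \<Longrightarrow> y_word s \<in> words_over (base_letters P)"
proof (induction s rule: y_word.induct)
  case 1
  then show ?case by (auto simp: base_letters_def base_seqs_def intro!: exI[of _ 3])
next
  case 2
  then show ?case by (auto simp: base_letters_def base_seqs_def intro!: exI[of _ 1])
next
  case 3
  then show ?case by (auto simp: base_letters_def base_seqs_def intro!: exI[of _ 2])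
next
  case (4 u)
  then show ?case using good_image[OF seq_image_Nil(1)[of u]]
    by (simp add: words_over_append) (simp add: base_letters_def)
next
  case (5 u)
  then show ?case using good_image[OF seq_image_Nil(2)[of u]] y10_word_over
    by (simp add: words_over_append) (simp add: base_letters_def)
next
  case (6 u)
  then show ?case using good_image[OF seq_image_Nil(3)[of u]]
    by (simp add: words_over_append) (simp add: base_letters_def)
qed (simp add: y10_word_over)

lemma a_word_over: "a_word n \<in> words_over (base_letters P)"
proof -
  have "0 \<in> base_letters P" "Suc 0 \<in> base_letters P" by (simp_all add: base_letters_def)
  then show ?thesis by (induction n rule: a_word.induct) (simp_all add: words_over_append)
qed

lemma relations_over:
  "x_relations \<union> y_relations P \<subseteq> words_over (base_letters P) \<times> words_over (base_letters P)"
proof -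
  have "0 \<in> base_letters P" "Suc 0 \<in> base_letters P" by (simp_all add: base_letters_def)
  then have "x0_word \<in> words_over (base_letters P)" "x00_word \<in> words_over (base_letters P)"
    "x10_word \<in> words_over (base_letters P)"
    using a_word_over by (simp_all add: x00_word_def x0_word_def x10_word_def words_over_append
        words_over_inv_word del: a_word.simps)
  then have w: "(s, w) \<in> comm_pairs \<Longrightarrow> w \<in> words_over (base_letters P)"
    "(s, w) \<in> expand_pairs \<Longrightarrow> w \<in> words_over (base_letters P)" for s w
    using a_word_over unfolding comm_pairs_def expand_pairs_def by (auto simp del: a_word.simps)
  have "x_relations \<subseteq> words_over (base_letters P) \<times> words_over (base_letters P)"
    using a_word_over unfolding x_relations_def by (auto simp: words_over_append simp del: a_word.simps)
  moreover have "y_relations P \<subseteq> words_over (base_letters P) \<times> words_over (base_letters P)"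
    unfolding y_relations_def comm_rel_def y_expand_rel_def
    by (auto simp: words_over_append dest: w
        intro!: words_over_inv_word y_word_over good_append)
  ultimately show ?thesis by blast
qed

theorem finitely_presented_gens: "finitely_presented (subgroup_generated homeo_group gens)"
proof -
  have "presentation (subgroup_generated homeo_group gens) base_gen (base_letters P)
    (x_relations \<union> y_relations P)"
  proof (rule homeo_presentation[OF gens_homeo _ relations_over])
    interpret H: group "homeo_group :: (bool word \<Rightarrow> bool word) monoid" by (rule group_homeo_group)
    have "base_gen k \<in> gens" if "k \<in> base_letters P" for k
      using that by (auto simp: base_letters_def base_gen_def)
    then show "base_gen \<in> base_letters P \<rightarrow> carrier (subgroup_generated homeo_group gens)"
      using H.subgroup_generated_subset_carrier_subset[OF gens_homeo] by auto
    let ?G = "gen ((\<lambda>k. Permu (base_gen k)) ` base_letters P)"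
    show "Permu b \<in> ?G" if "b \<in> gens" for b
    proof -
      have "perm.A n \<in> ?G" for n
        using ev_in_gen[OF a_word_over[of n]] base_val_a unfolding perm.A_def by metis
      then have "gen (range perm.A) \<subseteq> ?G" by (intro gen_subsetI) auto
      then have "px s \<in> ?G" for s using perm.X_in_gen_A by blast
      moreover have "py s \<in> ?G" if "P s" for s
        using ev_in_gen[OF y_word_over[OF that]] base_val_y by metis
      ultimately show ?thesis using that by (auto simp: gens_def X_gens_def px_def py_def)
    qed
    show "base_val u = base_val v" if "(u, v) \<in> x_relations \<union> y_relations P" for u v
      using base_val_relations[OF that] .
    fix \<psi> :: "nat \<Rightarrow> nat letter list set permu" and w
    assume rel: "\<forall>(u, v)\<in>x_relations \<union> y_relations P. ev \<psi> u = ev \<psi> v"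
      and w: "w \<in> words_over (base_letters P)" "base_val w = 0"
    let ?k = "\<lambda>k. (\<psi> k, Permu (base_gen k))"
    have fst: "fst (ev ?k u) = ev \<psi> u" and snd: "snd (ev ?k u) = base_val u" for u
      using ev_hom[of fst ?k u] ev_hom[of snd ?k u] by (simp_all add: additive_hom_def)
    interpret finite_rels P ?k snd
    proof
      show "ev ?k u = ev ?k v" if "(u, v) \<in> x_relations \<union> y_relations P" for u v
        using rel that base_val_relations[OF that] by (auto simp: prod_eq_iff fst snd)
    qed (simp_all add: additive_hom_def)
    show "ev \<psi> w = 0" using ev_faithful[OF w] fst[of w] by simp
  qed
  moreover have "finite (x_relations \<union> y_relations P)"
    using finite_x_relations finite_y_relations by blast
  ultimately show ?thesis
    unfolding finitely_presented_def using finite_base_letters by blast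
qed

end

lemma R_rels_over: "R_rels \<subseteq> words_over S_gens \<times> words_over S_gens"
proof -
  have "x_at s \<in> S_gens" "y_at s \<in> S_gens" for s
    by (auto simp: S_gens_def X_gens_def Y_gens_def)
  then show ?thesis
    by (auto elim!: R_rels.cases simp: xl_def yl_def)
qed

theorem theorem3p3:
  shows "presentation LM_group (\<lambda>g. g) S_gens R_rels \<and>
         presentation LM0_group (\<lambda>g. g) S0_gens R0_rels \<and>
         finitely_presented LM_group \<and>
         finitely_presented LM0_group"
proof -
  interpret all: good_labels "\<lambda>_. True" by standard simp_all
  \<comment> \<open>A step of the partial action does not change which digits occur in a
    sequence.\<close>
  interpret nonconst: good_labels "\<lambda>s. False \<in> set s \<and> True \<in> set s"
    by standard (auto elim: seq_image.cases)
  have "all.gens = S_gens"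
    unfolding all.gens_def S_gens_def Y_gens_def by auto
  moreover from this have "all.rels = R_rels"
    unfolding all.rels_def using R_rels_over by auto
  moreover have "nonconst.gens = S0_gens"
    unfolding nonconst.gens_def S0_gens_def Y0_gens_def ..
  moreover from this have "nonconst.rels = R0_rels"
    unfolding nonconst.rels_def R0_rels_def by simp
  ultimately show ?thesis
    using all.presentation_gens nonconst.presentation_gens
      all.finitely_presented_gens nonconst.finitely_presented_gens
    unfolding LM_group_def LM0_group_def by simp
qed

end
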